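(* Let $\mathbf{A}$ be a UHF algebra with a computable presentation $\mathbf{A}^\#$. Then $\mathbf{A}^\#$ has a computable UHF certificate $(n_j,\psi_j)_{j\in\mathbb{N}}$ such that $\psi_{j+1}^{-1}\circ\psi_j=\mathcal{E}_{n_j,n_{j+1}}$ for all $j$.
   Context: A UHF algebra is a unital $\mathrm{C}^*$-algebra isomorphic to an inductive limit of full matrix algebras with unital connecting embeddings. A presentation of a $\mathrm{C}^*$-algebra is a sequence generating a dense $*$-subalgebra; its rational points are $*$-polynomials with $\mathbb{Q}(i)$ coefficients and no constant term in it, effectively enumerated; it is computable if an algorithm, given a rational point $q$ and $k$, outputs a rational $r$ with $|\|q\|-r|<2^{-k}$. $M_n(\mathbb{C})$ carries its standard presentation whose special points are the matrices $\alpha E_{r,s}$ with $\alpha\in\mathbb{Q}(i)$ and $E_{r,s}$ the matrix units. A bounded linear map is computable between presentations if an algorithm, given a rational point $a$ of the domain and $k$, outputs a rational point of the target within $2^{-k}$ of the image of $a$. A UHF certificate of $\mathbf{A}$ is a sequence $(n_j,\psi_j)_{j\in\mathbb{N}}$ of positive integers $n_j$ and unital embeddings $\psi_j:M_{n_j}(\mathbb{C})\to\mathbf{A}$ with $\mathrm{ran}(\psi_j)\subseteq\mathrm{ran}(\psi_{j+1})$ and $\mathbf{A}=\overline{\bigcup_j\mathrm{ran}(\psi_j)}$; it is a computable UHF certificate of $\mathbf{A}^\#$ if $(n_j)$ is computable and the $\psi_j$ are computable maps from $M_{n_j}(\mathbb{C})$ to $\mathbf{A}^\#$ uniformly in $j$.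 For $m\mid n$, $\mathcal{E}_{m,n}:M_m(\mathbb{C})\to M_n(\mathbb{C})$ is the embedding $A\mapsto\mathrm{diag}(A,\ldots,A)$ ($n/m$ copies). *)

theory Defs
  imports
    "HOL-Analysis.Elementary_Topology"
    "HOL-Library.Nat_Bijection"
    "Jordan_Normal_Form.Schur_Decomposition"
begin

section \<open>Unital C*-algebras\<close>

text \<open>The superclass \<^class>\<open>real_normed_algebra_1\<close> contains \<open>norm 1 = 1\<close>, so the
  zero algebra, which is not a UHF algebra, is not in the class.\<close>

class unital_cstar_algebra = real_normed_algebra_1 + complete_space +
  fixes scaleC :: "complex \<Rightarrow> 'a \<Rightarrow> 'a"
    and adj :: "'a \<Rightarrow> 'a"
  assumes scaleR_scaleC: "scaleR r x = scaleC (complex_of_real r) x"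
    and scaleC_add_right: "scaleC c (x + y) = scaleC c x + scaleC c y"
    and scaleC_add_left: "scaleC (c + d) x = scaleC c x + scaleC d x"
    and scaleC_scaleC: "scaleC c (scaleC d x) = scaleC (c * d) x"
    and mult_scaleC_left: "scaleC c x * y = scaleC c (x * y)"
    and mult_scaleC_right: "x * scaleC c y = scaleC c (x * y)"
    and norm_scaleC: "norm (scaleC c x) = cmod c * norm x"
    and adj_adj: "adj (adj x) = x"
    and adj_add: "adj (x + y) = adj x + adj y"
    and adj_scaleC: "adj (scaleC c x) = scaleC (cnj c) (adj x)"
    and adj_mult: "adj (x * y) = adj y * adj x"
    and norm_adj_mult_self: "norm (adj x * x) = (norm x)\<^sup>2"

definition star_subalgebra :: "'a::unital_cstar_algebra set \<Rightarrow> bool" where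
  "star_subalgebra S \<longleftrightarrow>
     0 \<in> S \<and> (\<forall>x\<in>S. \<forall>y\<in>S. x + y \<in> S \<and> x * y \<in> S) \<and>
     (\<forall>x\<in>S. adj x \<in> S \<and> (\<forall>c. scaleC c x \<in> S))"

text \<open>The matrix algebras have a dimension varying with \<open>j\<close>, so they are not types.
  The *-algebra operations are therefore bundled with a carrier, and a type of class
  \<^class>\<open>unital_cstar_algebra\<close> is also viewed as such a bundle.\<close>

record 'a star_algebra = "(complex, 'a) module" +
  involution :: "'a \<Rightarrow> 'a"

definition whole_algebra :: "'a::unital_cstar_algebra star_algebra" where
  "whole_algebra =
     \<lparr> carrier = UNIV, monoid.mult = (*), monoid.one = 1, ring.zero = 0, ring.add = (+),
       module.smult = scaleC, involution = adj \<rparr>"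

definition matrix_algebra :: "nat \<Rightarrow> complex mat star_algebra" where
  "matrix_algebra n =
     \<lparr> carrier = carrier_mat n n, monoid.mult = (*), monoid.one = 1\<^sub>m n, ring.zero = 0\<^sub>m n n, ring.add = (+),
       module.smult = (\<cdot>\<^sub>m), involution = mat_adjoint \<rparr>"

definition unital_star_hom ::
    "'a star_algebra \<Rightarrow> 'b star_algebra \<Rightarrow> ('a \<Rightarrow> 'b) set" where
  "unital_star_hom P Q =
     {h \<in> Ring.ring_hom P Q. \<forall>x\<in>carrier P.
        (\<forall>c. h (module.smult P c x) = module.smult Q c (h x)) \<and>
        h (involution P x) = involution Q (h x)}"

definition unital_embedding ::
    "'a star_algebra \<Rightarrow> 'b star_algebra \<Rightarrow> ('a \<Rightarrow> 'b) set" where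
  "unital_embedding P Q = {h \<in> unital_star_hom P Q. inj_on h (carrier P)}"


section \<open>UHF algebras\<close>

definition l2_norm_vec :: "complex vec \<Rightarrow> real" where
  "l2_norm_vec v = sqrt (\<Sum>i<dim_vec v. (cmod (v $ i))\<^sup>2)"

definition operator_norm_mat :: "complex mat \<Rightarrow> real" where
  "operator_norm_mat X =
     (SUP v\<in>{v \<in> carrier_vec (dim_col X). l2_norm_vec v \<le> 1}. l2_norm_vec (X *\<^sub>v v))"

text \<open>\<open>connecting \<phi> j k\<close> is the composition \<open>\<phi> (j + k - 1) \<circ> \<dots> \<circ> \<phi> j\<close>.\<close>

primrec connecting :: "(nat \<Rightarrow> 'b \<Rightarrow> 'b) \<Rightarrow> nat \<Rightarrow> nat \<Rightarrow> 'b \<Rightarrow> 'b" where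
  "connecting \<phi> j 0 x = x"
| "connecting \<phi> j (Suc k) x = \<phi> (j + k) (connecting \<phi> j k x)"

text \<open>The C*-algebraic inductive limit is the completion of the algebraic direct limit with
  respect to the seminorm that sends the class of \<open>x\<close> in stage \<open>j\<close> to the limit of the norms
  of its images in the later stages. So \<open>'a\<close>, with the maps \<open>\<mu> j\<close>, is (isomorphic to) the
  limit iff the \<open>\<mu> j\<close> are compatible homomorphisms, the induced map on the algebraic limit
  preserves this seminorm, and its range is dense (\<open>'a\<close> being complete).\<close>

definition matrix_inductive_limit ::
    "(nat \<Rightarrow> nat) \<Rightarrow> (nat \<Rightarrow> complex mat \<Rightarrow> complex mat) \<Rightarrow>
     (nat \<Rightarrow> complex mat \<Rightarrow> 'a::unital_cstar_algebra) \<Rightarrow> bool" where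
  "matrix_inductive_limit n \<phi> \<mu> \<longleftrightarrow>
     (\<forall>j. \<mu> j \<in> unital_star_hom (matrix_algebra (n j)) whole_algebra) \<and>
     (\<forall>j. \<forall>X\<in>carrier_mat (n j) (n j). \<mu> (Suc j) (\<phi> j X) = \<mu> j X) \<and>
     (\<forall>j. \<forall>X\<in>carrier_mat (n j) (n j).
        (\<lambda>k. operator_norm_mat (connecting \<phi> j k X)) \<longlonglongrightarrow> norm (\<mu> j X)) \<and>
     closure (\<Union>j. \<mu> j ` carrier_mat (n j) (n j)) = UNIV"

definition UHF_algebra :: "'a::unital_cstar_algebra itself \<Rightarrow> bool" where
  "UHF_algebra _ \<longleftrightarrow>
     (\<exists>n \<phi> (\<mu> :: nat \<Rightarrow> complex mat \<Rightarrow> 'a).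
        (\<forall>j. n j > 0) \<and>
        (\<forall>j. \<phi> j \<in> unital_embedding (matrix_algebra (n j)) (matrix_algebra (n (Suc j)))) \<and>
        matrix_inductive_limit n \<phi> \<mu>)"

definition UHF_certificate ::
    "(nat \<Rightarrow> nat) \<Rightarrow> (nat \<Rightarrow> complex mat \<Rightarrow> 'a::unital_cstar_algebra) \<Rightarrow> bool" where
  "UHF_certificate n \<psi> \<longleftrightarrow>
     (\<forall>j. n j > 0) \<and>
     (\<forall>j. \<psi> j \<in> unital_embedding (matrix_algebra (n j)) whole_algebra) \<and>
     (\<forall>j. \<psi> j ` carrier_mat (n j) (n j) \<subseteq>
            \<psi> (Suc j) ` carrier_mat (n (Suc j)) (n (Suc j))) \<and>
     closure (\<Union>j. \<psi> j ` carrier_mat (n j) (n j)) = UNIV"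

text \<open>The embedding sending \<open>X\<close> to \<open>diag(X, \<dots>, X)\<close>, meant for \<open>m\<close> dividing \<open>n\<close>.\<close>

definition diag_embedding :: "nat \<Rightarrow> nat \<Rightarrow> complex mat \<Rightarrow> complex mat" where
  "diag_embedding m n X = diag_block_mat (replicate (n div m) X)"


section \<open>Total recursive functions\<close>

text \<open>\<open>total_recursive k f\<close>: on argument lists of length \<open>k\<close>, \<open>f\<close> is a (total) recursive
  function of \<open>k\<close> arguments. Minimization is restricted to the regular case, which loses no
  total function. Values on lists of other lengths are irrelevant.\<close>

inductive total_recursive :: "nat \<Rightarrow> (nat list \<Rightarrow> nat) \<Rightarrow> bool" where
  zero: "total_recursive k (\<lambda>xs. 0)"
| succ: "total_recursive 1 (\<lambda>xs. Suc (xs ! 0))"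
| proj: "i < k \<Longrightarrow> total_recursive k (\<lambda>xs. xs ! i)"
| comp: "total_recursive (length gs) f \<Longrightarrow> (\<forall>g\<in>set gs. total_recursive k g) \<Longrightarrow>
    total_recursive k (\<lambda>xs. f (map (\<lambda>g. g xs) gs))"
| prec: "total_recursive k f \<Longrightarrow> total_recursive (k + 2) g \<Longrightarrow>
    total_recursive (k + 1)
      (\<lambda>xs. rec_nat (f (tl xs)) (\<lambda>y r. g (y # r # tl xs)) (hd xs))"
| mini: "total_recursive (k + 1) f \<Longrightarrow> (\<forall>xs. length xs = k \<longrightarrow> (\<exists>y. f (y # xs) = 0)) \<Longrightarrow>
    total_recursive k (\<lambda>xs. LEAST y. f (y # xs) = 0)"


section \<open>Presentations and their rational points\<close>

definition rat_of_code :: "nat \<Rightarrow> rat" where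
  "rat_of_code m = (case prod_decode m of (a, b) \<Rightarrow> of_int (int_decode a) / of_nat (Suc b))"

definition gaussian_rat_of_code :: "nat \<Rightarrow> complex" where
  "gaussian_rat_of_code m =
     (case prod_decode m of (a, b) \<Rightarrow>
        Complex (of_rat (rat_of_code a)) (of_rat (rat_of_code b)))"

text \<open>Formal *-polynomials without constant term are coded by natural numbers: a polynomial
  is a list of monomials, a monomial is a coefficient with a nonempty word of letters, and a
  letter is a variable or the adjoint of a variable. The following functions evaluate
  the code at a sequence \<open>s\<close> of special points.\<close>

definition letter_point :: "'a star_algebra \<Rightarrow> (nat \<Rightarrow> 'a) \<Rightarrow> nat \<Rightarrow> 'a" where
  "letter_point P s m =
     (case sum_decode m of Inl i \<Rightarrow> s i | Inr i \<Rightarrow> involution P (s i))"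

definition monomial_point :: "'a star_algebra \<Rightarrow> (nat \<Rightarrow> 'a) \<Rightarrow> nat \<Rightarrow> 'a" where
  "monomial_point P s m =
     (case prod_decode m of (c, w) \<Rightarrow> case prod_decode w of (l, ls) \<Rightarrow>
        module.smult P (gaussian_rat_of_code c)
          (foldl (monoid.mult P) (letter_point P s l) (map (letter_point P s) (list_decode ls))))"

definition rational_point :: "'a star_algebra \<Rightarrow> (nat \<Rightarrow> 'a) \<Rightarrow> nat \<Rightarrow> 'a" where
  "rational_point P s m =
     foldr (ring.add P) (map (monomial_point P s) (list_decode m)) (ring.zero P)"

definition presentation :: "(nat \<Rightarrow> 'a::unital_cstar_algebra) \<Rightarrow> bool" where
  "presentation s \<longleftrightarrow> closure (star_subalgebra hull (range s)) = UNIV"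

definition computable_presentation :: "(nat \<Rightarrow> 'a::unital_cstar_algebra) \<Rightarrow> bool" where
  "computable_presentation s \<longleftrightarrow>
     presentation s \<and>
     (\<exists>F. total_recursive 2 F \<and>
        (\<forall>q k. \<bar>norm (rational_point whole_algebra s q) - of_rat (rat_of_code (F [q, k]))\<bar>
                 < (1 / 2) ^ k))"

text \<open>An enumeration of all \<open>\<alpha> E\<^sub>r\<^sub>,\<^sub>t\<close> with \<open>\<alpha>\<close> a Gaussian rational and \<open>r, t < n\<close>
  (indices start at 0; reduction modulo \<open>n\<close> keeps them in range).\<close>

definition standard_special_point :: "nat \<Rightarrow> nat \<Rightarrow> complex mat" where
  "standard_special_point n m =
     (case prod_decode m of (c, e) \<Rightarrow> case prod_decode e of (r, t) \<Rightarrow>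
        mat n n (\<lambda>(i, j). if i = r mod n \<and> j = t mod n then gaussian_rat_of_code c else 0))"

text \<open>The maps \<open>f j\<close>, from the algebra \<open>P j\<close> presented by \<open>p j\<close> to the algebra presented
  by \<open>s\<close>, are computable uniformly in \<open>j\<close>.\<close>

definition uniformly_computable_maps ::
    "(nat \<Rightarrow> 'b star_algebra) \<Rightarrow> (nat \<Rightarrow> nat \<Rightarrow> 'b) \<Rightarrow> (nat \<Rightarrow> 'a::unital_cstar_algebra) \<Rightarrow>
     (nat \<Rightarrow> 'b \<Rightarrow> 'a) \<Rightarrow> bool" where
  "uniformly_computable_maps P p s f \<longleftrightarrow>
     (\<exists>F. total_recursive 3 F \<and>
        (\<forall>j q k. norm (f j (rational_point (P j) (p j) q) -
                       rational_point whole_algebra s (F [j, q, k])) < (1 / 2) ^ k))"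

definition computable_UHF_certificate ::
    "(nat \<Rightarrow> 'a::unital_cstar_algebra) \<Rightarrow> (nat \<Rightarrow> nat) \<Rightarrow> (nat \<Rightarrow> complex mat \<Rightarrow> 'a) \<Rightarrow> bool"
  where
  "computable_UHF_certificate s n \<psi> \<longleftrightarrow>
     UHF_certificate n \<psi> \<and>
     (\<exists>F. total_recursive 1 F \<and> (\<forall>j. n j = F [j])) \<and>
     uniformly_computable_maps (\<lambda>j. matrix_algebra (n j))
       (\<lambda>j. standard_special_point (n j)) s \<psi>"

end

theory Submission
  imports Defs "HOL-Analysis.Elementary_Metric_Spaces"
begin

text \<open>
  Elements that satisfy the relations of a system of matrix units up to a small explicit error
  are close to an exact system, by a Newton iteration. So, in a computable presentation, a search
  for rational approximations of matrix units can decide when to stop. Starting from the trivial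
  system, one searches for finer and finer systems: the sums of the new units along the diagonal
  blocks approximate the preceding system, and the next rational point is almost in the span of
  the new units. Such a system exists because the algebra is UHF: the preceding approximate system
  is close to an exact one inside one of the given matrix algebras, where Gram-Schmidt refines it
  to a full system of matrix units. The diagonal sums of the later systems converge at a
  computable rate, and their limits are exact systems, each the diagonal sum of the next one.
\<close>

section \<open>Computability of numerical functions\<close>

text \<open>The matrix algebras supplied by the UHF hypothesis are not given effectively, so they
  can only certify that a search ends; the search itself may look at nothing but norms of rational
  points. Norms are known up to an error, so equations cannot be tested, and every condition is a
  strict inequality tested with a gap: what is accepted is a little weaker than what is shown to
  occur. The exact systems near the states are never computed and appear in the estimates only.

  An error made at one stage reaches every earlier level multiplied by a number of diagonal blocks,
  and then by the Lipschitz constant of the polynomial being evaluated. Both factors must be known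
  when the tolerance is chosen; hence a single number, the precision, bounds dimension and
  polynomial at once and grows strictly.

  The form diag(X, ..., X) requires no conjugation by a unitary afterwards: an orthonormal basis of
  the range of the first coarse diagonal unit is transported by the coarse units to the other
  ranges, and numbering the basis vectors as a + l * N makes the coarse system the diagonal sum of
  the fine one by construction.\<close>

text \<open>The definition of \<^const>\<open>total_recursive\<close> also fixes values on argument lists of the wrong
  length, which are irrelevant.\<close>

definition total_rec_agree :: "nat \<Rightarrow> (nat list \<Rightarrow> nat) \<Rightarrow> bool" where
  "total_rec_agree k f \<longleftrightarrow> (\<exists>g. total_recursive k g \<and> (\<forall>xs. length xs = k \<longrightarrow> g xs = f xs))"

lemma total_rec_agree_proj: "i < k \<Longrightarrow> total_rec_agree k (\<lambda>xs. xs ! i)"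
  unfolding total_rec_agree_def using total_recursive.proj by blast

lemma total_rec_agree_zero: "total_rec_agree k (\<lambda>xs. 0)"
  unfolding total_rec_agree_def using total_recursive.zero by blast

lemma total_rec_agree_comp_list:
  assumes "total_rec_agree (length gs) f" and "\<And>g. g \<in> set gs \<Longrightarrow> total_rec_agree k g"
  shows "total_rec_agree k (\<lambda>xs. f (map (\<lambda>g. g xs) gs))"
proof -
  obtain f' where f': "total_recursive (length gs) f'" "\<And>xs. length xs = length gs \<Longrightarrow> f' xs = f xs"
    using assms(1) unfolding total_rec_agree_def by blast
  obtain w where w: "\<And>g. g \<in> set gs \<Longrightarrow> total_recursive k (w g)"
      "\<And>g xs. g \<in> set gs \<Longrightarrow> length xs = k \<Longrightarrow> w g xs = g xs"
    using assms(2) unfolding total_rec_agree_def by metis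
  have "total_recursive k (\<lambda>xs. f' (map (\<lambda>g. g xs) (map w gs)))"
    by (rule total_recursive.comp) (use f' w in auto)
  moreover have "f' (map (\<lambda>g. g xs) (map w gs)) = f (map (\<lambda>g. g xs) gs)" if "length xs = k" for xs
  proof -
    have "map (\<lambda>g. g xs) (map w gs) = map (\<lambda>g. g xs) gs" using w(2) that by (simp add: comp_def)
    then show ?thesis using f'(2)[of "map (\<lambda>g. g xs) gs"] by (simp del: map_map)
  qed
  ultimately show ?thesis unfolding total_rec_agree_def by blast
qed

lemma total_rec_agree_comp1:
  assumes "total_rec_agree (Suc 0) (\<lambda>xs. f (xs ! 0))" and "total_rec_agree k g"
  shows "total_rec_agree k (\<lambda>xs. f (g xs))"
  using total_rec_agree_comp_list[of "[g]" "\<lambda>xs. f (xs ! 0)" k] assms by simp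

lemma total_rec_agree_comp2:
  assumes "total_rec_agree (Suc (Suc 0)) (\<lambda>xs. f (xs ! 0) (xs ! 1))"
    and "total_rec_agree k g" "total_rec_agree k h"
  shows "total_rec_agree k (\<lambda>xs. f (g xs) (h xs))"
  using total_rec_agree_comp_list[of "[g, h]" "\<lambda>xs. f (xs ! 0) (xs ! 1)" k] assms by auto

lemma total_rec_agree_Suc:
  assumes "total_rec_agree k g"
  shows "total_rec_agree k (\<lambda>xs. Suc (g xs))"
proof (rule total_rec_agree_comp1[OF _ assms])
  show "total_rec_agree (Suc 0) (\<lambda>xs. Suc (xs ! 0))"
    unfolding total_rec_agree_def using total_recursive.succ by (metis One_nat_def)
qed

lemma total_rec_agree_cong:
  "total_rec_agree k f \<Longrightarrow> (\<And>xs. length xs = k \<Longrightarrow> f xs = g xs) \<Longrightarrow> total_rec_agree k g"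
  unfolding total_rec_agree_def by auto

lemma total_rec_agree_prec:
  assumes "total_rec_agree k f" and "total_rec_agree (Suc (Suc k)) g"
  shows "total_rec_agree (Suc k) (\<lambda>xs. rec_nat (f (tl xs)) (\<lambda>y r. g (y # r # tl xs)) (hd xs))"
proof -
  obtain f' where f': "total_recursive k f'" "\<And>xs. length xs = k \<Longrightarrow> f' xs = f xs"
    using assms(1) unfolding total_rec_agree_def by blast
  obtain g' where g': "total_recursive (k + 2) g'" "\<And>xs. length xs = k + 2 \<Longrightarrow> g' xs = g xs"
    using assms(2) unfolding total_rec_agree_def by auto
  have "total_recursive (k + 1) (\<lambda>xs. rec_nat (f' (tl xs)) (\<lambda>y r. g' (y # r # tl xs)) (hd xs))"
    by (rule total_recursive.prec) fact+
  moreover have "rec_nat (f' (tl xs)) (\<lambda>y r. g' (y # r # tl xs)) n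
      = rec_nat (f (tl xs)) (\<lambda>y r. g (y # r # tl xs)) n" if "length xs = k + 1" for xs n
    by (induction n) (use that f'(2) g'(2) in auto)
  ultimately show ?thesis unfolding total_rec_agree_def by auto
qed

lemma total_rec_agree_mini:
  assumes "total_rec_agree (Suc k) f" and "\<And>xs. length xs = k \<Longrightarrow> \<exists>y. f (y # xs) = 0"
  shows "total_rec_agree k (\<lambda>xs. LEAST y. f (y # xs) = 0)"
proof -
  obtain f' where f': "total_recursive (k + 1) f'" "\<And>xs. length xs = Suc k \<Longrightarrow> f' xs = f xs"
    using assms(1) unfolding total_rec_agree_def by auto
  have "total_recursive k (\<lambda>xs. LEAST y. f' (y # xs) = 0)"
    by (rule total_recursive.mini) (use f' assms(2) in auto)
  then show ?thesis using f' unfolding total_rec_agree_def by auto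
qed

lemma total_rec_agree_rec1:
  assumes "total_rec_agree (Suc (Suc 0)) (\<lambda>xs. g (xs ! 0) (xs ! 1))"
  shows "total_rec_agree (Suc 0) (\<lambda>xs. rec_nat a (\<lambda>y r. g y r) (xs ! 0))"
proof -
  have c: "total_rec_agree 0 (\<lambda>xs. b)" for b
    by (induction b) (auto intro: total_rec_agree_zero total_rec_agree_Suc)
  show ?thesis
    by (rule total_rec_agree_cong[OF total_rec_agree_prec[OF c[of a] assms]])
      (auto simp: length_Suc_conv)
qed

lemma total_rec_agree_rec2:
  assumes "total_rec_agree (Suc 0) (\<lambda>xs. f (xs ! 0))"
    and "total_rec_agree (Suc (Suc (Suc 0))) (\<lambda>xs. g (xs ! 0) (xs ! 1) (xs ! 2))"
  shows "total_rec_agree (Suc (Suc 0)) (\<lambda>xs. rec_nat (f (xs ! 1)) (\<lambda>y r. g y r (xs ! 1)) (xs ! 0))"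
  by (rule total_rec_agree_cong[OF total_rec_agree_prec[OF assms]])
    (auto simp: length_Suc_conv)

lemma total_rec_agree_add_args: "total_rec_agree (Suc (Suc 0)) (\<lambda>xs. xs ! 0 + xs ! 1)"
proof (rule total_rec_agree_cong[OF total_rec_agree_rec2[of "\<lambda>x. x" "\<lambda>y r x. Suc r"]])
  fix xs :: "nat list"
  have "rec_nat b (\<lambda>y r. Suc r) a = a + b" for a b by (induction a) auto
  then show "rec_nat (xs ! 1) (\<lambda>y r. Suc r) (xs ! 0) = xs ! 0 + xs ! 1" .
qed (auto intro!: total_rec_agree_Suc total_rec_agree_proj)

lemmas total_rec_agree_add = total_rec_agree_comp2[OF total_rec_agree_add_args]

lemma total_rec_agree_mult_args: "total_rec_agree (Suc (Suc 0)) (\<lambda>xs. xs ! 0 * xs ! 1)"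
proof (rule total_rec_agree_cong[OF total_rec_agree_rec2[of "\<lambda>x. 0" "\<lambda>y r x. r + x"]])
  fix xs :: "nat list"
  have "rec_nat 0 (\<lambda>y r. r + b) a = a * b" for a b :: nat by (induction a) auto
  then show "rec_nat 0 (\<lambda>y r. r + xs ! 1) (xs ! 0) = xs ! 0 * xs ! 1" .
qed (auto intro!: total_rec_agree_add total_rec_agree_proj total_rec_agree_zero)

lemmas total_rec_agree_mult = total_rec_agree_comp2[OF total_rec_agree_mult_args]

lemma total_rec_agree_pred_arg: "total_rec_agree (Suc 0) (\<lambda>xs. xs ! 0 - 1)"
proof (rule total_rec_agree_cong[OF total_rec_agree_rec1[of "\<lambda>y r. y" 0]])
  fix xs :: "nat list"
  have "rec_nat 0 (\<lambda>y r. y) a = a - 1" for a :: nat by (induction a) auto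
  then show "rec_nat 0 (\<lambda>y r. y) (xs ! 0) = xs ! 0 - 1" .
qed (auto intro!: total_rec_agree_proj)

lemma total_rec_agree_diff:
  assumes "total_rec_agree k f" "total_rec_agree k g"
  shows "total_rec_agree k (\<lambda>xs. f xs - g xs)"
proof -
  have "total_rec_agree (Suc (Suc 0)) (\<lambda>xs. rec_nat (xs ! 1) (\<lambda>y r. r - 1) (xs ! 0))"
    by (rule total_rec_agree_rec2[of "\<lambda>x. x" "\<lambda>y r x. r - 1"])
      (intro total_rec_agree_comp1[OF total_rec_agree_pred_arg] total_rec_agree_proj; simp)+
  moreover have "rec_nat b (\<lambda>y r. r - 1) a = b - a" for a b :: nat by (induction a) auto
  ultimately have "total_rec_agree (Suc (Suc 0)) (\<lambda>xs. xs ! 1 - xs ! 0)" by simp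
  from total_rec_agree_comp2[of "\<lambda>a b. b - a", OF this assms(2,1)] show ?thesis .
qed

lemma total_rec_agree_triangle:
  assumes "total_rec_agree k f"
  shows "total_rec_agree k (\<lambda>xs. triangle (f xs))"
proof (rule total_rec_agree_comp1[OF total_rec_agree_cong[OF total_rec_agree_rec1[of "\<lambda>y r. r + Suc y" 0]] assms])
  fix xs :: "nat list"
  have "rec_nat 0 (\<lambda>y r. r + Suc y) a = triangle a" for a by (induction a) auto
  then show "rec_nat 0 (\<lambda>y r. r + Suc y) (xs ! 0) = triangle (xs ! 0)" .
qed (intro total_rec_agree_add total_rec_agree_Suc total_rec_agree_proj; simp)

section \<open>Cantor pairing and its inverses\<close>

abbreviation pair :: "nat \<Rightarrow> nat \<Rightarrow> nat" where "pair a b \<equiv> prod_encode (a, b)"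
definition pfst :: "nat \<Rightarrow> nat" where "pfst m = fst (prod_decode m)"
definition psnd :: "nat \<Rightarrow> nat" where "psnd m = snd (prod_decode m)"

lemma pfst_pair [simp]: "pfst (pair a b) = a" and psnd_pair [simp]: "psnd (pair a b) = b"
  by (simp_all add: pfst_def psnd_def)

lemma pair_pfst_psnd [simp]: "pair (pfst m) (psnd m) = m"
  by (simp add: pfst_def psnd_def)

lemma prod_decode_pfst_psnd: "prod_decode m = (pfst m, psnd m)"
  by (simp add: pfst_def psnd_def)

lemma pfst_le: "pfst m \<le> m" and psnd_le: "psnd m \<le> m"
  by (metis pair_pfst_psnd le_prod_encode_1, metis pair_pfst_psnd le_prod_encode_2)

lemma triangle_mono: "a \<le> b \<Longrightarrow> triangle a \<le> triangle b"
  by (induction b) (auto simp: le_Suc_eq)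

text \<open>With Cantor's pairing \<open>pair a b = triangle (a + b) + a\<close>, the sum a + b is
  the diagonal that contains m, the least s with m < triangle (s + 1). Unpairing thus costs one
  regular minimization; the rest is arithmetic.\<close>

lemma pfst_add_psnd: "pfst m + psnd m = (LEAST s. Suc m - triangle (Suc s) = 0)"
proof -
  obtain a b where m: "m = pair a b" by (metis pair_pfst_psnd)
  have "(LEAST s. Suc m - triangle (Suc s) = 0) = a + b"
  proof (rule Least_equality)
    fix s assume s: "Suc m - triangle (Suc s) = 0"
    show "a + b \<le> s"
    proof (rule ccontr)
      assume "\<not> a + b \<le> s"
      then have "triangle (Suc s) \<le> triangle (a + b)" by (intro triangle_mono) auto
      with s m show False by (simp add: prod_encode_def)
    qed
  qed (simp add: m prod_encode_def)
  then show ?thesis using m by simp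
qed

lemma triangle_ge: "n \<le> triangle n"
  by (induction n) auto

lemma total_rec_agree_pfst_add_psnd: "total_rec_agree (Suc 0) (\<lambda>xs. pfst (xs ! 0) + psnd (xs ! 0))"
  unfolding pfst_add_psnd
proof (rule total_rec_agree_cong[OF total_rec_agree_mini[of "Suc 0" "\<lambda>xs. Suc (xs ! 1) - triangle (Suc (xs ! 0))"]])
  fix xs :: "nat list" assume "length xs = Suc 0"
  show "\<exists>y. Suc ((y # xs) ! 1) - triangle (Suc ((y # xs) ! 0)) = 0"
    by (rule exI[of _ "xs ! 0"]) (use triangle_ge[of "xs ! 0"] in simp)
qed (auto simp del: triangle_Suc
   intro!: total_rec_agree_diff total_rec_agree_Suc total_rec_agree_triangle total_rec_agree_proj)

lemma total_rec_agree_pfst: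
  assumes "total_rec_agree k f" shows "total_rec_agree k (\<lambda>xs. pfst (f xs))"
proof -
  have "m - triangle (pfst m + psnd m) = pfst m" for m
  proof -
    have "triangle (pfst m + psnd m) + pfst m = m"
      using pair_pfst_psnd[of m] unfolding prod_encode_def case_prod_conv .
    then show ?thesis by linarith
  qed
  moreover have "total_rec_agree (Suc 0) (\<lambda>xs. xs ! 0 - triangle (pfst (xs ! 0) + psnd (xs ! 0)))"
    by (intro total_rec_agree_diff total_rec_agree_triangle total_rec_agree_pfst_add_psnd total_rec_agree_proj) simp
  ultimately have "total_rec_agree (Suc 0) (\<lambda>xs. pfst (xs ! 0))" by (simp only:)
  from total_rec_agree_comp1[OF this assms] show ?thesis .
qed

lemma total_rec_agree_psnd:
  assumes "total_rec_agree k f" shows "total_rec_agree k (\<lambda>xs. psnd (f xs))"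
proof -
  have "(pfst m + psnd m) - pfst m = psnd m" for m by simp
  moreover have "total_rec_agree (Suc 0) (\<lambda>xs. (pfst (xs ! 0) + psnd (xs ! 0)) - pfst (xs ! 0))"
    by (intro total_rec_agree_diff total_rec_agree_pfst total_rec_agree_pfst_add_psnd total_rec_agree_proj) simp
  ultimately have "total_rec_agree (Suc 0) (\<lambda>xs. psnd (xs ! 0))" by (simp only:)
  from total_rec_agree_comp1[OF this assms] show ?thesis .
qed

lemma total_rec_agree_pair:
  assumes "total_rec_agree k f" "total_rec_agree k g" shows "total_rec_agree k (\<lambda>xs. pair (f xs) (g xs))"
  unfolding prod_encode_def case_prod_conv
  by (intro total_rec_agree_add total_rec_agree_triangle assms)

section \<open>Closure properties of computable unary functions\<close>

definition computable :: "(nat \<Rightarrow> nat) \<Rightarrow> bool" where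
  "computable f \<longleftrightarrow> total_rec_agree (Suc 0) (\<lambda>xs. f (xs ! 0))"

named_theorems computable_intros

lemma total_rec_agree_computable:
  "computable f \<Longrightarrow> total_rec_agree k g \<Longrightarrow> total_rec_agree k (\<lambda>xs. f (g xs))"
  unfolding computable_def by (rule total_rec_agree_comp1)

lemma computable_compose: "computable f \<Longrightarrow> computable g \<Longrightarrow> computable (\<lambda>x. f (g x))"
  unfolding computable_def by (rule total_rec_agree_comp1)

lemma computable_id [computable_intros]: "computable (\<lambda>x. x)"
  unfolding computable_def by (simp add: total_rec_agree_proj)

lemma computable_Suc [computable_intros]: "computable f \<Longrightarrow> computable (\<lambda>x. Suc (f x))"
  unfolding computable_def by (rule total_rec_agree_Suc)

lemma computable_const [computable_intros]: "computable (\<lambda>x. c)"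
  by (induction c) (auto intro: total_rec_agree_Suc simp: computable_def total_rec_agree_zero)

lemma computable_arith [computable_intros]:
  assumes "computable f" "computable g"
  shows "computable (\<lambda>x. f x + g x)" "computable (\<lambda>x. f x * g x)" "computable (\<lambda>x. f x - g x)"
    "computable (\<lambda>x. pair (f x) (g x))"
  using assms unfolding computable_def
  by (auto intro: total_rec_agree_add total_rec_agree_mult total_rec_agree_diff total_rec_agree_pair)

lemma computable_pfst [computable_intros]: "computable f \<Longrightarrow> computable (\<lambda>x. pfst (f x))"
  unfolding computable_def by (rule total_rec_agree_pfst)

lemma computable_psnd [computable_intros]: "computable f \<Longrightarrow> computable (\<lambda>x. psnd (f x))"
  unfolding computable_def by (rule total_rec_agree_psnd)

text \<open>All functions are unary, with their arguments packed into a pair, so that one set of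
  introduction rules covers every arity. This rule and the next one unpack the arguments when a
  binary or ternary function is applied.\<close>

lemma computable_compose2:
  "computable (\<lambda>z. h (pfst z) (psnd z)) \<Longrightarrow> computable f \<Longrightarrow> computable g \<Longrightarrow> computable (\<lambda>x. h (f x) (g x))"
  using computable_compose[of "\<lambda>z. h (pfst z) (psnd z)" "\<lambda>x. pair (f x) (g x)",
      OF _ computable_arith(4)]
  unfolding pfst_pair psnd_pair by blast

lemma computable_compose3:
  "computable (\<lambda>z. h (pfst z) (pfst (psnd z)) (psnd (psnd z))) \<Longrightarrow> computable f \<Longrightarrow> computable g \<Longrightarrow>
    computable k \<Longrightarrow> computable (\<lambda>x. h (f x) (g x) (k x))"
  using computable_compose[of "\<lambda>z. h (pfst z) (pfst (psnd z)) (psnd (psnd z))" "\<lambda>x. pair (f x) (pair (g x) (k x))",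
      OF _ computable_arith(4)[OF _ computable_arith(4)]]
  unfolding pfst_pair psnd_pair by blast

lemma computable_rec_nat [computable_intros]:
  assumes "computable f" "computable (\<lambda>z. g (pfst z) (pfst (psnd z)) (psnd (psnd z)))" "computable n"
  shows "computable (\<lambda>x. rec_nat (f x) (\<lambda>y r. g y r x) (n x))"
proof -
  have "total_rec_agree (Suc (Suc (Suc 0)))
     (\<lambda>xs. (\<lambda>z. g (pfst z) (pfst (psnd z)) (psnd (psnd z))) (pair (xs ! 0) (pair (xs ! 1) (xs ! 2))))"
    by (rule total_rec_agree_computable[OF assms(2)])
      (auto intro!: total_rec_agree_pair total_rec_agree_proj)
  then have "total_rec_agree (Suc (Suc 0)) (\<lambda>xs. rec_nat (f (xs ! 1)) (\<lambda>y r. g y r (xs ! 1)) (xs ! 0))"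
    by (intro total_rec_agree_rec2) (use assms(1) computable_def in auto)
  then show ?thesis unfolding computable_def
    by (rule total_rec_agree_comp2) (use assms(3) computable_def in \<open>auto intro: total_rec_agree_proj\<close>)
qed

lemma computable_Least:
  assumes "computable (\<lambda>z. f (pfst z) (psnd z))" and "\<And>x. \<exists>y. f y x = 0"
  shows "computable (\<lambda>x. LEAST y. f y x = 0)"
proof -
  have "total_rec_agree (Suc (Suc 0)) (\<lambda>xs. (\<lambda>z. f (pfst z) (psnd z)) (pair (xs ! 0) (xs ! 1)))"
    by (rule total_rec_agree_computable[OF assms(1)])
      (auto intro!: total_rec_agree_pair total_rec_agree_proj)
  then have "total_rec_agree (Suc 0) (\<lambda>xs. LEAST y. f ((y # xs) ! 0) ((y # xs) ! 1) = 0)"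
    by (intro total_rec_agree_mini) (use assms(2) in auto)
  then show ?thesis unfolding computable_def by simp
qed

section \<open>Decidable predicates and bounded quantification\<close>

definition decidable :: "(nat \<Rightarrow> bool) \<Rightarrow> bool" where
  "decidable P \<longleftrightarrow> computable (\<lambda>x. of_bool (P x))"

lemma decidable_less [computable_intros]:
  assumes "computable f" "computable g" shows "decidable (\<lambda>x. f x < g x)"
proof -
  have "of_bool (f x < g x) = 1 - (Suc (f x) - g x)" for x by auto
  then show ?thesis unfolding decidable_def
    by (simp only:) (intro computable_intros assms)
qed

lemma decidable_not [computable_intros]:
  assumes "decidable P" shows "decidable (\<lambda>x. \<not> P x)"
proof -
  have "of_bool (\<not> P x) = 1 - (of_bool (P x) :: nat)" for x by auto
  with assms show ?thesis unfolding decidable_def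
    by (simp only:) (intro computable_intros assms)
qed

lemma decidable_conj [computable_intros]:
  assumes "decidable P" "decidable Q" shows "decidable (\<lambda>x. P x \<and> Q x)"
proof -
  have "of_bool (P x \<and> Q x) = of_bool (P x) * (of_bool (Q x) :: nat)" for x by auto
  with assms show ?thesis unfolding decidable_def
    by (simp only:) (intro computable_intros assms)
qed

lemma decidable_disj [computable_intros]:
  assumes "decidable P" "decidable Q" shows "decidable (\<lambda>x. P x \<or> Q x)"
  using decidable_not[OF decidable_conj[OF decidable_not[OF assms(1)] decidable_not[OF assms(2)]]] by simp

lemma decidable_imp [computable_intros]:
  assumes "decidable P" "decidable Q" shows "decidable (\<lambda>x. P x \<longrightarrow> Q x)"
  unfolding imp_conv_disj by (intro computable_intros assms)

lemma decidable_le [computable_intros]: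
  assumes "computable f" "computable g" shows "decidable (\<lambda>x. f x \<le> g x)"
  using decidable_not[OF decidable_less[OF assms(2,1)]] by (simp add: not_less)

lemma decidable_eq [computable_intros]:
  fixes f g :: "nat \<Rightarrow> nat"
  assumes "computable f" "computable g" shows "decidable (\<lambda>x. f x = g x)"
  using decidable_conj[OF decidable_le[OF assms] decidable_le[OF assms(2,1)]] by (simp add: eq_iff)

lemma computable_if [computable_intros]:
  assumes "decidable P" "computable f" "computable g" shows "computable (\<lambda>x. if P x then f x else g x)"
proof -
  have "(if P x then f x else g x) = of_bool (P x) * f x + of_bool (\<not> P x) * g x" for x by auto
  moreover have "computable (\<lambda>x. of_bool (P x) * f x + of_bool (\<not> P x) * g x)"
    using assms(1) decidable_not[OF assms(1)] unfolding decidable_def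
    by (intro computable_intros assms)
  ultimately show ?thesis by simp
qed

lemma decidable_ball_less [computable_intros]:
  assumes "decidable (\<lambda>z. P (pfst z) (psnd z))" "computable n"
  shows "decidable (\<lambda>x. \<forall>y<n x. P y x)"
proof -
  have eq: "of_bool (\<forall>y<m. P y x) = rec_nat (1::nat) (\<lambda>y r. r * of_bool (P y x)) m" for m x
  proof (induction m)
    case (Suc m)
    have "(\<forall>y<Suc m. P y x) \<longleftrightarrow> (\<forall>y<m. P y x) \<and> P m x" by (auto simp: less_Suc_eq)
    then show ?case using Suc by (simp only: of_bool_conj) simp
  qed simp
  have "computable (\<lambda>z. of_bool (P (pfst z) (psnd z)))" using assms(1) by (simp add: decidable_def)
  note P = computable_compose2[of "\<lambda>a b. of_bool (P a b)", OF this]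
  show ?thesis unfolding decidable_def eq
    by (intro computable_rec_nat[of "\<lambda>_. 1" "\<lambda>y r x. r * of_bool (P y x)" n] computable_arith(2) P
      computable_pfst computable_psnd computable_id computable_const assms(2))
qed

lemma computable_power [computable_intros]:
  assumes "computable f" "computable n" shows "computable (\<lambda>x. f x ^ n x)"
proof -
  have eq: "a ^ m = rec_nat 1 (\<lambda>y r. r * a) m" for a m :: nat
    by (induction m) auto
  show ?thesis unfolding eq 
    by (intro computable_rec_nat[of "\<lambda>_. 1" "\<lambda>y r x. r * f x"] computable_intros 
      computable_compose[OF assms(1)] assms)
qed

lemma computable_div [computable_intros]:
  assumes "computable f" "computable g" shows "computable (\<lambda>x. f x div g x)"
proof -
  have eq: "a div b = (if b = 0 then 0 else LEAST q. a < b * Suc q)" for a b :: nat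
  proof (cases "b = 0")
    case False
    have "(LEAST q. a < b * Suc q) = a div b"
    proof (rule Least_equality)
      show "a < b * Suc (a div b)"
        using False dividend_less_times_div[of b a] by (metis mult_Suc_right neq0_conv)
      show "a div b \<le> q" if "a < b * Suc q" for q
        using less_mult_imp_div_less[of a "Suc q" b] that by (metis mult.commute less_Suc_eq_le)
    qed
    then show ?thesis using False by simp
  qed simp
  \<comment> \<open>Regular minimization demands a zero for every argument, so the disjunct
    \<open>psnd x = 0\<close> stops the search for divisor 0 as well; the case distinction around it
    supplies the value there.\<close>
  have "computable (\<lambda>x. LEAST q. (of_bool (\<not> (pfst x < psnd x * Suc q \<or> psnd x = 0)) :: nat) = 0)"
  proof (rule computable_Least)
    show "computable (\<lambda>z. of_bool (\<not> (pfst (psnd z) < psnd (psnd z) * Suc (pfst z) \<or> psnd (psnd z) = 0)))"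
      unfolding decidable_def[symmetric] by (intro computable_intros)
    show "\<exists>y. (of_bool (\<not> (pfst x < psnd x * Suc y \<or> psnd x = 0)) :: nat) = 0" for x
    proof (rule exI[of _ "pfst x"])
      have "pfst x < psnd x * Suc (pfst x)" if "psnd x \<noteq> 0"
        using that by (cases "psnd x") auto
      then show "(of_bool (\<not> (pfst x < psnd x * Suc (pfst x) \<or> psnd x = 0)) :: nat) = 0" by auto
    qed
  qed
  from computable_if[OF decidable_eq[OF computable_psnd[OF computable_id] computable_const[of 0]]
    computable_const[of 0] this]
  have "computable (\<lambda>z. if psnd z = 0 then 0 else LEAST q. (of_bool (\<not> (pfst z < psnd z * Suc q \<or> psnd z = 0)) :: nat) = 0)" .
  also have "(\<lambda>z. if psnd z = 0 then 0 else LEAST q. (of_bool (\<not> (pfst z < psnd z * Suc q \<or> psnd z = 0)) :: nat) = 0)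
     = (\<lambda>z. pfst z div psnd z)"
    by (intro ext, subst eq) (simp del: mult_Suc_right cong: if_cong)
  finally show ?thesis by (rule computable_compose2[OF _ assms])
qed

lemma computable_mod [computable_intros]:
  assumes "computable f" "computable g" shows "computable (\<lambda>x. f x mod g x)"
proof -
  have "computable (\<lambda>x. f x - g x * (f x div g x))" by (intro computable_intros assms)
  then show ?thesis by (simp only: minus_mult_div_eq_mod)
qed

section \<open>Codes of lists, Gaussian rationals and polynomials\<close>

lemma rec_nat_funpow: "rec_nat a (\<lambda>y r. g r) n = (g ^^ n) a"
  by (induction n) auto

lemma list_encode_ge_length: "length xs \<le> list_encode xs"
proof (induction xs)
  case (Cons x xs)
  have "list_encode xs \<le> pair x (list_encode xs)" by (rule le_prod_encode_2)
  with Cons show ?case by simp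
qed simp

lemma length_list_decode_le: "length (list_decode l) \<le> l"
  using list_encode_ge_length[of "list_decode l"] by simp

lemma list_decode_elem_le: "x \<in> set (list_decode l) \<Longrightarrow> x \<le> l"
proof -
  have "x \<in> set xs \<Longrightarrow> x \<le> list_encode xs" for xs
  proof (induction xs)
    case (Cons y xs)
    have "list_encode xs \<le> pair y (list_encode xs)" "y \<le> pair y (list_encode xs)"
      by (rule le_prod_encode_2, rule le_prod_encode_1)
    with Cons show ?case by auto
  qed simp
  from this[of "list_decode l"] show "x \<in> set (list_decode l) \<Longrightarrow> x \<le> l" by simp
qed

text \<open>A list is at most as long as its code, so \<open>l\<close> steps exhaust the list with code \<open>l\<close>.\<close>

lemma foldl_list_decode:
  "foldl g a (list_decode l) =
    psnd (rec_nat (pair l a) (\<lambda>y r. if pfst r = 0 then r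
      else pair (psnd (pfst r - 1)) (g (psnd r) (pfst (pfst r - 1)))) l)"
proof -
  define step where "step = (\<lambda>r. if pfst r = 0 then r
      else pair (psnd (pfst r - 1)) (g (psnd r) (pfst (pfst r - 1))))"
  have stop: "(step ^^ n) (pair 0 a) = pair 0 a" for n a
    by (induction n) (auto simp: step_def)
  have "length xs \<le> n \<Longrightarrow> (step ^^ n) (pair (list_encode xs) a) = pair 0 (foldl g a xs)" for xs n
  proof (induction xs arbitrary: a n)
    case (Cons x xs)
    then obtain m where "n = Suc m" "length xs \<le> m" by (cases n) auto
    then show ?case
      using Cons.IH[of m "g a x"] by (simp add: funpow_Suc_right del: funpow.simps) (simp add: step_def)
  qed (simp add: stop)
  from this[of "list_decode l" l] have "psnd ((step ^^ l) (pair l a)) = foldl g a (list_decode l)"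
    using length_list_decode_le by simp
  then show ?thesis by (simp only: rec_nat_funpow step_def)
qed

lemma computable_foldl [computable_intros]:
  assumes "computable (\<lambda>z. g (pfst z) (pfst (psnd z)) (psnd (psnd z)))" "computable a" "computable l"
  shows "computable (\<lambda>x. foldl (\<lambda>r y. g r y x) (a x) (list_decode (l x)))"
  unfolding foldl_list_decode
  by (intro computable_rec_nat[where g = "\<lambda>y r x. if pfst r = 0 then r
      else pair (psnd (pfst r - 1)) (g (psnd r) (pfst (pfst r - 1)) x)"]
    computable_compose3[of g, OF assms(1)] computable_intros assms(2,3))

text \<open>\<open>Suc (pair y r)\<close> is the code of a cons, so folding it pushes the elements
  in reverse order onto the initial list. Reversal is the case of an empty initial list, and
  appending is a fold over a reversed list.\<close>

lemma foldl_cons_code: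
  "foldl (\<lambda>r y. Suc (pair y r)) (list_encode ys) xs = list_encode (rev xs @ ys)"
  by (induction xs arbitrary: ys)
    (simp_all add: list_encode.simps(2)[symmetric] del: list_encode.simps(2))

lemma computable_rev [computable_intros]:
  assumes "computable l" shows "computable (\<lambda>x. list_encode (rev (list_decode (l x))))"
proof -
  have eq: "list_encode (rev xs) = foldl (\<lambda>r y. Suc (pair y r)) 0 xs" for xs
    using foldl_cons_code[of "[]" xs] by simp
  show ?thesis unfolding eq
    by (intro computable_foldl[where g = "\<lambda>r y x. Suc (pair y r)"] computable_intros assms)
qed

lemma computable_append [computable_intros]:
  assumes "computable l" "computable m"
  shows "computable (\<lambda>x. list_encode (list_decode (l x) @ list_decode (m x)))"
proof -
  have eq:
    "list_encode (list_decode a @ list_decode b)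
      = foldl (\<lambda>r y. Suc (pair y r)) b (list_decode (list_encode (rev (list_decode a))))" for a b
    using foldl_cons_code[of "list_decode b" "rev (list_decode a)"] by simp
  show ?thesis unfolding eq
    by (intro computable_foldl[where g = "\<lambda>r y x. Suc (pair y r)"] computable_intros assms)
qed

lemma computable_concat_map:
  assumes "computable (\<lambda>z. h (pfst z) (psnd z))" "computable l"
  shows "computable (\<lambda>x. list_encode (concat (map (\<lambda>y. list_decode (h y x)) (list_decode (l x)))))"
proof -
  have "foldl (\<lambda>r y. list_encode (list_decode r @ list_decode (h y x))) (list_encode ys) xs
      = list_encode (ys @ concat (map (\<lambda>y. list_decode (h y x)) xs))" for xs ys x
    by (induction xs arbitrary: ys) (simp_all del: list_encode.simps)
  from this[of _ "[]"] have eq: "list_encode (concat (map (\<lambda>y. list_decode (h y x)) xs))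
      = foldl (\<lambda>r y. list_encode (list_decode r @ list_decode (h y x))) 0 xs" for xs x
    by simp
  show ?thesis unfolding eq
    by (intro computable_foldl[where g = "\<lambda>r y x. list_encode (list_decode r @ list_decode (h y x))"]
       computable_compose2[of h, OF assms(1)] computable_intros assms(2))
qed

lemma computable_map:
  assumes "computable (\<lambda>z. h (pfst z) (psnd z))" "computable l"
  shows "computable (\<lambda>x. list_encode (map (\<lambda>y. h y x) (list_decode (l x))))"
proof -
  \<comment> \<open>\<open>Suc (pair c 0)\<close> is the code of the list with the single element c,
    so a map is a concatenation of singletons.\<close>
  have eq: "map (\<lambda>y. h y x) xs = concat (map (\<lambda>y. list_decode (Suc (pair (h y x) 0))) xs)" for xs x
    by (induction xs) simp_all
  show ?thesis unfolding eq
    by (intro computable_concat_map[where h = "\<lambda>y x. Suc (pair (h y x) 0)"] 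
       computable_compose2[of h, OF assms(1)] computable_intros assms(2))
qed

text \<open>For a nonempty list with code l, \<open>pfst (l - 1)\<close> is the head and
  \<open>psnd (l - 1)\<close> the code of the tail.\<close>

definition list_code_nth :: "nat \<Rightarrow> nat \<Rightarrow> nat" where
  "list_code_nth l i = pfst (rec_nat l (\<lambda>y r. psnd (r - 1)) i - 1)"

lemma list_code_nth: "i < length xs \<Longrightarrow> list_code_nth (list_encode xs) i = xs ! i"
proof -
  have eq: "rec_nat l (\<lambda>y r. psnd (r - 1)) n = ((\<lambda>r. psnd (r - 1)) ^^ n) l" for l n
    by (rule rec_nat_funpow)
  show "i < length xs \<Longrightarrow> list_code_nth (list_encode xs) i = xs ! i"
    unfolding list_code_nth_def eq
  proof (induction xs arbitrary: i)
    case (Cons x xs)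
    then show ?case by (cases i) (simp_all add: funpow_Suc_right del: funpow.simps(2))
  qed simp
qed

lemma computable_list_code_nth [computable_intros]:
  "computable l \<Longrightarrow> computable i \<Longrightarrow> computable (\<lambda>x. list_code_nth (l x) (i x))"
  unfolding list_code_nth_def by (intro computable_intros)

section \<open>Arithmetic of rationals and Gaussian rationals on codes\<close>

definition code_pos :: "nat \<Rightarrow> nat" where "code_pos a = (if a mod 2 = 0 then a div 2 else 0)"
definition code_neg :: "nat \<Rightarrow> nat" where "code_neg a = (if a mod 2 = 0 then 0 else Suc a div 2)"
definition diff_code :: "nat \<Rightarrow> nat \<Rightarrow> nat" where
  "diff_code p q = (if q \<le> p then 2 * (p - q) else Suc (2 * (q - Suc p)))"

text \<open>Even codes stand for nonnegative integers, odd codes for negative ones. Writing an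
  integer as a difference of two naturals keeps its arithmetic within natural-valued functions,
  where subtraction is truncated.\<close>

lemma int_decode_pos_neg: "int_decode a = int (code_pos a) - int (code_neg a)"
  unfolding int_decode_def sum_decode_def code_pos_def code_neg_def
  by (auto simp: even_iff_mod_2_eq_zero[symmetric] elim!: oddE)

lemma int_decode_diff_code: "int_decode (diff_code p q) = int p - int q"
  unfolding int_decode_def sum_decode_def diff_code_def by (auto simp: of_nat_diff)

text \<open>\<open>rat_of_code\<close> stores a denominator minus one, which rules out division by
  0; here d is the true denominator.\<close>

definition rat_code :: "nat \<Rightarrow> nat \<Rightarrow> nat \<Rightarrow> nat" where
  "rat_code p q d = pair (diff_code p q) (d - 1)"

definition rval :: "nat \<Rightarrow> real" where "rval r = of_rat (rat_of_code r)"

lemma rval_eq: "rval r = (real (code_pos (pfst r)) - real (code_neg (pfst r))) / real (Suc (psnd r))"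
proof -
  have "rval r = real_of_int (int_decode (pfst r)) / real (Suc (psnd r))"
    unfolding rval_def rat_of_code_def prod_decode_pfst_psnd case_prod_conv of_rat_divide of_rat_of_int_eq
      of_rat_of_nat_eq ..
  then show ?thesis by (simp add: int_decode_pos_neg)
qed

lemma rval_rat_code: "d > 0 \<Longrightarrow> rval (rat_code p q d) = (real p - real q) / real d"
  unfolding rval_def rat_of_code_def rat_code_def
  by (simp add: int_decode_diff_code of_rat_divide of_rat_diff)

definition rat_add :: "nat \<Rightarrow> nat \<Rightarrow> nat" where
  "rat_add a b = rat_code
     (code_pos (pfst a) * Suc (psnd b) + code_pos (pfst b) * Suc (psnd a))
     (code_neg (pfst a) * Suc (psnd b) + code_neg (pfst b) * Suc (psnd a)) (Suc (psnd a) * Suc (psnd b))"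

definition rat_mult :: "nat \<Rightarrow> nat \<Rightarrow> nat" where
  "rat_mult a b = rat_code
     (code_pos (pfst a) * code_pos (pfst b) + code_neg (pfst a) * code_neg (pfst b))
     (code_pos (pfst a) * code_neg (pfst b) + code_neg (pfst a) * code_pos (pfst b))
     (Suc (psnd a) * Suc (psnd b))"

definition rat_neg :: "nat \<Rightarrow> nat" where
  "rat_neg a = rat_code (code_neg (pfst a)) (code_pos (pfst a)) (Suc (psnd a))"

lemma rval_add: "rval (rat_add a b) = rval a + rval b"
proof -
  have "Suc (psnd a) * Suc (psnd b) > 0" by simp
  then show ?thesis unfolding rat_add_def rval_rat_code[OF \<open>Suc (psnd a) * Suc (psnd b) > 0\<close>]
      rval_eq[of a] rval_eq[of b]
    by (simp add: field_simps)
qed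

lemma rval_mult: "rval (rat_mult a b) = rval a * rval b"
proof -
  have "Suc (psnd a) * Suc (psnd b) > 0" by simp
  then show ?thesis unfolding rat_mult_def rval_rat_code[OF \<open>Suc (psnd a) * Suc (psnd b) > 0\<close>]
      rval_eq[of a] rval_eq[of b]
    by (simp add: field_simps)
qed

lemma rval_neg: "rval (rat_neg a) = - rval a"
  unfolding rat_neg_def by (subst rval_rat_code) (auto simp: rval_eq field_simps)

lemma abs_rval_le: "\<bar>rval r\<bar> \<le> pfst r"
proof -
  have "\<bar>real (code_pos a) - real (code_neg a)\<bar> \<le> a" for a
    unfolding code_pos_def code_neg_def by (auto simp: real_of_nat_div)
  from divide_right_mono[OF this, of "real (Suc (psnd r))"] 
  have "\<bar>rval r\<bar> \<le> real (pfst r) / real (Suc (psnd r))" by (simp add: rval_eq)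
  also have "\<dots> \<le> pfst r" by (simp add: field_simps)
  finally show ?thesis .
qed

definition gval :: "nat \<Rightarrow> complex" where "gval = gaussian_rat_of_code"

lemma gval_eq: "gval c = Complex (rval (pfst c)) (rval (psnd c))"
  by (simp add: gval_def gaussian_rat_of_code_def prod_decode_pfst_psnd rval_def)

definition gauss_mult :: "nat \<Rightarrow> nat \<Rightarrow> nat" where
  "gauss_mult c d = pair
     (rat_add (rat_mult (pfst c) (pfst d)) (rat_neg (rat_mult (psnd c) (psnd d))))
     (rat_add (rat_mult (pfst c) (psnd d)) (rat_mult (psnd c) (pfst d)))"

definition gauss_conj :: "nat \<Rightarrow> nat" where
  "gauss_conj c = pair (pfst c) (rat_neg (psnd c))"

lemma gval_mult: "gval (gauss_mult c d) = gval c * gval d"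
  by (simp add: gval_eq gauss_mult_def rval_add rval_mult rval_neg complex_eq_iff)

lemma gval_conj: "gval (gauss_conj c) = cnj (gval c)"
  by (simp add: gval_eq gauss_conj_def rval_neg complex_eq_iff)

lemma pfst_add_psnd_le: "pfst m + psnd m \<le> m"
proof -
  have "triangle (pfst m + psnd m) + pfst m = m"
    using pair_pfst_psnd[of m] unfolding prod_encode_def case_prod_conv .
  with triangle_ge[of "pfst m + psnd m"] show ?thesis by linarith
qed

text \<open>Together with \<open>abs_rval_le\<close>, this lets a code bound the number it stands
  for, so that coefficients can be estimated without decoding them.\<close>

lemma cmod_gval_le: "cmod (gval c) \<le> real c"
proof -
  have "cmod (gval c) \<le> \<bar>rval (pfst c)\<bar> + \<bar>rval (psnd c)\<bar>"
    using cmod_le[of "gval c"] by (simp add: gval_eq)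
  also have "\<dots> \<le> real (pfst (pfst c)) + real (pfst (psnd c))"
    by (intro add_mono abs_rval_le)
  also have "\<dots> \<le> real (pfst c) + real (psnd c)"
    by (intro add_mono) (simp_all add: pfst_le)
  also have "\<dots> \<le> real c" using pfst_add_psnd_le[of c] by linarith
  finally show ?thesis .
qed

lemma gval_dense: "\<exists>c. cmod (gval c - z) < \<epsilon>" if "\<epsilon> > 0"
proof -
  have "\<exists>r. \<bar>rval r - x\<bar> < \<epsilon> / 2" for x
  proof -
    have "x - \<epsilon> / 2 < x + \<epsilon> / 2" using that by simp
    then obtain q :: rat where q: "x - \<epsilon> / 2 < of_rat q" "of_rat q < x + \<epsilon> / 2"
      using of_rat_dense by blast
    obtain a b where ab: "quotient_of q = (a, b)" by fastforce
    then have b: "b > 0" and qe: "q = of_int a / of_int b"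
      using quotient_of_denom_pos quotient_of_div by auto
    have "rat_of_code (pair (int_encode a) (nat b - 1)) = q"
      using b unfolding rat_of_code_def qe by (simp add: of_nat_diff)
    then have "rval (pair (int_encode a) (nat b - 1)) = of_rat q" by (simp add: rval_def)
    with q have "\<bar>rval (pair (int_encode a) (nat b - 1)) - x\<bar> < \<epsilon> / 2"
      unfolding abs_less_iff by linarith
    then show ?thesis ..
  qed
  then obtain r t where rt: "\<bar>rval r - Re z\<bar> < \<epsilon> / 2" "\<bar>rval t - Im z\<bar> < \<epsilon> / 2" by metis
  have "cmod (gval (pair r t) - z) \<le> \<bar>rval r - Re z\<bar> + \<bar>rval t - Im z\<bar>"
    using cmod_le[of "gval (pair r t) - z"] by (simp add: gval_eq)
  with rt show ?thesis by (intro exI[of _ "pair r t"]) linarith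
qed

definition gauss_one :: nat where "gauss_one = pair (rat_code 1 0 1) (rat_code 0 0 1)"
definition gauss_minus_one :: nat where "gauss_minus_one = pair (rat_code 0 1 1) (rat_code 0 0 1)"

lemma gval_one [simp]: "gval gauss_one = 1" and gval_minus_one [simp]: "gval gauss_minus_one = -1"
  by (simp_all add: gauss_one_def gauss_minus_one_def gval_eq rval_rat_code complex_eq_iff)

lemma computable_code_pos [computable_intros]: "computable f \<Longrightarrow> computable (\<lambda>x. code_pos (f x))"
  and computable_code_neg [computable_intros]: "computable f \<Longrightarrow> computable (\<lambda>x. code_neg (f x))"
  unfolding code_pos_def code_neg_def by (intro computable_intros; assumption)+

lemma computable_rat_code [computable_intros]:
  "computable f \<Longrightarrow> computable g \<Longrightarrow> computable h \<Longrightarrow> computable (\<lambda>x. rat_code (f x) (g x) (h x))"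
  unfolding rat_code_def diff_code_def by (intro computable_intros)

lemma computable_rat_arith [computable_intros]:
  assumes "computable f" "computable g"
  shows "computable (\<lambda>x. rat_add (f x) (g x))" "computable (\<lambda>x. rat_mult (f x) (g x))"
    "computable (\<lambda>x. rat_neg (f x))"
  unfolding rat_add_def rat_mult_def rat_neg_def by (intro computable_intros assms)+

lemma computable_gauss_mult [computable_intros]:
  "computable f \<Longrightarrow> computable g \<Longrightarrow> computable (\<lambda>x. gauss_mult (f x) (g x))"
  unfolding gauss_mult_def by (intro computable_intros)

lemma computable_gauss_conj [computable_intros]:
  "computable f \<Longrightarrow> computable (\<lambda>x. gauss_conj (f x))"
  unfolding gauss_conj_def by (intro computable_intros)

section \<open>Operations on codes of *-polynomials\<close>

text \<open>The word of a monomial is nonempty and coded by its head and tail, which is the predecessor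
  of its code as a list.\<close>

definition word_of :: "nat \<Rightarrow> nat list" where "word_of m = list_decode (Suc (psnd m))"

definition monomial_code :: "nat \<Rightarrow> nat list \<Rightarrow> nat" where
  "monomial_code c w = pair c (list_encode w - 1)"

lemma word_of_nonempty [simp]: "word_of m \<noteq> []"
  by (simp add: word_of_def prod_decode_pfst_psnd)

lemma word_of_monomial_code [simp]: "w \<noteq> [] \<Longrightarrow> word_of (monomial_code c w) = w"
  by (cases w) (simp_all add: word_of_def monomial_code_def)

lemma pfst_monomial_code [simp]: "pfst (monomial_code c w) = c"
  by (simp add: monomial_code_def)

definition poly_add :: "nat \<Rightarrow> nat \<Rightarrow> nat" where
  "poly_add p q = list_encode (list_decode p @ list_decode q)"

definition poly_scale :: "nat \<Rightarrow> nat \<Rightarrow> nat" where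
  "poly_scale c p = list_encode (map (\<lambda>m. monomial_code (gauss_mult c (pfst m)) (word_of m)) (list_decode p))"

text \<open>The inner \<open>list_decode (list_encode _)\<close> is the identity; it gives the body
  the shape of \<open>computable_concat_map\<close>, where the function that is mapped returns codes
  of lists.\<close>

definition poly_mult :: "nat \<Rightarrow> nat \<Rightarrow> nat" where
  "poly_mult p q = list_encode (concat (map (\<lambda>a. list_decode (list_encode (map
     (\<lambda>b. monomial_code (gauss_mult (pfst a) (pfst b)) (word_of a @ word_of b)) (list_decode q)))) (list_decode p)))"

text \<open>In the encoding of sums behind \<open>letter_point\<close>, even codes are variables and
  odd codes their adjoints, so taking the adjoint of a letter flips the last bit.\<close>

definition flip_letter :: "nat \<Rightarrow> nat" where
  "flip_letter l = (if l mod 2 = 0 then Suc l else l - 1)"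

definition poly_adj :: "nat \<Rightarrow> nat" where
  "poly_adj p = list_encode (map (\<lambda>m. monomial_code (gauss_conj (pfst m))
     (map flip_letter (rev (word_of m)))) (list_decode p))"

lemma computable_poly_add [computable_intros]:
  "computable f \<Longrightarrow> computable g \<Longrightarrow> computable (\<lambda>x. poly_add (f x) (g x))"
  unfolding poly_add_def by (intro computable_intros)

lemma computable_poly_scale [computable_intros]:
  assumes "computable f" "computable g" shows "computable (\<lambda>x. poly_scale (f x) (g x))"
  unfolding poly_scale_def monomial_code_def word_of_def list_decode_inverse
  by (rule computable_map[where h = "\<lambda>m x. pair (gauss_mult (f x) (pfst m)) (Suc (psnd m) - 1)"])
    (intro computable_intros computable_compose[OF assms(1)] assms(2))+

lemma computable_poly_mult [computable_intros]:
  assumes "computable f" "computable g"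
  shows "computable (\<lambda>x. poly_mult (f x) (g x))"
proof -
  have "computable (\<lambda>z. list_encode (map (\<lambda>b. monomial_code (gauss_mult (pfst (pfst z)) (pfst b)) (word_of (pfst z) @ word_of b))
        (list_decode (g (psnd z)))))"
    unfolding monomial_code_def word_of_def
    by (rule computable_map[where h = "\<lambda>b z. pair (gauss_mult (pfst (pfst z)) (pfst b))
         (list_encode (list_decode (Suc (psnd (pfst z))) @ list_decode (Suc (psnd b))) - 1)"])
      (intro computable_intros computable_compose[OF assms(2)])+
  then show ?thesis unfolding poly_mult_def
    by (rule computable_concat_map[OF _ assms(1)])
qed

lemma computable_poly_adj [computable_intros]:
  assumes "computable f" shows "computable (\<lambda>x. poly_adj (f x))"
proof (rule computable_compose[OF _ assms])
  have "computable (\<lambda>m. list_encode (map flip_letter (list_decode (list_encode (rev (list_decode (Suc (psnd m))))))))"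
    unfolding flip_letter_def 
    by (rule computable_map[where h = "\<lambda>l x. if l mod 2 = 0 then Suc l else l - 1"])
      (intro computable_intros)+
  then have m: "computable (\<lambda>m. monomial_code (gauss_conj (pfst m)) (map flip_letter (rev (word_of m))))"
    unfolding monomial_code_def word_of_def list_encode_inverse
    by (intro computable_intros)
  show "computable poly_adj"
    unfolding poly_adj_def
    by (rule computable_map[where h = "\<lambda>m x. monomial_code (gauss_conj (pfst m)) (map flip_letter (rev (word_of m)))"])
      (intro computable_compose[OF m] computable_intros)+
qed

definition poly_subst_letter :: "(nat \<Rightarrow> nat) \<Rightarrow> nat \<Rightarrow> nat" where
  "poly_subst_letter D l = (if l mod 2 = 0 then D (l div 2) else poly_adj (D (l div 2)))"

text \<open>Both levels are folds, so that \<open>computable_foldl\<close> applies. The fold over a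
  word starts at its first letter because there is no code for the constant 1; the fold over
  monomials starts at 0, the code of the zero polynomial.\<close>

definition poly_subst :: "(nat \<Rightarrow> nat) \<Rightarrow> nat \<Rightarrow> nat" where
  "poly_subst D q = foldl (\<lambda>r m. poly_add r (poly_scale (pfst m)
     (foldl (\<lambda>t l. poly_mult t (poly_subst_letter D l)) (poly_subst_letter D (pfst (psnd m)))
       (list_decode (psnd (psnd m)))))) 0 (list_decode q)"

lemma computable_poly_subst:
  assumes "computable (\<lambda>z. D (pfst z) (psnd z))" "computable q"
  shows "computable (\<lambda>x. poly_subst (\<lambda>i. D i x) (q x))"
proof -
  note D = computable_compose2[of D, OF assms(1)]
  have L: "computable (\<lambda>z. poly_subst_letter (\<lambda>i. D i (g z)) (h z))" if "computable g" "computable h" for g h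
    unfolding poly_subst_letter_def by (intro computable_intros D that)
  show ?thesis unfolding poly_subst_def
    by (intro assms(2) L computable_foldl[where g = "\<lambda>r m x. poly_add r (poly_scale (pfst m)
        (foldl (\<lambda>t l. poly_mult t (poly_subst_letter (\<lambda>i. D i x) l))
         (poly_subst_letter (\<lambda>i. D i x) (pfst (psnd m))) (list_decode (psnd (psnd m)))))"]
      computable_foldl[where g = "\<lambda>t l z. poly_mult t (poly_subst_letter (\<lambda>i. D i (psnd (psnd z))) l)"]
      computable_poly_add computable_poly_scale computable_poly_mult computable_pfst computable_psnd
      computable_id computable_const)
qed

section \<open>Systems of matrix units\<close>

lemma scaleC_bounded_bilinear: "bounded_bilinear (scaleC :: complex \<Rightarrow> 'a::unital_cstar_algebra \<Rightarrow> 'a)"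
proof (rule bounded_bilinear.intro)
  show "scaleC (scaleR r c) x = scaleR r (scaleC c x)" for r c and x :: 'a
    by (simp add: scaleR_scaleC scaleC_scaleC scaleR_conv_of_real)
  show "scaleC c (scaleR r x) = scaleR r (scaleC c x)" for r c and x :: 'a
    by (simp add: scaleR_scaleC scaleC_scaleC mult.commute)
  show "\<exists>K. \<forall>a (b::'a). norm (scaleC a b) \<le> norm a * norm b * K"
    by (rule exI[of _ 1]) (simp add: norm_scaleC)
qed (simp_all add: scaleC_add_left scaleC_add_right)

interpretation scaleC: bounded_bilinear scaleC
  by (rule scaleC_bounded_bilinear)

lemma scaleC_one [simp]: "scaleC 1 x = x"
  using scaleR_scaleC[of 1 x] by simp

text \<open>The C*-identity gives norm x * norm x <= norm (adj x) * norm x. Used for the adjoint of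
  x as well, this makes the involution isometric.\<close>

lemma norm_adj_le: "norm x \<le> norm (adj (x::'a::unital_cstar_algebra))"
proof (cases "norm x = 0")
  case False
  have "norm x * norm x \<le> norm (adj x) * norm x"
    using norm_adj_mult_self[of x] norm_mult_ineq[of "adj x" x] by (simp add: power2_eq_square)
  with False show ?thesis by (simp add: mult_le_cancel_right)
qed simp

lemma norm_adj [simp]: "norm (adj (x::'a::unital_cstar_algebra)) = norm x"
  using norm_adj_le[of x] norm_adj_le[of "adj x"] by (simp add: adj_adj)

lemma adj_bounded_linear: "bounded_linear (adj :: 'a::unital_cstar_algebra \<Rightarrow> 'a)"
  by (rule bounded_linear_intro[where K = 1]) (simp_all add: adj_add scaleR_scaleC adj_scaleC)

lemma adj_scaleR: "adj (scaleR r x) = scaleR r (adj (x::'a::unital_cstar_algebra))"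
  by (simp add: scaleR_scaleC adj_scaleC)

lemma adj_zero [simp]: "adj 0 = (0::'a::unital_cstar_algebra)"
  using adj_add[of "0::'a" 0] by simp

lemma adj_diff: "adj (x - y) = adj x - adj (y::'a::unital_cstar_algebra)"
  using adj_add[of "x - y" y] by simp

lemmas tendsto_adj [tendsto_intros] = bounded_linear.tendsto[OF adj_bounded_linear]
lemmas tendsto_scaleC [tendsto_intros] = scaleC.tendsto

lemma adj_sum: "adj (sum f A) = (\<Sum>i\<in>A. adj (f i :: 'a::unital_cstar_algebra))"
  by (induction A rule: infinite_finite_induct) (simp_all add: adj_add)

lemma adj_one [simp]: "adj 1 = (1::'a::unital_cstar_algebra)"
  using adj_mult[of "adj (1::'a)" 1] by (simp add: adj_adj)

lemma adj_mult_self_eq_0: "adj x * x = 0 \<longleftrightarrow> x = (0::'a::unital_cstar_algebra)"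
  using norm_adj_mult_self[of x] by auto

lemma LIMSEQ_half_power:
  fixes x :: "'a::real_normed_vector"
  assumes "\<And>i. norm (f i - x) \<le> C * (1/2) ^ i"
  shows "f \<longlonglongrightarrow> x"
proof -
  have "(\<lambda>i. C * (1/2::real) ^ i) \<longlonglongrightarrow> C * 0" by (intro tendsto_intros LIMSEQ_power_zero) simp
  then have "(\<lambda>i. C * (1/2::real) ^ i) \<longlonglongrightarrow> 0" by simp
  moreover have "\<forall>\<^sub>F i in sequentially. norm (f i - x) \<le> norm (C * (1/2::real) ^ i) * 1"
    using order_trans[OF assms abs_ge_self] by simp
  ultimately have "(\<lambda>i. f i - x) \<longlonglongrightarrow> 0" by (rule tendsto_0_le)
  then show ?thesis by (simp only: LIM_zero_iff)
qed

lemma geometric_limit: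
  fixes x :: "nat \<Rightarrow> 'a::{real_normed_vector, complete_space}"
  assumes "\<And>i. norm (x (Suc i) - x i) \<le> C * (1/2) ^ i"
  shows "\<exists>l. x \<longlonglongrightarrow> l \<and> (\<forall>i. norm (l - x i) \<le> 2 * C * (1/2) ^ i)"
proof -
  \<comment> \<open>The geometric partial sum is kept exactly: without the factor
    \<open>1 - (1/2) ^ k\<close> the bound is not inductive.\<close>
  have step: "norm (x (i + k) - x i) \<le> 2 * C * (1/2) ^ i * (1 - (1/2) ^ k)" for i k
  proof (induction k)
    case (Suc k)
    have "norm (x (i + Suc k) - x i) \<le> norm (x (Suc (i + k)) - x (i + k)) + norm (x (i + k) - x i)"
      by (metis add_Suc_right norm_triangle_ineq diff_add_cancel add_diff_eq)
    also have "\<dots> \<le> C * (1/2) ^ (i + k) + 2 * C * (1/2) ^ i * (1 - (1/2) ^ k)"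
      by (intro add_mono assms Suc)
    also have "\<dots> = 2 * C * (1/2) ^ i * (1 - (1/2) ^ Suc k)"
      by (simp add: power_add algebra_simps)
    finally show ?case .
  qed simp
  have C: "0 \<le> C" using order_trans[OF norm_ge_zero assms[of 0]] by simp
  have le: "norm (x (i + k) - x i) \<le> 2 * C * (1/2) ^ i" for i k
    using step[of i k] C mult_left_le[of "1 - (1/2) ^ k" "2 * C * (1/2) ^ i"] by simp
  have "Cauchy x"
  proof (rule CauchyI')
    fix e :: real assume e: "0 < e"
    have "(\<lambda>i. 2 * C * (1/2) ^ i) \<longlonglongrightarrow> 2 * C * 0"
      by (intro tendsto_intros LIMSEQ_power_zero) simp
    then have "eventually (\<lambda>i. 2 * C * (1/2) ^ i < e) sequentially"
      using e by (intro order_tendstoD) auto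
    then obtain M where M: "\<And>i. i \<ge> M \<Longrightarrow> 2 * C * (1/2) ^ i < e"
      by (auto simp: eventually_sequentially)
    have "dist (x m) (x n) < e" if "m \<ge> M" "n > m" for m n
      using le[of m "n - m"] M[OF that(1)] that(2) by (simp add: dist_norm norm_minus_commute)
    then show "\<exists>M. \<forall>m\<ge>M. \<forall>n>m. dist (x m) (x n) < e" by blast
  qed
  then obtain l where l: "x \<longlonglongrightarrow> l" using Cauchy_convergent convergent_def by blast
  have "norm (l - x i) \<le> 2 * C * (1/2) ^ i" for i
  proof (rule LIMSEQ_le_const2)
    show "(\<lambda>k. norm (x (k + i) - x i)) \<longlonglongrightarrow> norm (l - x i)"
      by (intro tendsto_intros LIMSEQ_ignore_initial_segment l)
    show "\<exists>N. \<forall>n\<ge>N. norm (x (n + i) - x i) \<le> 2 * C * (1/2) ^ i"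
      using le[of i] by (auto simp: add.commute)
  qed
  with l show ?thesis by blast
qed

section \<open>Matrix units, diagonal sums and spans\<close>

definition matrix_units :: "nat \<Rightarrow> (nat \<Rightarrow> nat \<Rightarrow> 'a::unital_cstar_algebra) \<Rightarrow> bool" where
  "matrix_units n e \<longleftrightarrow>
     (\<forall>a<n. \<forall>b<n. adj (e a b) = e b a) \<and>
     (\<forall>a<n. \<forall>b<n. \<forall>c<n. \<forall>d<n. e a b * e c d = (if b = c then e a d else 0)) \<and>
     (\<Sum>a<n. e a a) = 1"

definition mat_sum :: "nat \<Rightarrow> (nat \<Rightarrow> nat \<Rightarrow> complex) \<Rightarrow> (nat \<Rightarrow> nat \<Rightarrow> 'a::unital_cstar_algebra) \<Rightarrow> 'a" where
  "mat_sum n c e = (\<Sum>a<n. \<Sum>b<n. scaleC (c a b) (e a b))"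

definition unit_span :: "nat \<Rightarrow> (nat \<Rightarrow> nat \<Rightarrow> 'a::unital_cstar_algebra) \<Rightarrow> 'a set" where
  "unit_span n e = range (\<lambda>c. mat_sum n c e)"

lemma mat_sum_cong:
  "(\<And>a b. a < n \<Longrightarrow> b < n \<Longrightarrow> c a b = d a b) \<Longrightarrow> mat_sum n c e = mat_sum n d e"
  unfolding mat_sum_def by (intro sum.cong refl) auto

lemma mat_sum_add: "mat_sum n c e + mat_sum n d e = mat_sum n (\<lambda>a b. c a b + d a b) e"
  by (simp add: mat_sum_def scaleC_add_left sum.distrib)

lemma mat_sum_scaleC: "scaleC r (mat_sum n c e) = mat_sum n (\<lambda>a b. r * c a b) e"
  by (simp add: mat_sum_def scaleC.sum_right scaleC_scaleC)

lemma matrix_units_pos: "matrix_units n e \<Longrightarrow> 0 < n"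
  unfolding matrix_units_def by (cases n) auto

lemma matrix_units_limit:
  assumes "\<And>i. matrix_units n (e i)" "\<And>a b. a < n \<Longrightarrow> b < n \<Longrightarrow> (\<lambda>i. e i a b) \<longlonglongrightarrow> l a b"
  shows "matrix_units n l"
  unfolding matrix_units_def
proof (intro conjI allI impI)
  fix a b assume ab: "a < n" "b < n"
  have 1: "(\<lambda>i. adj (e i a b)) \<longlonglongrightarrow> adj (l a b)" by (intro tendsto_intros assms ab)
  have "(\<lambda>i. adj (e i a b)) = (\<lambda>i. e i b a)" using assms(1) ab by (auto simp: matrix_units_def)
  then have "(\<lambda>i. adj (e i a b)) \<longlonglongrightarrow> l b a" using assms(2)[OF ab(2,1)] by simp
  then show "adj (l a b) = l b a" by (rule LIMSEQ_unique[OF 1])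
  fix c d assume cd: "c < n" "d < n"
  have 1: "(\<lambda>i. e i a b * e i c d) \<longlonglongrightarrow> l a b * l c d" by (intro tendsto_intros assms ab cd)
  have "(\<lambda>i. e i a b * e i c d) = (\<lambda>i. if b = c then e i a d else 0)"
    using assms(1) ab cd by (auto simp: matrix_units_def)
  then have "(\<lambda>i. e i a b * e i c d) \<longlonglongrightarrow> (if b = c then l a d else 0)"
    using assms(2)[OF ab(1) cd(2)] by (cases "b = c") auto
  then show "l a b * l c d = (if b = c then l a d else 0)" by (rule LIMSEQ_unique[OF 1])
next
  have 1: "(\<lambda>i. \<Sum>a<n. e i a a) \<longlonglongrightarrow> (\<Sum>a<n. l a a)" by (intro tendsto_sum assms(2)) auto
  have "(\<lambda>i. \<Sum>a<n. e i a a) = (\<lambda>i. 1)" using assms(1) by (auto simp: matrix_units_def)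
  then have "(\<lambda>i. \<Sum>a<n. e i a a) \<longlonglongrightarrow> 1" by simp
  then show "(\<Sum>a<n. l a a) = 1" by (rule LIMSEQ_unique[OF 1])
qed

lemma sum_lessThan_mult:
  fixes f :: "nat \<Rightarrow> 'b::comm_monoid_add"
  shows "(\<Sum>i<d * N. f i) = (\<Sum>l<d. \<Sum>a<N. f (a + l * N))"
proof (induction d)
  case (Suc d)
  have "(\<Sum>i<Suc d * N. f i) = (\<Sum>i<d * N. f i) + (\<Sum>i\<in>{d * N..<d * N + N}. f i)"
    by (subst sum.union_disjoint[symmetric]) (auto intro!: sum.cong)
  also have "(\<Sum>i\<in>{d * N..<d * N + N}. f i) = (\<Sum>a<N. f (a + d * N))"
    by (rule sum.reindex_bij_witness[of _ "\<lambda>a. a + d * N" "\<lambda>i. i - d * N"]) auto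
  finally show ?case using Suc by simp
qed simp

text \<open>The image of the (a, b) matrix unit under diag(X, ..., X) with d blocks of size N; the
  index a + l * N is position a in block l.\<close>

definition diag_sum :: "nat \<Rightarrow> nat \<Rightarrow> (nat \<Rightarrow> nat \<Rightarrow> 'a::comm_monoid_add) \<Rightarrow> nat \<Rightarrow> nat \<Rightarrow> 'a" where
  "diag_sum d N e a b = (\<Sum>l<d. e (a + l * N) (b + l * N))"

lemma add_mult_less: "a < N \<Longrightarrow> l < d \<Longrightarrow> a + l * N < d * (N::nat)"
  using mult_le_mono1[of "Suc l" d N] by simp

lemma add_mult_eq_iff: "a < N \<Longrightarrow> b < N \<Longrightarrow> a + l * N = b + k * N \<longleftrightarrow> a = b \<and> l = (k::nat)"
proof
  assume *: "a < N" "b < N" "a + l * N = b + k * N"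
  then have "(a + l * N) mod N = (b + k * N) mod N" "(a + l * N) div N = (b + k * N) div N"
    by simp_all
  with *(1,2) show "a = b \<and> l = k" by simp
qed simp

lemma matrix_units_diag_sum:
  fixes e :: "nat \<Rightarrow> nat \<Rightarrow> 'a::unital_cstar_algebra"
  assumes "matrix_units (d * N) e"
  shows "matrix_units N (diag_sum d N e)"
  unfolding matrix_units_def
proof (intro conjI allI impI)
  fix a b assume ab: "a < N" "b < N"
  show "adj (diag_sum d N e a b) = diag_sum d N e b a"
    using assms ab unfolding matrix_units_def diag_sum_def by (simp add: adj_sum add_mult_less)
  fix c k assume cd: "c < N" "k < N"
  have "diag_sum d N e a b * diag_sum d N e c k
      = (\<Sum>l<d. \<Sum>m<d. e (a + l * N) (b + l * N) * e (c + m * N) (k + m * N))"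
    unfolding diag_sum_def by (rule sum_product)
  also have "\<dots> = (\<Sum>l<d. \<Sum>m<d. if m = l then (if b = c then e (a + l * N) (k + l * N) else 0) else 0)"
    using assms ab cd unfolding matrix_units_def
    by (intro sum.cong refl) (auto simp: add_mult_less add_mult_eq_iff)
  also have "\<dots> = (if b = c then diag_sum d N e a k else 0)"
    by (simp add: diag_sum_def)
  finally show "diag_sum d N e a b * diag_sum d N e c k = (if b = c then diag_sum d N e a k else 0)" .
next
  have "(\<Sum>a<N. diag_sum d N e a a) = (\<Sum>l<d. \<Sum>a<N. e (a + l * N) (a + l * N))"
    unfolding diag_sum_def by (rule sum.swap)
  also have "\<dots> = 1" using assms unfolding matrix_units_def sum_lessThan_mult by simp
  finally show "(\<Sum>a<N. diag_sum d N e a a) = 1" .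
qed

text \<open>Diagonal embeddings compose: block k of size N inside block l of size d * N is block k +
  l * d of the fine subdivision.\<close>

lemma diag_sum_diag_sum:
  assumes "N > 0"
  shows "diag_sum d N (diag_sum d' (d * N) e) a b = diag_sum (d' * d) N e a b"
proof -
  have "diag_sum (d' * d) N e a b = (\<Sum>l<d'. \<Sum>k<d. e (a + (k + l * d) * N) (b + (k + l * d) * N))"
    unfolding diag_sum_def by (rule sum_lessThan_mult)
  also have "\<dots> = (\<Sum>k<d. \<Sum>l<d'. e (a + (k + l * d) * N) (b + (k + l * d) * N))"
    by (rule sum.swap)
  finally show ?thesis unfolding diag_sum_def by (simp add: algebra_simps)
qed

context
  fixes n and e :: "nat \<Rightarrow> nat \<Rightarrow> 'a::unital_cstar_algebra"
  assumes mu: "matrix_units n e"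
begin

lemma unit_adj: "a < n \<Longrightarrow> b < n \<Longrightarrow> adj (e a b) = e b a"
  using mu by (simp add: matrix_units_def)

lemma unit_mult: "a < n \<Longrightarrow> b < n \<Longrightarrow> c < n \<Longrightarrow> d < n \<Longrightarrow> e a b * e c d = (if b = c then e a d else 0)"
  using mu by (simp add: matrix_units_def)

lemma unit_sum: "(\<Sum>a<n. e a a) = 1"
  using mu by (simp add: matrix_units_def)

text \<open>Every diagonal unit factors through \<open>e a b\<close>, so a vanishing unit would make
  all of them vanish, while they sum to 1.\<close>

lemma unit_nonzero: assumes "a < n" "b < n" shows "e a b \<noteq> 0"
proof
  assume 0: "e a b = 0"
  have "e c c = e c a * e a b * e b c" if "c < n" for c using that assms by (simp add: unit_mult)
  then have "(\<Sum>a<n. e a a) = 0" using 0 by simp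
  then show False using unit_sum by simp
qed

lemma norm_unit: assumes "a < n" "b < n" shows "norm (e a b) = 1"
proof -
  have bb: "norm (e b b) = 1" if "b < n" for b
    using norm_adj_mult_self[of "e b b"] unit_nonzero[of b b] that by (simp add: unit_adj unit_mult power2_eq_square)
  have "(norm (e a b))\<^sup>2 = 1"
    using norm_adj_mult_self[of "e a b"] assms bb by (simp add: unit_adj unit_mult)
  then show ?thesis by (simp add: power2_eq_1_iff) (smt (verit) norm_ge_zero)
qed

text \<open>Compression by two units isolates one coefficient. Uniqueness of coefficients and all
  later corner arguments rest on this.\<close>

lemma mat_sum_corner:
  assumes "a < n" "b < n" "r < n" "t < n" shows "e r a * mat_sum n c e * e b t = scaleC (c a b) (e r t)"
proof -
  have "e r a * mat_sum n c e * e b t = (\<Sum>i<n. \<Sum>j<n. scaleC (c i j) (e r a * e i j * e b t))"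
    by (simp add: mat_sum_def sum_distrib_left sum_distrib_right mult_scaleC_left mult_scaleC_right)
  also have "\<dots> = (\<Sum>i<n. \<Sum>j<n. if j = b then (if i = a then scaleC (c a b) (e r t) else 0) else 0)"
    using assms by (intro sum.cong refl) (auto simp: unit_mult scaleC.zero_right)
  also have "\<dots> = scaleC (c a b) (e r t)" using assms by simp
  finally show ?thesis .
qed

lemma mat_sum_inj: 
  assumes "mat_sum n c e = mat_sum n c' e" "a < n" "b < n" shows "c a b = c' a b"
proof -
  have "scaleC (c a b) (e a b) = scaleC (c' a b) (e a b)"
    using mat_sum_corner[of a b a b] assms by metis
  then have "norm (scaleC (c a b - c' a b) (e a b)) = 0" by (simp add: scaleC.diff_left)
  then show ?thesis using norm_unit assms by (simp add: norm_scaleC)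
qed

lemma decompose: "x = (\<Sum>a<n. \<Sum>b<n. e a a * x * e b b)"
proof -
  have "x = (\<Sum>a<n. e a a) * x * (\<Sum>b<n. e b b)" by (simp add: unit_sum)
  also have "\<dots> = (\<Sum>a<n. \<Sum>b<n. e a a * x * e b b)"
    by (subst sum.swap) (simp only: sum_distrib_right sum_distrib_left)
  finally show ?thesis .
qed

text \<open>Every entry of x is moved to the corner of \<open>e 0 0\<close>, where membership in the
  span means being a scalar multiple of \<open>e 0 0\<close>. This one-dimensional test serves for
  closedness of the span and for inclusions between spans of different systems.\<close>

lemma unit_spanI:
  assumes "\<And>a b. a < n \<Longrightarrow> b < n \<Longrightarrow> \<exists>c. e 0 a * x * e b 0 = scaleC c (e 0 0)"
  shows "x \<in> unit_span n e"
proof -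
  obtain c where c: "\<And>a b. a < n \<Longrightarrow> b < n \<Longrightarrow> e 0 a * x * e b 0 = scaleC (c a b) (e 0 0)"
    using assms by metis
  have pos: "0 < n" using mu by (rule matrix_units_pos)
  have "e a a * x * e b b = scaleC (c a b) (e a b)" if "a < n" "b < n" for a b
  proof -
    have "e a a * x * e b b = e a 0 * (e 0 a * x * e b 0) * e 0 b"
      using that pos by (metis (no_types, opaque_lifting) mult.assoc unit_mult)
    then show ?thesis using that pos by (simp add: c mult_scaleC_left mult_scaleC_right unit_mult)
  qed
  then have "x = mat_sum n c e" unfolding mat_sum_def by (subst decompose) (auto intro!: sum.cong)
  then show ?thesis by (auto simp: unit_span_def)
qed

lemma unit_span_corner:
  assumes "x \<in> unit_span n e" "a < n" "b < n" "r < n" "t < n"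
  shows "\<exists>c. e r a * x * e b t = scaleC c (e r t)"
  using assms mat_sum_corner unfolding unit_span_def by blast

lemma unit_in_unit_span: "a < n \<Longrightarrow> b < n \<Longrightarrow> e a b \<in> unit_span n e"
proof (rule unit_spanI)
  fix i j assume *: "a < n" "b < n" "i < n" "j < n"
  then have "0 < n" by simp
  then have "e 0 i * e a b * e j 0 = scaleC (if i = a \<and> b = j then 1 else 0) (e 0 0)"
    using * by (auto simp: unit_mult scaleC.zero_left)
  then show "\<exists>c. e 0 i * e a b * e j 0 = scaleC c (e 0 0)" ..
qed

lemma mat_sum_mult:
  shows "mat_sum n c e * mat_sum n d e = mat_sum n (\<lambda>a b. \<Sum>k<n. c a k * d k b) e"
proof -
  have row: "e a b * mat_sum n d e = (\<Sum>l<n. scaleC (d b l) (e a l))" if "a < n" "b < n" for a b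
  proof -
    have "e a b * mat_sum n d e = (\<Sum>k<n. \<Sum>l<n. scaleC (d k l) (e a b * e k l))"
      by (simp add: mat_sum_def sum_distrib_left mult_scaleC_right)
    also have "\<dots> = (\<Sum>k<n. if k = b then (\<Sum>l<n. scaleC (d b l) (e a l)) else 0)"
      using that by (intro sum.cong refl) (auto simp: unit_mult scaleC.zero_right)
    also have "\<dots> = (\<Sum>l<n. scaleC (d b l) (e a l))" using that by simp
    finally show ?thesis .
  qed
  have "mat_sum n c e * mat_sum n d e = (\<Sum>a<n. \<Sum>b<n. scaleC (c a b) (e a b * mat_sum n d e))"
    unfolding mat_sum_def[of n c] by (simp add: sum_distrib_right mult_scaleC_left)
  also have "\<dots> = (\<Sum>a<n. \<Sum>b<n. \<Sum>l<n. scaleC (c a b * d b l) (e a l))"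
    by (intro sum.cong refl) (simp add: row scaleC.sum_right scaleC_scaleC)
  also have "\<dots> = mat_sum n (\<lambda>a b. \<Sum>k<n. c a k * d k b) e"
    unfolding mat_sum_def scaleC.sum_left by (rule sum.cong[OF refl]) (rule sum.swap)
  finally show ?thesis .
qed

lemma mat_sum_adj:
  shows "adj (mat_sum n c e) = mat_sum n (\<lambda>a b. cnj (c b a)) e"
proof -
  have "adj (mat_sum n c e) = (\<Sum>a<n. \<Sum>b<n. scaleC (cnj (c a b)) (e b a))"
    by (simp add: mat_sum_def adj_sum adj_scaleC unit_adj)
  also have "\<dots> = mat_sum n (\<lambda>a b. cnj (c b a)) e" unfolding mat_sum_def by (rule sum.swap)
  finally show ?thesis .
qed

lemma mat_sum_identity:
  shows "mat_sum n (\<lambda>a b. if a = b then 1 else 0) e = 1"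
proof -
  have "mat_sum n (\<lambda>a b. if a = b then 1 else 0) e = (\<Sum>a<n. \<Sum>b<n. if b = a then e a b else 0)"
    unfolding mat_sum_def by (intro sum.cong refl) (auto simp: scaleC.zero_left)
  then show ?thesis by (simp add: unit_sum)
qed

lemma unit_span_add: "x \<in> unit_span n e \<Longrightarrow> y \<in> unit_span n e \<Longrightarrow> x + y \<in> unit_span n e"
  unfolding unit_span_def by (auto simp: mat_sum_add)

lemma unit_span_scaleC: "x \<in> unit_span n e \<Longrightarrow> scaleC r x \<in> unit_span n e"
  unfolding unit_span_def by (auto simp: mat_sum_scaleC)

lemma unit_span_mult: "x \<in> unit_span n e \<Longrightarrow> y \<in> unit_span n e \<Longrightarrow> x * y \<in> unit_span n e"
  unfolding unit_span_def by (auto simp: mat_sum_mult)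

lemma unit_span_adj: "x \<in> unit_span n e \<Longrightarrow> adj x \<in> unit_span n e"
  unfolding unit_span_def by (auto simp: mat_sum_adj)

lemma unit_span_scaleR: "x \<in> unit_span n e \<Longrightarrow> scaleR r x \<in> unit_span n e"
  by (simp add: scaleR_scaleC unit_span_scaleC)

lemma unit_span_diff: "x \<in> unit_span n e \<Longrightarrow> y \<in> unit_span n e \<Longrightarrow> x - y \<in> unit_span n e"
  using unit_span_add[of x "scaleR (-1) y"] unit_span_scaleR[of y "-1"] by simp

lemma unit_span_zero: "0 \<in> unit_span n e"
  using unit_span_scaleC[of "e 0 0" 0] unit_in_unit_span[of 0 0] matrix_units_pos[OF mu]
  by (simp add: scaleC.zero_left)

lemma unit_span_sum: "(\<And>i. i \<in> A \<Longrightarrow> f i \<in> unit_span n e) \<Longrightarrow> sum f A \<in> unit_span n e"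
  by (induction A rule: infinite_finite_induct) (auto intro: unit_span_add unit_span_zero)

text \<open>Since \<open>e 0 0\<close> has norm 1, a convergent sequence of its multiples has Cauchy
  coefficients, and this applies in each corner. Closedness keeps the limit of the Newton iteration
  inside a matrix algebra.\<close>

lemma closed_unit_span: "closed (unit_span n e)"
  unfolding closed_sequential_limits
proof (intro allI impI, elim conjE)
  fix x l assume x: "\<forall>i. x i \<in> unit_span n e" and lim: "x \<longlonglongrightarrow> l"
  have pos: "0 < n" using mu by (rule matrix_units_pos)
  show "l \<in> unit_span n e"
  proof (rule unit_spanI)
    fix a b assume ab: "a < n" "b < n"
    have "\<exists>c. e 0 a * x i * e b 0 = scaleC c (e 0 0)" for i
      using unit_span_corner[OF _ ab pos pos] x by blast
    then obtain c where c: "\<And>i. e 0 a * x i * e b 0 = scaleC (c i) (e 0 0)" by metis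
    have conv: "(\<lambda>i. scaleC (c i) (e 0 0)) \<longlonglongrightarrow> e 0 a * l * e b 0"
      unfolding c[symmetric] by (intro tendsto_intros lim)
    then have "Cauchy (\<lambda>i. scaleC (c i) (e 0 0))" using LIMSEQ_imp_Cauchy by blast
    moreover have "dist (scaleC (c i) (e 0 0)) (scaleC (c j) (e 0 0)) = dist (c i) (c j)" for i j
      using norm_unit[OF pos pos] by (simp add: dist_norm norm_scaleC flip: scaleC.diff_left)
    ultimately have "Cauchy c" by (simp add: Cauchy_def)
    then obtain k where "c \<longlonglongrightarrow> k" using Cauchy_convergent convergent_def by blast
    then have "(\<lambda>i. scaleC (c i) (e 0 0)) \<longlonglongrightarrow> scaleC k (e 0 0)" by (intro tendsto_intros)
    with conv have "e 0 a * l * e b 0 = scaleC k (e 0 0)" using LIMSEQ_unique by blast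
    then show "\<exists>c. e 0 a * l * e b 0 = scaleC c (e 0 0)" ..
  qed
qed

end

section \<open>Stability of matrix units\<close>

definition unit_defect :: "(nat \<Rightarrow> nat \<Rightarrow> 'a::ring_1) \<Rightarrow> nat \<Rightarrow> nat \<Rightarrow> nat \<Rightarrow> nat \<Rightarrow> 'a" where
  "unit_defect e a b c d = (if b = c then e a d else 0) - e a b * e c d"

text \<open>The first-order correction of an almost multiplicative map on matrices is obtained by
  contracting the defect with the diagonal \<open>\<Sum>k. e k 0 \<otimes> e 0 k\<close>, from the left or from the
  right. The average of the two versions preserves adjoints.\<close>

definition newton_shift :: "nat \<Rightarrow> (nat \<Rightarrow> nat \<Rightarrow> 'a::unital_cstar_algebra) \<Rightarrow> nat \<Rightarrow> nat \<Rightarrow> 'a" where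
  "newton_shift N e c d = e c 0 * e 0 d
     - scaleR (1/2) ((\<Sum>k<N. e k 0 * e 0 k) * e c d + e c d * (\<Sum>k<N. e k 0 * e 0 k))"

text \<open>An exact identity in which each term on the right is a product of two small factors:
  \<open>Q\<close> and the shift are themselves of the order of the defect, as estimated in
  \<open>newton_step\<close>. Hence the new defect is quadratic in the old one.\<close>

lemma unit_defect_newton:
  fixes e :: "nat \<Rightarrow> nat \<Rightarrow> 'a::unital_cstar_algebra" and N :: nat
  defines "Q \<equiv> 1 - (\<Sum>k<N. e k 0 * e 0 k)"
  assumes "b < N" "c < N"
  shows "unit_defect (\<lambda>a b. e a b + newton_shift N e a b) a b c d =
    scaleR (1/2) (Q * unit_defect e a b c d + unit_defect e a b c d * Q)
    + (\<Sum>k<N. unit_defect e a b k 0 * unit_defect e 0 k c d)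
    - newton_shift N e a b * newton_shift N e c d"
proof -
  define R where "R = (\<Sum>k<N. e k 0 * e 0 k)"
  have "(\<Sum>k<N. unit_defect e a b k 0 * unit_defect e 0 k c d) =
     (\<Sum>k<N. (if k = b then (if b = c then e a 0 * e 0 d else 0) else 0)
       - (if k = b then e a 0 * (e 0 b * e c d) else 0) - (if k = c then e a b * (e c 0 * e 0 d) else 0)
       + e a b * (e k 0 * e 0 k) * e c d)"
    by (intro sum.cong refl) (auto simp: unit_defect_def algebra_simps)
  also have "\<dots> = (if b = c then e a 0 * e 0 d else 0) - e a 0 * (e 0 b * e c d) - e a b * (e c 0 * e 0 d)
       + e a b * R * e c d"
    using assms(2,3) by (simp add: sum.distrib sum_subtractf R_def sum_distrib_left sum_distrib_right)
  finally have S: "(\<Sum>k<N. unit_defect e a b k 0 * unit_defect e 0 k c d) =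
    (if b = c then e a 0 * e 0 d else 0) - e a 0 * (e 0 b * e c d) - e a b * (e c 0 * e 0 d)
       + e a b * R * e c d" .
  define x y D F where "x = e a b" and "y = e c d" and "D = (if b = c then e a d else 0)"
    and "F = (if b = c then e a 0 * e 0 d else 0)"
  define \<eta> \<theta> where "\<eta> = newton_shift N e a b" and "\<theta> = newton_shift N e c d"
  \<comment> \<open>\<open>x * \<theta>\<close> and \<open>\<eta> * y\<close> contribute one half of
    \<open>x * R * y\<close> each; the two halves together match the last term of S. The averaging
    in the shift is compatible with the identity for this reason.\<close>
  have half: "z = scaleR (1/2) z + scaleR (1/2) z" for z :: 'a
    by (simp flip: scaleR_left_distrib)
  have 1: "x * \<theta> = e a b * (e c 0 * e 0 d) - (scaleR (1/2) (x * R * y) + scaleR (1/2) (x * y * R))"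
    by (simp add: \<theta>_def x_def y_def newton_shift_def R_def[symmetric] algebra_simps)
  have 2: "\<eta> * y = e a 0 * (e 0 b * e c d) - (scaleR (1/2) (R * x * y) + scaleR (1/2) (x * R * y))"
    by (simp add: \<eta>_def x_def y_def newton_shift_def R_def[symmetric] algebra_simps)
  have 3: "scaleR (1/2) (Q * (D - x * y) + (D - x * y) * Q) = (D - x * y)
     - scaleR (1/2) (R * D + D * R) + scaleR (1/2) (R * x * y) + scaleR (1/2) (x * y * R)"
    using half[of "D - x * y"] by (simp add: Q_def R_def[symmetric] algebra_simps)
  have "unit_defect (\<lambda>a b. e a b + newton_shift N e a b) a b c d
      = D + (F - scaleR (1/2) (R * D + D * R)) - (x + \<eta>) * (y + \<theta>)"
    by (simp add: unit_defect_def D_def F_def x_def y_def \<eta>_def \<theta>_def)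
      (simp add: newton_shift_def R_def[symmetric])
  also have "\<dots> = D + (F - scaleR (1/2) (R * D + D * R)) - (x * y + x * \<theta> + \<eta> * y + \<eta> * \<theta>)"
    by (simp add: algebra_simps)
  also have "\<dots> = scaleR (1/2) (Q * (D - x * y) + (D - x * y) * Q)
     + (F - e a 0 * (e 0 b * e c d) - e a b * (e c 0 * e 0 d)
        + (scaleR (1/2) (x * R * y) + scaleR (1/2) (x * R * y))) - \<eta> * \<theta>"
    unfolding 1 2 3 by simp
  finally show ?thesis
    unfolding S half[of "x * R * y", symmetric] by (simp add: unit_defect_def D_def F_def x_def y_def \<eta>_def \<theta>_def)
qed

text \<open>The bound 1/2 can be crude: the sum P of the diagonal elements is almost idempotent when
  \<epsilon> is small, so the norm of 1 - P is either close to 0 or not much below 1, and 1/2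
  separates the two cases.\<close>

definition almost_units :: "nat \<Rightarrow> real \<Rightarrow> (nat \<Rightarrow> nat \<Rightarrow> 'a::unital_cstar_algebra) \<Rightarrow> bool" where
  "almost_units N \<epsilon> e \<longleftrightarrow>
     (\<forall>a<N. \<forall>b<N. adj (e a b) = e b a) \<and>
     (\<forall>a<N. \<forall>b<N. \<forall>c<N. \<forall>d<N. norm (unit_defect e a b c d) \<le> \<epsilon>) \<and>
     norm ((\<Sum>a<N. e a a) - 1) \<le> 1/2"

lemma norm_sum_le_const:
  fixes f :: "nat \<Rightarrow> 'b::real_normed_vector"
  assumes "\<And>k. k < N \<Longrightarrow> norm (f k) \<le> C" shows "norm (\<Sum>k<N. f k) \<le> real N * C"
  using sum_norm_bound[of "{..<N}" f C] assms by simp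

text \<open>The remainder is \<epsilon>^2 times 3 N^2 + N + 49 N^4, where 49 = 7^2 comes from the
  product of two shifts. It is at most 53 N^4 \<epsilon>^2, so the factor 128 in the hypothesis
  leaves less than half of the defect.\<close>

lemma newton_step:
  fixes e :: "nat \<Rightarrow> nat \<Rightarrow> 'a::unital_cstar_algebra"
  assumes au: "almost_units N \<epsilon> e" and N: "0 < N" and \<epsilon>: "\<epsilon> * (128 * real N ^ 4) \<le> 1" and \<epsilon>0: "0 \<le> \<epsilon>"
  shows "almost_units N (\<epsilon> / 2) (\<lambda>a b. e a b + newton_shift N e a b)"
    and "a < N \<Longrightarrow> b < N \<Longrightarrow> norm (newton_shift N e a b) \<le> 7 * real N ^ 2 * \<epsilon>"
proof -
  have N1: "1 \<le> real N" using N by simp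
  have pw: "real N ^ i \<le> real N ^ j" if "i \<le> j" for i j by (rule power_increasing[OF that N1])
  have adj_e: "adj (e a b) = e b a" if "a < N" "b < N" for a b using au that by (simp add: almost_units_def)
  have def: "norm (unit_defect e a b c d) \<le> \<epsilon>" if "a < N" "b < N" "c < N" "d < N" for a b c d
    using au that by (simp add: almost_units_def)
  have small: "\<epsilon> * real N ^ j \<le> 1/128" if "j \<le> 4" for j
    using mult_left_mono[OF pw[OF that] \<epsilon>0] \<epsilon> by simp
  have \<epsilon>16: "\<epsilon> \<le> 1/128" using small[of 0] by simp
  \<comment> \<open>\<open>e b b\<close> is self-adjoint, so its norm t satisfies t^2 <= t +
    \<epsilon> by the C*-identity, which excludes t > 3/2.\<close>
  have bb: "norm (e b b) \<le> 3/2" if b: "b < N" for b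
  proof (rule ccontr)
    assume "\<not> norm (e b b) \<le> 3/2"
    then have g: "3/2 < norm (e b b)" by simp
    have "(norm (e b b))\<^sup>2 = norm (e b b * e b b)" using norm_adj_mult_self[of "e b b"] b by (simp add: adj_e)
    also have "\<dots> = norm (e b b - unit_defect e b b b b)" by (simp add: unit_defect_def)
    also have "\<dots> \<le> norm (e b b) + \<epsilon>" using norm_triangle_ineq4[of "e b b"] def[of b b b b] b by (smt (verit))
    finally have "norm (e b b) * norm (e b b) \<le> norm (e b b) + \<epsilon>" by (simp add: power2_eq_square)
    moreover have "3/2 * norm (e b b) \<le> norm (e b b) * norm (e b b)" using g by (intro mult_right_mono) auto
    ultimately show False using g \<epsilon>16 by linarith
  qed
  have e2: "norm (e a b) \<le> 2" if ab: "a < N" "b < N" for a b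
  proof -
    have "(norm (e a b))\<^sup>2 = norm (e b a * e a b)" using norm_adj_mult_self[of "e a b"] ab by (simp add: adj_e)
    also have "\<dots> = norm (e b b - unit_defect e b a a b)" by (simp add: unit_defect_def)
    also have "\<dots> \<le> norm (e b b) + \<epsilon>"
      using norm_triangle_ineq4[of "e b b"] def[of b a a b] ab by (smt (verit))
    also have "\<dots> \<le> 2\<^sup>2" using bb[OF ab(2)] \<epsilon>16 by simp
    finally show ?thesis by (rule power2_le_imp_le) simp
  qed
  define P where "P = (\<Sum>a<N. e a a)"
  define R where "R = (\<Sum>k<N. e k 0 * e 0 k)"
  have RP: "norm (P - R) \<le> real N * \<epsilon>"
  proof -
    have "P - R = (\<Sum>k<N. unit_defect e k 0 0 k)"
      by (simp add: P_def R_def unit_defect_def sum_subtractf)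
    then show ?thesis using def N by (simp add: norm_sum_le_const)
  qed
  have PP: "norm (P - P * P) \<le> real N ^ 2 * \<epsilon>"
  proof -
    have "P - P * P = (\<Sum>a<N. \<Sum>b<N. unit_defect e a a b b)"
      by (simp add: P_def sum_product unit_defect_def sum_subtractf)
    also have "norm \<dots> \<le> real N * (real N * \<epsilon>)" by (intro norm_sum_le_const def)
    finally show ?thesis by (simp add: power2_eq_square mult.assoc)
  qed
  \<comment> \<open>In 1 - P = (1 - P)^2 + (P - P^2) the square has norm at most half that of 1 - P
    and is absorbed on the left. The crude bound 1/2 thereby improves to the order of
    \<epsilon>.\<close>
  have P1: "norm (1 - P) \<le> 2 * real N ^ 2 * \<epsilon>"
  proof -
    have h: "norm (1 - P) \<le> 1/2" using au by (simp add: almost_units_def P_def norm_minus_commute)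
    have "1 - P = (1 - P) * (1 - P) + (P - P * P)" by (simp add: algebra_simps)
    then have "norm (1 - P) \<le> norm (1 - P) * norm (1 - P) + real N ^ 2 * \<epsilon>"
      using PP norm_triangle_ineq[of "(1 - P) * (1 - P)" "P - P * P"] norm_mult_ineq[of "1 - P" "1 - P"] by (smt (verit))
    also have "norm (1 - P) * norm (1 - P) \<le> 1/2 * norm (1 - P)" using h by (intro mult_right_mono) auto
    finally show ?thesis by simp
  qed
  have Q: "norm (1 - R) \<le> 3 * real N ^ 2 * \<epsilon>"
  proof -
    have "norm (1 - R) \<le> norm (1 - P) + norm (P - R)" using norm_triangle_ineq[of "1 - P" "P - R"] by simp
    also have "\<dots> \<le> 2 * real N ^ 2 * \<epsilon> + real N * \<epsilon>" by (intro add_mono P1 RP)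
    also have "real N * \<epsilon> \<le> real N ^ 2 * \<epsilon>" using pw[of 1 2] \<epsilon>0 by (intro mult_right_mono) auto
    finally show ?thesis by (simp add: algebra_simps)
  qed
  \<comment> \<open>The shift is minus a defect plus the average of two products with 1 - R, whence
    7 = 1 + 3 * 2 with the bounds 3 for 1 - R and 2 for the elements e.\<close>
  have shift: "norm (newton_shift N e a b) \<le> 7 * real N ^ 2 * \<epsilon>" if ab: "a < N" "b < N" for a b
  proof -
    have "newton_shift N e a b = - unit_defect e a 0 0 b + scaleR (1/2) ((1 - R) * e a b + e a b * (1 - R))"
      by (simp add: newton_shift_def unit_defect_def R_def[symmetric] algebra_simps flip: scaleR_left_distrib)
    then have "norm (newton_shift N e a b) \<le> norm (unit_defect e a 0 0 b) + 1/2 * norm ((1 - R) * e a b + e a b * (1 - R))"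
      using norm_triangle_ineq[of "- unit_defect e a 0 0 b" "scaleR (1/2) ((1 - R) * e a b + e a b * (1 - R))"] by simp
    also have "norm ((1 - R) * e a b + e a b * (1 - R)) \<le> norm (1 - R) * norm (e a b) + norm (e a b) * norm (1 - R)"
      by (intro order_trans[OF norm_triangle_ineq] add_mono norm_mult_ineq)
    also have "\<dots> = 2 * (norm (1 - R) * norm (e a b))" by simp
    also have "norm (1 - R) * norm (e a b) \<le> (3 * real N ^ 2 * \<epsilon>) * 2" by (rule mult_mono) (use Q e2 ab \<epsilon>0 in auto)
    also have "norm (unit_defect e a 0 0 b) \<le> real N ^ 2 * \<epsilon>"
      using def[of a 0 0 b] ab N mult_right_mono[OF pw[of 0 2] \<epsilon>0] by simp
    finally show ?thesis by (simp add: algebra_simps)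
  qed
  then show "a < N \<Longrightarrow> b < N \<Longrightarrow> norm (newton_shift N e a b) \<le> 7 * real N ^ 2 * \<epsilon>" .
  have adjR: "adj R = R" using N by (simp add: R_def adj_sum adj_mult adj_e)
  have adj_shift: "adj (newton_shift N e a b) = newton_shift N e b a" if "a < N" "b < N" for a b
    using that N by (simp add: newton_shift_def R_def[symmetric] adj_diff adj_add adj_mult adj_scaleR adjR adj_e add.commute)
  show "almost_units N (\<epsilon> / 2) (\<lambda>a b. e a b + newton_shift N e a b)"
    unfolding almost_units_def
  proof (intro conjI allI impI)
    fix a b assume ab: "a < N" "b < N"
    then show "adj (e a b + newton_shift N e a b) = e b a + newton_shift N e b a"
      by (simp add: adj_add adj_e adj_shift)
    fix c d assume cd: "c < N" "d < N"
    have t1: "norm (scaleR (1/2) ((1 - R) * unit_defect e a b c d + unit_defect e a b c d * (1 - R))) \<le> 3 * real N ^ 2 * \<epsilon> * \<epsilon>"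
    proof -
      have "norm ((1 - R) * unit_defect e a b c d + unit_defect e a b c d * (1 - R))
         \<le> norm (1 - R) * norm (unit_defect e a b c d) + norm (unit_defect e a b c d) * norm (1 - R)"
        by (intro order_trans[OF norm_triangle_ineq] add_mono norm_mult_ineq)
      also have "\<dots> = 2 * (norm (1 - R) * norm (unit_defect e a b c d))" by simp
      also have "norm (1 - R) * norm (unit_defect e a b c d) \<le> (3 * real N ^ 2 * \<epsilon>) * \<epsilon>"
        by (rule mult_mono) (use Q def ab cd \<epsilon>0 in auto)
      finally show ?thesis by simp
    qed
    have t2: "norm (\<Sum>k<N. unit_defect e a b k 0 * unit_defect e 0 k c d) \<le> real N * (\<epsilon> * \<epsilon>)"
      by (intro norm_sum_le_const order_trans[OF norm_mult_ineq] mult_mono def) (use ab cd N \<epsilon>0 in auto)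
    have t3: "norm (newton_shift N e a b * newton_shift N e c d) \<le> (7 * real N ^ 2 * \<epsilon>) * (7 * real N ^ 2 * \<epsilon>)"
      by (intro order_trans[OF norm_mult_ineq] mult_mono shift) (use ab cd \<epsilon>0 in auto)
    have "norm (unit_defect (\<lambda>a b. e a b + newton_shift N e a b) a b c d)
       \<le> 3 * real N ^ 2 * \<epsilon> * \<epsilon> + real N * (\<epsilon> * \<epsilon>) + (7 * real N ^ 2 * \<epsilon>) * (7 * real N ^ 2 * \<epsilon>)"
      unfolding unit_defect_newton[OF ab(2) cd(1)] R_def[symmetric]
      by (intro order_trans[OF norm_triangle_ineq4] order_trans[OF norm_triangle_ineq] add_mono t1 t2 t3)
    also have "\<dots> = \<epsilon> * (3 * (\<epsilon> * real N ^ 2) + \<epsilon> * real N ^ 1 + 49 * (\<epsilon> * real N ^ 4))"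
      by (simp add: algebra_simps power_numeral_reduce)
    also have "\<dots> \<le> \<epsilon> * (3 * (1/128) + 1/128 + 49 * (1/128))"
      using \<epsilon>0 by (intro mult_left_mono add_mono small) auto
    also have "\<dots> \<le> \<epsilon> / 2" using \<epsilon>0 by simp
    finally show "norm (unit_defect (\<lambda>a b. e a b + newton_shift N e a b) a b c d) \<le> \<epsilon> / 2" .
  next
    have "norm ((\<Sum>a<N. e a a + newton_shift N e a a) - 1) \<le> norm (P - 1) + norm (\<Sum>a<N. newton_shift N e a a)"
      using norm_triangle_ineq[of "P - 1" "\<Sum>a<N. newton_shift N e a a"] by (simp add: P_def sum.distrib algebra_simps)
    also have "\<dots> \<le> 2 * real N ^ 2 * \<epsilon> + real N * (7 * real N ^ 2 * \<epsilon>)"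
      using P1 by (intro add_mono norm_sum_le_const shift) (auto simp: norm_minus_commute)
    also have "\<dots> = 2 * (\<epsilon> * real N ^ 2) + 7 * (\<epsilon> * real N ^ 3)" by (simp add: algebra_simps power_numeral_reduce)
    also have "\<dots> \<le> 2 * (1/128) + 7 * (1/128)" by (intro add_mono mult_left_mono small) auto
    finally show "norm ((\<Sum>a<N. e a a + newton_shift N e a a) - 1) \<le> 1/2" by simp
  qed
qed

text \<open>The iterates are polynomials in the given elements, so the limit stays in B; with B the
  span of matrix units, the exact system lies in that matrix algebra. The constant 14 sums the
  corrections 7 N^2 \<epsilon> / 2^i.\<close>

lemma almost_units_stable:
  fixes e :: "nat \<Rightarrow> nat \<Rightarrow> 'a::unital_cstar_algebra"
  assumes au: "almost_units N \<epsilon> e" and N: "0 < N" and \<epsilon>: "\<epsilon> * (128 * real N ^ 4) \<le> 1" and \<epsilon>0: "0 \<le> \<epsilon>"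
    and B: "closed B" "\<And>x y. x \<in> B \<Longrightarrow> y \<in> B \<Longrightarrow> x + y \<in> B \<and> x - y \<in> B \<and> x * y \<in> B"
      "\<And>x r. x \<in> B \<Longrightarrow> scaleR r x \<in> B"
    and eB: "\<And>a b. a < N \<Longrightarrow> b < N \<Longrightarrow> e a b \<in> B"
  shows "\<exists>f. matrix_units N f \<and> (\<forall>a<N. \<forall>b<N. f a b \<in> B \<and> norm (f a b - e a b) \<le> 14 * real N ^ 2 * \<epsilon>)"
proof -
  define E where "E = (\<lambda>i. ((\<lambda>e a b. e a b + newton_shift N e a b) ^^ i) e)"
  have E0: "E 0 = e" and ESuc: "E (Suc i) = (\<lambda>a b. E i a b + newton_shift N (E i) a b)" for i
    by (simp_all add: E_def)
  have \<epsilon>i: "\<epsilon> / 2 ^ i * (128 * real N ^ 4) \<le> 1" for i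
  proof -
    have "\<epsilon> / 2 ^ i \<le> \<epsilon>" using divide_left_mono[of 1 "2 ^ i" \<epsilon>] \<epsilon>0 by simp
    then show ?thesis by (rule order_trans[OF mult_right_mono \<epsilon>]) simp
  qed
  have auE: "almost_units N (\<epsilon> / 2 ^ i) (E i)" for i
  proof (induction i)
    case (Suc i)
    show ?case using newton_step(1)[OF Suc N \<epsilon>i] \<epsilon>0 by (simp add: ESuc mult.commute)
  qed (simp add: E0 au)
  have step: "norm (E (Suc i) a b - E i a b) \<le> (7 * real N ^ 2 * \<epsilon>) * (1/2) ^ i" if "a < N" "b < N" for i a b
    using newton_step(2)[OF auE N \<epsilon>i _ that] \<epsilon>0 by (simp add: ESuc power_divide)
  have EB: "E i a b \<in> B" if "a < N" "b < N" for i a b using that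
  proof (induction i arbitrary: a b)
    case (Suc i)
    have z: "0 \<in> B" using B(3)[of _ 0] eB[OF N N] by auto
    have Bsum: "sum f A \<in> B" if "\<And>k. k \<in> A \<Longrightarrow> f k \<in> B" for f and A :: "nat set"
      using that by (induction A rule: infinite_finite_induct) (auto simp: z B(2))
    have "(\<Sum>k<N. E i k 0 * E i 0 k) \<in> B" by (rule Bsum) (simp add: B(2) Suc.IH N)
    moreover have "E i a b \<in> B" "E i a 0 \<in> B" "E i 0 b \<in> B" using Suc N by auto
    ultimately show ?case unfolding ESuc newton_shift_def by (simp add: B(2,3))
  qed (simp add: E0 eB)
  define f where "f a b = lim (\<lambda>i. E i a b)" for a b
  have f: "(\<lambda>i. E i a b) \<longlonglongrightarrow> f a b" "norm (f a b - E i a b) \<le> 2 * (7 * real N ^ 2 * \<epsilon>) * (1/2) ^ i"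
    if ab: "a < N" "b < N" for a b i
  proof -
    obtain l where "(\<lambda>i. E i a b) \<longlonglongrightarrow> l"
      "\<forall>i. norm (l - E i a b) \<le> 2 * (7 * real N ^ 2 * \<epsilon>) * (1/2) ^ i"
      using geometric_limit[of "\<lambda>i. E i a b" "7 * real N ^ 2 * \<epsilon>"] step[OF ab] by blast
    moreover from this(1) have "f a b = l" unfolding f_def by (rule limI)
    ultimately show "(\<lambda>i. E i a b) \<longlonglongrightarrow> f a b"
      "norm (f a b - E i a b) \<le> 2 * (7 * real N ^ 2 * \<epsilon>) * (1/2) ^ i" by auto
  qed
  have fmul: "f a b * f c d = (if b = c then f a d else 0)" if ab: "a < N" "b < N" and cd: "c < N" "d < N" for a b c d
  proof -
    have "(\<lambda>i. if b = c then E i a d else 0) \<longlonglongrightarrow> (if b = c then f a d else 0)"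
      using f(1)[OF ab(1) cd(2)] by auto
    then have 1: "(\<lambda>i. unit_defect (E i) a b c d) \<longlonglongrightarrow> unit_defect f a b c d"
      unfolding unit_defect_def by (intro tendsto_intros f ab cd)
    have 2: "(\<lambda>i. unit_defect (E i) a b c d) \<longlonglongrightarrow> 0"
    proof (rule LIMSEQ_half_power)
      show "norm (unit_defect (E i) a b c d - 0) \<le> \<epsilon> * (1/2) ^ i" for i
        using auE[of i] ab cd by (simp add: almost_units_def power_divide)
    qed
    show ?thesis
      using LIMSEQ_unique[OF 1 2] by (simp add: unit_defect_def)
  qed
  have "f a b \<in> B" if "a < N" "b < N" for a b
    using closed_sequentially[OF B(1) EB[OF that] f(1)[OF that]] .
  moreover have "norm (f a b - e a b) \<le> 14 * real N ^ 2 * \<epsilon>" if "a < N" "b < N" for a b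
    using f(2)[OF that, of 0] by (simp add: E0)
  moreover have "matrix_units N f"
    unfolding matrix_units_def
  proof (intro conjI allI impI)
    fix a b assume ab: "a < N" "b < N"
    have 1: "(\<lambda>i. adj (E i a b)) \<longlonglongrightarrow> adj (f a b)" by (intro tendsto_intros f ab)
    have "(\<lambda>i. adj (E i a b)) = (\<lambda>i. E i b a)" using auE ab by (auto simp: almost_units_def)
    with f(1)[OF ab(2,1)] have "(\<lambda>i. adj (E i a b)) \<longlonglongrightarrow> f b a" by simp
    then show "adj (f a b) = f b a" by (rule LIMSEQ_unique[OF 1])
    fix c d assume "c < N" "d < N"
    with ab show "f a b * f c d = (if b = c then f a d else 0)" by (rule fmul)
  next
    define P where "P = (\<Sum>a<N. f a a)"
    have lim: "(\<lambda>i. \<Sum>a<N. E i a a) \<longlonglongrightarrow> P" unfolding P_def by (intro tendsto_sum f) auto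
    have h: "norm (P - 1) \<le> 1/2"
    proof (rule LIMSEQ_le_const2)
      show "(\<lambda>i. norm ((\<Sum>a<N. E i a a) - 1)) \<longlonglongrightarrow> norm (P - 1)" by (intro tendsto_intros lim)
      show "\<exists>M. \<forall>i\<ge>M. norm ((\<Sum>a<N. E i a a) - 1) \<le> 1/2" using auE by (auto simp: almost_units_def)
    qed
    \<comment> \<open>P is idempotent, hence so is 1 - P, and an idempotent of norm at most 1/2 is
      0.\<close>
    have "P * P = (\<Sum>a<N. \<Sum>b<N. if b = a then f a b else 0)"
      unfolding P_def sum_product by (intro sum.cong refl) (auto simp: fmul)
    then have "P * P = P" by (simp add: P_def)
    then have "1 - P = (1 - P) * (1 - P)" by (simp add: algebra_simps)
    then have "norm (1 - P) \<le> norm (1 - P) * norm (1 - P)" using norm_mult_ineq[of "1 - P" "1 - P"] by simp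
    also have "\<dots> \<le> 1/2 * norm (1 - P)" using h by (intro mult_right_mono) (auto simp: norm_minus_commute)
    finally show "(\<Sum>a<N. f a a) = 1" by (simp add: P_def)
  qed
  ultimately show ?thesis by blast
qed

section \<open>Refinement of matrix units\<close>

text \<open>Elements x of the span with x * e 0 0 = x are column vectors, and adj x * y is their
  inner product times \<open>e 0 0\<close>. In these terms this is Gram-Schmidt applied to the
  columns p * e a 0 with a < m, and the sum of the g i * adj (g i) is the projection onto the span
  of the g i.\<close>

lemma orthonormal_column_span:
  fixes e :: "nat \<Rightarrow> nat \<Rightarrow> 'a::unital_cstar_algebra"
  assumes mu: "matrix_units n e" and p: "p \<in> unit_span n e" "adj p = p" "p * p = p"
  shows "m \<le> n \<Longrightarrow> \<exists>(d::nat) g. (\<forall>i<d. g i \<in> unit_span n e \<and> p * g i = g i \<and> g i * e 0 0 = g i) \<and>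
     (\<forall>i<d. \<forall>j<d. adj (g i) * g j = (if i = j then e 0 0 else 0)) \<and>
     (\<forall>a<m. (\<Sum>i<d. g i * adj (g i)) * (p * e a 0) = p * e a 0)"
proof (induction m)
  case 0
  show ?case by (rule exI[of _ "0::nat"]) simp
next
  case (Suc m)
  obtain d :: nat and g :: "nat \<Rightarrow> 'a"
    where G: "(\<forall>i<d. g i \<in> unit_span n e \<and> p * g i = g i \<and> g i * e 0 0 = g i) \<and>
     (\<forall>i<d. \<forall>j<d. adj (g i) * g j = (if i = j then e 0 0 else 0)) \<and>
     (\<forall>a<m. (\<Sum>i<d. g i * adj (g i)) * (p * e a 0) = p * e a 0)"
    using Suc.IH[OF Suc_leD[OF Suc.prems]] by (elim exE)
  from G have g: "\<And>i. i < d \<Longrightarrow> g i \<in> unit_span n e" "\<And>i. i < d \<Longrightarrow> p * g i = g i"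
      "\<And>i. i < d \<Longrightarrow> g i * e 0 0 = g i"
    and gg: "\<And>i j. i < d \<Longrightarrow> j < d \<Longrightarrow> adj (g i) * g j = (if i = j then e 0 0 else 0)"
    and Kp: "\<And>a. a < m \<Longrightarrow> (\<Sum>i<d. g i * adj (g i)) * (p * e a 0) = p * e a 0"
    by simp_all
  have pos: "0 < n" and mn: "m < n" using Suc.prems by auto
  note um = unit_mult[OF mu] and ua = unit_adj[OF mu]
  define K where "K = (\<Sum>i<d. g i * adj (g i))"
  \<comment> \<open>The component of the next column orthogonal to the g i; if it vanishes, the
    family stays as it is.\<close>
  define x where "x = p * e m 0 - K * (p * e m 0)"
  have e0g: "e 0 0 * adj (g i) = adj (g i)" if "i < d" for i
    using arg_cong[OF g(3)[OF that], of adj] by (simp add: adj_mult ua pos)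
  have gK: "adj (g i) * K = adj (g i)" if "i < d" for i
  proof -
    have "adj (g i) * K = (\<Sum>j<d. (adj (g i) * g j) * adj (g j))"
      by (simp add: K_def sum_distrib_left mult.assoc)
    also have "\<dots> = (\<Sum>j<d. if j = i then e 0 0 * adj (g i) else 0)"
      by (intro sum.cong refl) (auto simp: gg that)
    also have "\<dots> = adj (g i)" using that by (simp add: e0g)
    finally show ?thesis .
  qed
  have gx: "adj (g i) * x = 0" if "i < d" for i
    using gK[OF that] by (simp add: x_def right_diff_distrib flip: mult.assoc)
  have xg: "adj x * g i = 0" if "i < d" for i
    using arg_cong[OF gx[OF that], of adj] by (simp add: adj_mult adj_adj)
  have xK: "adj x * (K * y) = 0" for y
  proof -
    have "adj x * K = (\<Sum>i<d. (adj x * g i) * adj (g i))" by (simp add: K_def sum_distrib_left mult.assoc)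
    also have "\<dots> = 0" by (simp add: xg)
    finally show ?thesis by (simp flip: mult.assoc)
  qed
  have pK: "p * K = K" by (simp add: K_def sum_distrib_left g(2) flip: mult.assoc)
  have px: "p * x = x" using p(3) pK by (simp add: x_def right_diff_distrib flip: mult.assoc)
  have xe: "x * e 0 0 = x" using mn pos by (simp add: x_def left_diff_distrib um mult.assoc)
  have K_span: "K \<in> unit_span n e"
    unfolding K_def by (intro unit_span_sum[OF mu] unit_span_mult[OF mu] unit_span_adj[OF mu]) (auto intro: g)
  have x_span: "x \<in> unit_span n e"
    unfolding x_def by (intro unit_span_diff[OF mu] unit_span_mult[OF mu] p(1) K_span unit_in_unit_span[OF mu] mn pos)
  have pe: "p * e m 0 = x + K * (p * e m 0)" by (simp add: x_def)
  show ?case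
  proof (cases "x = 0")
    case True
    then have "K * (p * e m 0) = p * e m 0" using pe by simp
    then show ?thesis using g gg Kp unfolding K_def
      by (intro exI[of _ d] exI[of _ g]) (auto simp: less_Suc_eq)
  next
    case False
    have "\<forall>a. \<exists>t. a < n \<longrightarrow> e 0 a * x * e 0 0 = scaleC t (e 0 0)"
      using unit_span_corner[OF mu x_span _ pos pos pos] by blast
    then obtain t where t: "\<And>a. a < n \<Longrightarrow> e 0 a * x * e 0 0 = scaleC (t a) (e 0 0)" by metis
    have x_sum: "x = (\<Sum>a<n. scaleC (t a) (e a 0))"
    proof -
      have "x = (\<Sum>a<n. e a a) * x" by (simp add: unit_sum[OF mu])
      also have "\<dots> = (\<Sum>a<n. e a a * x)" by (rule sum_distrib_right)
      also have "\<dots> = (\<Sum>a<n. scaleC (t a) (e a 0))"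
      proof (intro sum.cong refl)
        fix a assume "a \<in> {..<n}"
        then have a: "a < n" by simp
        have "e a a * x = e a 0 * (e 0 a * x * e 0 0)"
          using a pos xe by (simp add: um mult.assoc flip: mult.assoc[of "e a 0" "e 0 a"])
        also have "\<dots> = scaleC (t a) (e a 0)" using a pos by (simp add: t mult_scaleC_right um)
        finally show "e a a * x = scaleC (t a) (e a 0)" .
      qed
      finally show ?thesis .
    qed
    \<comment> \<open>The squared Euclidean norm of the column x, by whose root x is
      normalized.\<close>
    define r where "r = (\<Sum>a<n. (cmod (t a))\<^sup>2)"
    have xx: "adj x * x = scaleR r (e 0 0)"
    proof -
      have "adj x * x = (\<Sum>a<n. \<Sum>b<n. scaleC (cnj (t a) * t b) (e 0 a * e b 0))"
        by (subst (1 2) x_sum)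
          (simp add: adj_sum adj_scaleC ua pos sum_product mult_scaleC_left mult_scaleC_right scaleC_scaleC mult.commute)
      also have "\<dots> = (\<Sum>a<n. \<Sum>b<n. if b = a then scaleC (cnj (t a) * t a) (e 0 0) else 0)"
        using pos by (intro sum.cong refl) (auto simp: um scaleC.zero_right)
      also have "\<dots> = (\<Sum>a<n. scaleC (complex_of_real ((cmod (t a))\<^sup>2)) (e 0 0))"
        by (simp only: complex_norm_square mult.commute[of "cnj _"] sum.delta finite_lessThan) simp
      also have "\<dots> = scaleR r (e 0 0)" by (simp add: r_def scaleR_scaleC scaleC.sum_left)
      finally show ?thesis .
    qed
    have r0: "r \<noteq> 0" using xx False by (auto simp: adj_mult_self_eq_0)
    have "r \<ge> 0" by (simp add: r_def sum_nonneg)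
    with r0 have r: "r > 0" by simp
    define h where "h = (\<lambda>i. if i = d then scaleR (1 / sqrt r) x else g i)"
    have hd: "h d = scaleR (1 / sqrt r) x" and hi: "\<And>i. i < d \<Longrightarrow> h i = g i" by (auto simp: h_def)
    have ss: "1 / sqrt r * (1 / sqrt r) = 1 / r" using r by (simp add: real_sqrt_mult_self)
    have hh: "adj (h d) * h d = e 0 0"
    proof -
      have "adj (h d) * h d = scaleR (1 / sqrt r * (1 / sqrt r)) (adj x * x)" by (simp add: hd adj_scaleR)
      then show ?thesis using r unfolding ss xx by simp
    qed
    have K': "(\<Sum>i<Suc d. h i * adj (h i)) = K + scaleR (1 / r) (x * adj x)"
    proof -
      have "h d * adj (h d) = scaleR (1 / sqrt r * (1 / sqrt r)) (x * adj x)" by (simp add: hd adj_scaleR)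
      then have "h d * adj (h d) = scaleR (1 / r) (x * adj x)" unfolding ss .
      then show ?thesis by (simp add: K_def hi)
    qed
    show ?thesis
    proof (intro exI[of _ "Suc d"] exI[of _ h] conjI allI impI)
      fix i assume "i < Suc d"
      then have i: "i < d \<or> i = d" by linarith
      then show "h i \<in> unit_span n e" by (auto simp: hi hd g unit_span_scaleR[OF mu] x_span)
      from i show "p * h i = h i" by (auto simp: hi hd g px)
      from i show "h i * e 0 0 = h i" by (auto simp: hi hd g xe)
      fix j assume "j < Suc d"
      then have j: "j < d \<or> j = d" by linarith
      have "adj (h k) * h d = 0" "adj (h d) * h k = 0" if "k < d" for k
        using that by (auto simp: hd hi adj_scaleR gx xg)
      then show "adj (h i) * h j = (if i = j then e 0 0 else 0)"
        using i j hh by (auto simp: hi gg)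
    next
      fix a assume "a < Suc m"
      then consider "a < m" | "a = m" by linarith
      then show "(\<Sum>i<Suc d. h i * adj (h i)) * (p * e a 0) = p * e a 0"
      proof cases
        case 1
        have "adj x * (p * e a 0) = 0" using xK[of "p * e a 0"] Kp[OF 1] by (simp add: K_def)
        then show ?thesis unfolding K' using Kp[OF 1] by (simp add: distrib_right K_def mult.assoc)
      next
        case 2
        have "adj x * (p * e m 0) = adj x * x" using xK[of "p * e m 0"] by (subst pe) (simp add: distrib_left)
        then have "x * adj x * (p * e m 0) = scaleR r x" by (simp add: xx xe mult.assoc)
        moreover have "K * (p * e m 0) + x = p * e m 0" by (simp add: x_def)
        ultimately show ?thesis unfolding K' 2 using r by (simp add: distrib_right)
      qed
    qed
  qed
qed

text \<open>The g l are an orthonormal basis of the range of \<open>f 0 0\<close>, and f a 0 carries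
  them to the range of f a a. All these vectors together form a basis adapted to f; E consists of
  its rank-one operators, which span everything that e spans.\<close>

lemma matrix_units_refine:
  fixes e f :: "nat \<Rightarrow> nat \<Rightarrow> 'a::unital_cstar_algebra"
  assumes mu: "matrix_units n e" and mf: "matrix_units N f"
    and span: "\<And>a b. a < N \<Longrightarrow> b < N \<Longrightarrow> f a b \<in> unit_span n e"
  shows "\<exists>d E. matrix_units (d * N) E \<and> (\<forall>a<N. \<forall>b<N. diag_sum d N E a b = f a b) \<and>
    unit_span n e \<subseteq> unit_span (d * N) E"
proof -
  note pos = matrix_units_pos[OF mu] and posN = matrix_units_pos[OF mf]
  note um = unit_mult[OF mu] and ua = unit_adj[OF mu]
  note fm = unit_mult[OF mf] and fa = unit_adj[OF mf]
  define p where "p = f 0 0"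
  have p: "p \<in> unit_span n e" "adj p = p" "p * p = p" using span posN by (auto simp: p_def fa fm)
  obtain d :: nat and g :: "nat \<Rightarrow> 'a"
    where G: "(\<forall>i<d. g i \<in> unit_span n e \<and> p * g i = g i \<and> g i * e 0 0 = g i) \<and>
     (\<forall>i<d. \<forall>j<d. adj (g i) * g j = (if i = j then e 0 0 else 0)) \<and>
     (\<forall>a<n. (\<Sum>i<d. g i * adj (g i)) * (p * e a 0) = p * e a 0)"
    using orthonormal_column_span[OF mu p order_refl] by (elim exE)
  from G have g: "\<And>i. i < d \<Longrightarrow> g i \<in> unit_span n e" "\<And>i. i < d \<Longrightarrow> p * g i = g i"
      "\<And>i. i < d \<Longrightarrow> g i * e 0 0 = g i"
    and gg: "\<And>i j. i < d \<Longrightarrow> j < d \<Longrightarrow> adj (g i) * g j = (if i = j then e 0 0 else 0)"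
    and Kp: "\<And>a. a < n \<Longrightarrow> (\<Sum>i<d. g i * adj (g i)) * (p * e a 0) = p * e a 0"
    by simp_all
  have gp: "adj (g i) * p = adj (g i)" if "i < d" for i
    using arg_cong[OF g(2)[OF that], of adj] p(2) by (simp add: adj_mult)
  have e0g: "e 0 0 * adj (g i) = adj (g i)" if "i < d" for i
    using arg_cong[OF g(3)[OF that], of adj] by (simp add: adj_mult ua pos)
  have K: "(\<Sum>i<d. g i * adj (g i)) = p"
  proof -
    define K where "K = (\<Sum>i<d. g i * adj (g i))"
    have "K * p = K" by (simp add: K_def sum_distrib_right mult.assoc gp)
    \<comment> \<open>K fixes the columns p * e a 0, and p is recovered from them by multiplying
      with e 0 a and summing over a.\<close>
    moreover have "K * p = p"
    proof -
      have "K * p = K * (p * (\<Sum>a<n. e a 0 * e 0 a))" using pos by (simp add: um unit_sum[OF mu])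
      also have "\<dots> = (\<Sum>a<n. K * (p * e a 0) * e 0 a)" by (simp add: sum_distrib_left mult.assoc)
      also have "\<dots> = (\<Sum>a<n. p * (e a 0 * e 0 a))" by (intro sum.cong refl) (simp add: K_def Kp mult.assoc)
      also have "\<dots> = p * (\<Sum>a<n. e a 0 * e 0 a)" by (simp add: sum_distrib_left)
      also have "\<dots> = p" using pos by (simp add: um unit_sum[OF mu])
      finally show ?thesis .
    qed
    ultimately show ?thesis by (simp add: K_def)
  qed
  define u where "u i = f (i mod N) 0 * g (i div N)" for i
  define E where "E i j = u i * adj (u j)" for i j
  have bound: "i mod N < N" "i div N < d" if "i < d * N" for i
    using that posN by (auto simp: less_mult_imp_div_less)
  have adj_u: "adj (u i) = adj (g (i div N)) * f 0 (i mod N)" if "i < d * N" for i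
    using bound[OF that] posN by (simp add: u_def adj_mult fa)
  have uu: "adj (u i) * u j = (if i = j then e 0 0 else 0)" if ij: "i < d * N" "j < d * N" for i j
  proof -
    have "adj (u i) * u j = adj (g (i div N)) * (f 0 (i mod N) * f (j mod N) 0) * g (j div N)"
      unfolding adj_u[OF ij(1)] by (simp add: u_def mult.assoc)
    also have "\<dots> = (if i mod N = j mod N then adj (g (i div N)) * (p * g (j div N)) else 0)"
      using bound[OF ij(1)] bound[OF ij(2)] posN by (simp add: fm p_def mult.assoc)
    also have "\<dots> = (if i mod N = j mod N \<and> i div N = j div N then e 0 0 else 0)"
      using bound[OF ij(1)] bound[OF ij(2)] by (simp add: g(2) gg)
    also have "i mod N = j mod N \<and> i div N = j div N \<longleftrightarrow> i = j" by (metis div_mod_decomp)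
    finally show ?thesis .
  qed
  have ue: "u i * e 0 0 = u i" if "i < d * N" for i
    using bound[OF that] by (simp add: u_def mult.assoc g(3))
  have diag: "diag_sum d N E a b = f a b" if ab: "a < N" "b < N" for a b
  proof -
    have "diag_sum d N E a b = (\<Sum>l<d. f a 0 * (g l * adj (g l)) * f 0 b)"
      unfolding diag_sum_def E_def
      by (intro sum.cong refl) (use ab in \<open>simp add: adj_u add_mult_less\<close>, simp add: u_def ab posN mult.assoc)
    also have "\<dots> = f a 0 * (\<Sum>l<d. g l * adj (g l)) * f 0 b" by (simp add: sum_distrib_left sum_distrib_right)
    also have "\<dots> = f a b" using ab posN by (simp add: K p_def fm)
    finally show ?thesis .
  qed
  have muE: "matrix_units (d * N) E"
    unfolding matrix_units_def
  proof (intro conjI allI impI)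
    show "adj (E a b) = E b a" for a b by (simp add: E_def adj_mult adj_adj)
    fix i j k l assume ij: "i < d * N" "j < d * N" and kl: "k < d * N" "l < d * N"
    have "E i j * E k l = u i * (adj (u j) * u k) * adj (u l)" by (simp add: E_def mult.assoc)
    also have "\<dots> = (if j = k then E i l else 0)" using ij kl by (simp add: uu ue E_def)
    finally show "E i j * E k l = (if j = k then E i l else 0)" .
  next
    have "(\<Sum>i<d * N. E i i) = (\<Sum>a<N. diag_sum d N E a a)"
      unfolding sum_lessThan_mult diag_sum_def by (rule sum.swap)
    also have "\<dots> = (\<Sum>a<N. f a a)" by (intro sum.cong refl) (simp add: diag)
    finally show "(\<Sum>i<d * N. E i i) = 1" by (simp add: unit_sum[OF mf])
  qed
  have u_span: "u i \<in> unit_span n e" if "i < d * N" for i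
    unfolding u_def using bound[OF that] posN by (intro unit_span_mult[OF mu] span g) auto
  \<comment> \<open>The compression \<open>adj (u i) * x * u j\<close> lies in the corner of
    \<open>e 0 0\<close>, where the span of e is one-dimensional; so the corner test for E
    succeeds.\<close>
  have "unit_span n e \<subseteq> unit_span (d * N) E"
  proof (rule subsetI, rule unit_spanI[OF muE])
    fix x i j assume x: "x \<in> unit_span n e" and ij: "i < d * N" "j < d * N"
    have z: "0 < d * N" using ij by linarith
    have "adj (u i) * x * u j \<in> unit_span n e"
      by (intro unit_span_mult[OF mu] unit_span_adj[OF mu] u_span ij x)
    from unit_span_corner[OF mu this pos pos pos pos] obtain c where
      c: "e 0 0 * (adj (u i) * x * u j) * e 0 0 = scaleC c (e 0 0)" by blast
    have "adj (u i) * x * u j = e 0 0 * (adj (u i) * x * u j) * e 0 0"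
    proof -
      have "e 0 0 * (adj (u i) * x * u j) * e 0 0 = adj (u i * e 0 0) * x * (u j * e 0 0)"
        by (simp add: adj_mult ua pos mult.assoc)
      then show ?thesis by (simp add: ue ij)
    qed
    then have c: "adj (u i) * x * u j = scaleC c (e 0 0)" using c by simp
    have "E 0 i * x * E j 0 = u 0 * (adj (u i) * x * u j) * adj (u 0)" by (simp add: E_def mult.assoc)
    also have "\<dots> = scaleC c (E 0 0)"
      unfolding c using ue[OF z] by (simp add: mult_scaleC_left mult_scaleC_right E_def)
    finally show "\<exists>c. E 0 i * x * E j 0 = scaleC c (E 0 0)" ..
  qed
  with muE diag show ?thesis by blast
qed

section \<open>Evaluation of rational points\<close>

lemma letter_point_eq:
  "letter_point P s l = (if l mod 2 = 0 then s (l div 2) else involution P (s (l div 2)))"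
  unfolding letter_point_def sum_decode_def by (simp add: even_iff_mod_2_eq_zero)

definition mono_val :: "(nat \<Rightarrow> 'a::unital_cstar_algebra) \<Rightarrow> nat \<Rightarrow> 'a" where
  "mono_val L m = scaleC (gval (pfst m)) (prod_list (map L (word_of m)))"

definition poly_val :: "(nat \<Rightarrow> 'a::unital_cstar_algebra) \<Rightarrow> nat \<Rightarrow> 'a" where
  "poly_val L q = sum_list (map (mono_val L) (list_decode q))"

lemma word_of_eq: "word_of m = pfst (psnd m) # list_decode (psnd (psnd m))"
  by (simp add: word_of_def prod_decode_pfst_psnd)

text \<open>Formulated for a map out of a bundle so that it serves twice: the identity handles
  rational points of the whole algebra, and \<open>mat_val\<close> those of a matrix algebra. Both
  become values of \<open>poly_val\<close>, differing only in the letters.\<close>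

lemma hom_rational_point:
  fixes P :: "'b star_algebra" and h :: "'b \<Rightarrow> 'a::unital_cstar_algebra"
  assumes s: "\<And>l. letter_point P s l \<in> carrier P"
    and mult: "\<And>x y. x \<in> carrier P \<Longrightarrow> y \<in> carrier P \<Longrightarrow>
        monoid.mult P x y \<in> carrier P \<and> h (monoid.mult P x y) = h x * h y"
    and add: "\<And>x y. x \<in> carrier P \<Longrightarrow> y \<in> carrier P \<Longrightarrow>
        ring.add P x y \<in> carrier P \<and> h (ring.add P x y) = h x + h y"
    and zero: "ring.zero P \<in> carrier P" "h (ring.zero P) = 0"
    and smult: "\<And>c x. x \<in> carrier P \<Longrightarrow>
        module.smult P c x \<in> carrier P \<and> h (module.smult P c x) = scaleC c (h x)"
  shows "h (rational_point P s q) = poly_val (\<lambda>l. h (letter_point P s l)) q"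
proof -
  have fold: "foldl (monoid.mult P) a (map (letter_point P s) ws) \<in> carrier P \<and>
      h (foldl (monoid.mult P) a (map (letter_point P s) ws)) = h a * prod_list (map (\<lambda>l. h (letter_point P s l)) ws)"
    if "a \<in> carrier P" for a ws
    using that by (induction ws arbitrary: a) (simp_all add: mult s mult.assoc)
  have mono: "monomial_point P s m \<in> carrier P \<and> h (monomial_point P s m) = mono_val (\<lambda>l. h (letter_point P s l)) m" for m
    unfolding monomial_point_def prod_decode_pfst_psnd case_prod_conv
    by (simp add: smult fold s mono_val_def word_of_eq gval_def)
  have "foldr (ring.add P) (map (monomial_point P s) ms) (ring.zero P) \<in> carrier P \<and>
      h (foldr (ring.add P) (map (monomial_point P s) ms) (ring.zero P))
        = sum_list (map (mono_val (\<lambda>l. h (letter_point P s l))) ms)" for ms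
    by (induction ms) (simp_all add: zero add mono)
  then show ?thesis by (simp add: rational_point_def poly_val_def)
qed

definition eval_point :: "(nat \<Rightarrow> 'a::unital_cstar_algebra) \<Rightarrow> nat \<Rightarrow> 'a" where
  "eval_point s = rational_point whole_algebra s"

lemma eval_point_poly_val: "eval_point s q = poly_val (letter_point whole_algebra s) q"
  unfolding eval_point_def
  using hom_rational_point[of whole_algebra s "\<lambda>x. x" q]
  by (simp add: whole_algebra_def scaleC.zero_right)

lemma poly_val_0 [simp]: "poly_val L 0 = 0"
  by (simp add: poly_val_def)

lemma poly_val_add: "poly_val L (poly_add p q) = poly_val L p + poly_val L q"
  by (simp add: poly_val_def poly_add_def)

lemma mono_val_monomial_code: "w \<noteq> [] \<Longrightarrow> mono_val L (monomial_code c w) = scaleC (gval c) (prod_list (map L w))"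
  by (simp add: mono_val_def)

lemma poly_val_scale: "poly_val L (poly_scale c p) = scaleC (gval c) (poly_val L p)"
proof -
  have "sum_list (map (mono_val L) (map (\<lambda>m. monomial_code (gauss_mult c (pfst m)) (word_of m)) ms))
      = scaleC (gval c) (sum_list (map (mono_val L) ms))" for ms
    by (induction ms) (simp_all add: scaleC.zero_right scaleC_add_right mono_val_monomial_code gval_mult
        scaleC_scaleC, simp add: mono_val_def scaleC_scaleC)
  then show ?thesis by (simp add: poly_val_def poly_scale_def)
qed

lemma poly_val_mult: "poly_val L (poly_mult p q) = poly_val L p * poly_val L q"
proof -
  have 1: "sum_list (map (mono_val L) (map (\<lambda>b. monomial_code (gauss_mult (pfst a) (pfst b)) (word_of a @ word_of b)) ms))
      = mono_val L a * sum_list (map (mono_val L) ms)" for a ms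
    by (induction ms) (simp_all add: mono_val_monomial_code gval_mult distrib_left,
      simp add: mono_val_def mult_scaleC_left mult_scaleC_right scaleC_scaleC mult.commute)
  have "sum_list (map (mono_val L) (concat (map (\<lambda>a. map (\<lambda>b. monomial_code (gauss_mult (pfst a) (pfst b)) (word_of a @ word_of b)) ns) ms)))
      = sum_list (map (mono_val L) ms) * sum_list (map (mono_val L) ns)" for ms ns
    by (induction ms) (simp_all add: 1 distrib_right del: map_map)
  then show ?thesis by (simp add: poly_val_def poly_mult_def del: map_map map_concat)
qed

lemma adj_prod_list: "adj (prod_list xs) = prod_list (rev (map adj (xs :: 'a::unital_cstar_algebra list)))"
  by (induction xs) (simp_all add: adj_mult)

lemma poly_val_adj:
  assumes "\<And>l. L (flip_letter l) = adj (L l)"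
  shows "poly_val L (poly_adj p) = adj (poly_val L p)"
proof -
  have 1: "mono_val L (monomial_code (gauss_conj (pfst m)) (map flip_letter (rev (word_of m)))) = adj (mono_val L m)" for m
    by (subst mono_val_monomial_code)
      (simp_all add: mono_val_def gval_conj adj_scaleC adj_prod_list rev_map comp_def assms)
  have "sum_list (map (mono_val L) (map (\<lambda>m. monomial_code (gauss_conj (pfst m)) (map flip_letter (rev (word_of m)))) ms))
      = adj (sum_list (map (mono_val L) ms))" for ms
    by (induction ms) (simp_all add: 1 adj_add)
  then show ?thesis by (simp add: poly_val_def poly_adj_def del: map_map)
qed

lemma letter_point_flip: "letter_point whole_algebra s (flip_letter l) = adj (letter_point whole_algebra s l)"
proof (cases "l mod 2 = 0")
  case True
  then have "Suc l mod 2 \<noteq> 0" "Suc l div 2 = l div 2" by presburger+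
  with True show ?thesis by (simp add: letter_point_eq flip_letter_def whole_algebra_def)
next
  case False
  then have "(l - 1) mod 2 = 0" "(l - 1) div 2 = l div 2" by presburger+
  with False show ?thesis by (simp add: letter_point_eq flip_letter_def whole_algebra_def adj_adj)
qed

lemma eval_point_simps [simp]:
  "eval_point s 0 = 0"
  "eval_point s (poly_add p q) = eval_point s p + eval_point s q"
  "eval_point s (poly_scale c p) = scaleC (gval c) (eval_point s p)"
  "eval_point s (poly_mult p q) = eval_point s p * eval_point s q"
  "eval_point s (poly_adj p) = adj (eval_point s p)"
  by (simp_all add: eval_point_poly_val poly_val_add poly_val_scale poly_val_mult poly_val_adj letter_point_flip)

lemma eval_point_poly_subst:
  "eval_point s (poly_subst D q) = poly_val (\<lambda>l. eval_point s (poly_subst_letter D l)) q"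
proof -
  define L where "L = (\<lambda>l. eval_point s (poly_subst_letter D l))"
  have w: "eval_point s (foldl (\<lambda>t l. poly_mult t (poly_subst_letter D l)) a ws)
      = eval_point s a * prod_list (map L ws)" for a ws
    by (induction ws arbitrary: a) (simp_all add: L_def mult.assoc)
  have "eval_point s (foldl (\<lambda>r m. poly_add r (poly_scale (pfst m)
     (foldl (\<lambda>t l. poly_mult t (poly_subst_letter D l)) (poly_subst_letter D (pfst (psnd m)))
       (list_decode (psnd (psnd m)))))) a ms) = eval_point s a + sum_list (map (mono_val L) ms)" for a ms
  proof (induction ms arbitrary: a)
    case (Cons m ms)
    have "mono_val L m = scaleC (gval (pfst m)) (L (pfst (psnd m)) * prod_list (map L (list_decode (psnd (psnd m)))))"
      by (simp add: mono_val_def word_of_eq)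
    with Cons show ?case by (simp add: w L_def add.assoc)
  qed simp
  then show ?thesis by (simp add: poly_subst_def poly_val_def L_def)
qed

lemma eval_point_poly_subst_letter:
  "eval_point s (poly_subst_letter D l) =
    (if l mod 2 = 0 then eval_point s (D (l div 2)) else adj (eval_point s (D (l div 2))))"
  by (simp add: poly_subst_letter_def)

lemma tendsto_poly_val:
  assumes "\<And>l. (\<lambda>i. L i l) \<longlonglongrightarrow> M l"
  shows "(\<lambda>i. poly_val (L i) q) \<longlonglongrightarrow> poly_val M q"
proof -
  have 1: "(\<lambda>i. prod_list (map (L i) ws)) \<longlonglongrightarrow> prod_list (map M ws)" for ws
    by (induction ws) (auto intro!: tendsto_intros assms)
  have "(\<lambda>i. sum_list (map (mono_val (L i)) ms)) \<longlonglongrightarrow> sum_list (map (mono_val M) ms)" for ms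
    by (induction ms) (auto simp: mono_val_def intro!: tendsto_intros 1)
  then show ?thesis by (simp add: poly_val_def)
qed

text \<open>Every number occurring in the code of a polynomial is bounded by the code itself, so a
  Lipschitz constant can be read off from the code alone.\<close>

lemma poly_val_lipschitz:
  fixes L M :: "nat \<Rightarrow> 'a::unital_cstar_algebra"
  assumes L: "\<And>l. norm (L l) \<le> real l" and LM: "\<And>l. norm (L l - M l) \<le> real l * \<delta>" and \<delta>: "0 \<le> \<delta>" "\<delta> \<le> 1"
  shows "norm (poly_val L q - poly_val M q) \<le> 2 ^ ((q + 2)\<^sup>2) * \<delta>"
proof (cases "q = 0")
  case False
  then have q1: "1 \<le> real q" by simp
  \<comment> \<open>Replacing one letter costs q, and 2 q bounds a letter of M because \<delta> <=
    1; together they give the factor 3 q per letter.\<close>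
  have w: "norm (prod_list (map L ws)) \<le> real q ^ length ws \<and>
     norm (prod_list (map L ws) - prod_list (map M ws)) \<le> (3 * real q) ^ length ws * \<delta>"
    if "\<forall>l\<in>set ws. l \<le> q" for ws
    using that
  proof (induction ws)
    case (Cons l ws)
    then have l: "real l \<le> real q" by simp
    have Ll: "norm (L l) \<le> real q" using L[of l] l by linarith
    have d: "norm (L l - M l) \<le> real q * \<delta>"
      using LM[of l] mult_right_mono[OF l \<delta>(1)] by linarith
    have Ml: "norm (M l) \<le> 2 * real q"
    proof -
      have "norm (M l) \<le> norm (L l) + norm (L l - M l)" using norm_triangle_ineq4[of "L l" "L l - M l"] by simp
      also have "real q * \<delta> \<le> real q" using \<delta> by (simp add: mult_left_le)
      then have "norm (L l) + norm (L l - M l) \<le> 2 * real q" using Ll d by linarith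
      finally show ?thesis .
    qed
    have IH: "norm (prod_list (map L ws)) \<le> real q ^ length ws"
      "norm (prod_list (map L ws) - prod_list (map M ws)) \<le> (3 * real q) ^ length ws * \<delta>"
      using Cons by auto
    have n1: "norm (L l * prod_list (map L ws)) \<le> real q * real q ^ length ws"
      by (intro order_trans[OF norm_mult_ineq] mult_mono Ll IH) auto
    have "norm (L l * prod_list (map L ws) - M l * prod_list (map M ws))
       = norm ((L l - M l) * prod_list (map L ws) + M l * (prod_list (map L ws) - prod_list (map M ws)))"
      by (simp add: algebra_simps)
    also have "\<dots> \<le> (real q * \<delta>) * real q ^ length ws + (2 * real q) * ((3 * real q) ^ length ws * \<delta>)"
      by (intro order_trans[OF norm_triangle_ineq] add_mono order_trans[OF norm_mult_ineq] mult_mono d IH Ml)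
        (use \<delta> in auto)
    also have "(real q * \<delta>) * real q ^ length ws \<le> (real q * \<delta>) * (3 * real q) ^ length ws"
      using \<delta> by (intro mult_left_mono power_mono) auto
    finally have "norm (L l * prod_list (map L ws) - M l * prod_list (map M ws)) \<le> (3 * real q) ^ Suc (length ws) * \<delta>"
      by (simp add: algebra_simps)
    with n1 show ?case by simp
  qed (simp add: \<delta>)
  have m: "norm (mono_val L m - mono_val M m) \<le> real q * ((3 * real q) ^ q * \<delta>)" if m: "m \<in> set (list_decode q)" for m
  proof -
    have mq: "m \<le> q" using m by (rule list_decode_elem_le)
    \<comment> \<open>A monomial is strictly smaller than the code of a list containing it; the
      strictness pays for the successor in \<open>word_of\<close>.\<close>
    have len: "length (word_of m) \<le> q"
    proof -
      have "length (word_of m) \<le> Suc (psnd m)" unfolding word_of_def by (rule length_list_decode_le)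
      also have "Suc (psnd m) \<le> Suc m" using psnd_le by simp
      also have "Suc m \<le> q"
      proof -
        have "m < list_encode xs" if "m \<in> set xs" for xs
          using that
        proof (induction xs)
          case (Cons y ys)
          have "y \<le> pair y (list_encode ys)" "list_encode ys \<le> pair y (list_encode ys)"
            by (rule le_prod_encode_1, rule le_prod_encode_2)
          with Cons show ?case by auto
        qed simp
        from this[OF m] show ?thesis by simp
      qed
      finally show ?thesis .
    qed
    have "\<forall>l\<in>set (word_of m). l \<le> q"
    proof
      fix l assume "l \<in> set (word_of m)"
      then have "l = pfst (psnd m) \<or> l \<in> set (list_decode (psnd (psnd m)))" by (simp add: word_of_eq)
      then have "l \<le> psnd m"
        using pfst_le[of "psnd m"] psnd_le[of "psnd m"] list_decode_elem_le[of l "psnd (psnd m)"] by linarith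
      then show "l \<le> q" using psnd_le[of m] mq by linarith
    qed
    from w[OF this] have "norm (prod_list (map L (word_of m)) - prod_list (map M (word_of m)))
       \<le> (3 * real q) ^ length (word_of m) * \<delta>" by blast
    also have "\<dots> \<le> (3 * real q) ^ q * \<delta>"
      using q1 \<delta> len by (intro mult_right_mono power_increasing) auto
    finally have 1: "norm (prod_list (map L (word_of m)) - prod_list (map M (word_of m))) \<le> (3 * real q) ^ q * \<delta>" .
    have "cmod (gval (pfst m)) \<le> real q"
      using cmod_gval_le[of "pfst m"] pfst_le[of m] mq by linarith
    then show ?thesis
      unfolding mono_val_def scaleC.diff_right[symmetric] norm_scaleC
      by (intro mult_mono 1) auto
  qed
  have "norm (sum_list (map (mono_val L) ms) - sum_list (map (mono_val M) ms)) \<le> real (length ms) * (real q * ((3 * real q) ^ q * \<delta>))"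
    if "set ms \<subseteq> set (list_decode q)" for ms
    using that
  proof (induction ms)
    case (Cons m' ms)
    have "norm (sum_list (map (mono_val L) (m' # ms)) - sum_list (map (mono_val M) (m' # ms)))
       = norm ((mono_val L m' - mono_val M m') + (sum_list (map (mono_val L) ms) - sum_list (map (mono_val M) ms)))"
      by (simp add: algebra_simps)
    also have "\<dots> \<le> real q * ((3 * real q) ^ q * \<delta>) + real (length ms) * (real q * ((3 * real q) ^ q * \<delta>))"
      using Cons by (intro order_trans[OF norm_triangle_ineq] add_mono m) auto
    finally show ?case by (simp add: algebra_simps)
  qed simp
  from this[OF order_refl] have "norm (poly_val L q - poly_val M q)
     \<le> real (length (list_decode q)) * (real q * ((3 * real q) ^ q * \<delta>))" by (simp add: poly_val_def)
  also have "\<dots> \<le> real q * (real q * ((3 * real q) ^ q * \<delta>))"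
    using \<delta> length_list_decode_le[of q] by (intro mult_right_mono) auto
  also have "\<dots> \<le> (3 * real q) * ((3 * real q) * ((3 * real q) ^ q * \<delta>))"
    using \<delta> by (intro mult_mono mult_left_mono) auto
  also have "\<dots> = (3 * real q) ^ (q + 2) * \<delta>" by (simp add: power_add power2_eq_square algebra_simps)
  \<comment> \<open>From 3 q <= 4 * 2^q. A power of 2 can be absorbed by adding its exponent to
    those of the tolerances.\<close>
  also have "\<dots> \<le> (2 ^ (q + 2)) ^ (q + 2) * \<delta>"
  proof (intro mult_right_mono power_mono)
    have "real q \<le> 2 ^ q" using less_exp[of q] by (metis less_imp_le of_nat_le_iff of_nat_numeral of_nat_power)
    then have "3 * real q \<le> 4 * 2 ^ q" by linarith
    then show "3 * real q \<le> 2 ^ (q + 2)" by (simp add: power_add)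
  qed (use \<delta> in auto)
  also have "\<dots> = 2 ^ ((q + 2)\<^sup>2) * \<delta>" by (simp only: power_mult[symmetric] power2_eq_square)
  finally show ?thesis .
qed (use \<delta> in simp)

lemma LIMSEQ_from_dense:
  fixes x :: "'a::real_normed_vector"
  assumes "\<And>\<epsilon>. \<epsilon> > 0 \<Longrightarrow> \<exists>q. norm (f q - x) < \<epsilon>"
  shows "\<exists>q. (\<lambda>i. f (q i)) \<longlonglongrightarrow> x"
proof -
  have "\<forall>i. \<exists>q. norm (f q - x) < (1/2) ^ i" using assms by simp
  then obtain q where q: "\<And>i. norm (f (q i) - x) < (1/2) ^ i" by metis
  have "(\<lambda>i. f (q i)) \<longlonglongrightarrow> x"
    by (rule LIMSEQ_half_power[where C = 1]) (use less_imp_le[OF q] in simp)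
  then show ?thesis by blast
qed

lemma closure_normI:
  fixes S :: "'a::real_normed_vector set"
  assumes "closure S = UNIV" "\<epsilon> > 0" shows "\<exists>y\<in>S. norm (y - x) < \<epsilon>"
  using assms closure_approachable[of x S] by (simp add: dist_norm)

lemma gval_LIMSEQ: "\<exists>q. (\<lambda>i. gval (q i)) \<longlonglongrightarrow> z"
  by (rule LIMSEQ_from_dense) (rule gval_dense)

text \<open>Density of the Gaussian rationals makes the closure of the rational points stable under
  all complex scalars. It is therefore a *-subalgebra, and it contains the special points.\<close>

lemma eval_point_dense:
  assumes "presentation s"
  shows "closure (range (eval_point s)) = UNIV"
proof -
  let ?C = "closure (range (eval_point s))"
  have seq: "x \<in> ?C \<longleftrightarrow> (\<exists>q. (\<lambda>i. eval_point s (q i)) \<longlonglongrightarrow> x)" for x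
  proof
    assume "x \<in> ?C"
    then show "\<exists>q. (\<lambda>i. eval_point s (q i)) \<longlonglongrightarrow> x"
      by (intro LIMSEQ_from_dense) (auto simp: closure_approachable dist_norm)
  next
    assume "\<exists>q. (\<lambda>i. eval_point s (q i)) \<longlonglongrightarrow> x"
    then obtain q where "(\<lambda>i. eval_point s (q i)) \<longlonglongrightarrow> x" ..
    then show "x \<in> ?C" unfolding closure_sequential by (intro exI[of _ "\<lambda>i. eval_point s (q i)"]) simp
  qed
  have "star_subalgebra ?C"
    unfolding star_subalgebra_def
  proof (intro conjI ballI allI)
    show "0 \<in> ?C" using rangeI[of "eval_point s" 0] by (simp add: closure_subset[THEN subsetD])
    fix x assume "x \<in> ?C"
    then obtain p where p: "(\<lambda>i. eval_point s (p i)) \<longlonglongrightarrow> x" by (auto simp: seq)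
    show "adj x \<in> ?C" unfolding seq
      by (rule exI[of _ "\<lambda>i. poly_adj (p i)"]) (auto intro!: tendsto_intros p)
    show "scaleC c x \<in> ?C" for c
    proof -
      obtain q where q: "(\<lambda>i. gval (q i)) \<longlonglongrightarrow> c" using gval_LIMSEQ by blast
      show ?thesis unfolding seq
        by (rule exI[of _ "\<lambda>i. poly_scale (q i) (p i)"]) (auto intro!: tendsto_intros p q)
    qed
    fix y assume "y \<in> ?C"
    then obtain r where r: "(\<lambda>i. eval_point s (r i)) \<longlonglongrightarrow> y" by (auto simp: seq)
    show "x + y \<in> ?C" unfolding seq
      by (rule exI[of _ "\<lambda>i. poly_add (p i) (r i)"]) (auto intro!: tendsto_intros p r)
    show "x * y \<in> ?C" unfolding seq
      by (rule exI[of _ "\<lambda>i. poly_mult (p i) (r i)"]) (auto intro!: tendsto_intros p r)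
  qed
  moreover have "range s \<subseteq> ?C"
  proof
    fix x assume "x \<in> range s"
    then obtain i where x: "x = s i" by blast
    have "eval_point s (list_encode [monomial_code gauss_one [2 * i]]) = s i"
      unfolding eval_point_poly_val poly_val_def list_encode_inverse
      by (simp add: mono_val_monomial_code letter_point_eq)
    then have "s i \<in> range (eval_point s)" by (metis rangeI)
    then show "x \<in> ?C" unfolding x by (rule closure_subset[THEN subsetD])
  qed
  ultimately have "star_subalgebra hull (range s) \<subseteq> ?C" by (intro hull_minimal)
  then have "closure (star_subalgebra hull (range s)) \<subseteq> ?C" by (intro closure_minimal) auto
  with assms show ?thesis by (auto simp: presentation_def)
qed

section \<open>Approximate matrix units as search states\<close>

text \<open>A state codes a precision \<open>p\<close> and codes of approximations \<open>v\<^sub>a\<close> of the first column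
  \<open>e a 0\<close> of a system of matrix units, so that \<open>v\<^sub>a v\<^sub>b*\<close> approximates \<open>e a b\<close>. The precision
  is itself a code: of the dimension, of a polynomial in the matrix units that witnesses density,
  and of a padding that makes \<open>p\<close> large. So \<open>p\<close> bounds the first two, and all tolerances
  can be functions of \<open>p\<close>.\<close>

definition state_prec :: "nat \<Rightarrow> nat" where "state_prec x = pfst x"
definition state_dim :: "nat \<Rightarrow> nat" where "state_dim x = pfst (pfst x)"
definition state_poly :: "nat \<Rightarrow> nat" where "state_poly x = pfst (psnd (pfst x))"
definition state_vec :: "nat \<Rightarrow> nat \<Rightarrow> nat" where "state_vec x a = list_code_nth (psnd x) a"

text \<open>As products of a column with its adjoint, the approximate units satisfy adj (e a b) = e
  b a exactly, so no adjoint relation has to be tested.\<close>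

definition unit_code :: "nat \<Rightarrow> nat \<Rightarrow> nat \<Rightarrow> nat" where
  "unit_code x a b = poly_mult (state_vec x a) (poly_adj (state_vec x b))"

definition diag_code :: "nat \<Rightarrow> nat \<Rightarrow> nat \<Rightarrow> nat \<Rightarrow> nat" where
  "diag_code x N a b =
     rec_nat 0 (\<lambda>l r. poly_add r (unit_code x (a + l * N) (b + l * N))) (state_dim x div N)"

text \<open>A variable of the standard presentation codes a coefficient and two indices modulo N.
  Replacing it by that multiple of an approximate unit turns a polynomial over matrices into a
  polynomial over s.\<close>

definition subst_code :: "nat \<Rightarrow> nat \<Rightarrow> nat \<Rightarrow> nat" where
  "subst_code x N q = poly_subst
     (\<lambda>i. poly_scale (pfst i) (diag_code x N (pfst (psnd i) mod N) (psnd (psnd i) mod N))) q"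

definition poly_diff :: "nat \<Rightarrow> nat \<Rightarrow> nat" where
  "poly_diff p q = poly_add p (poly_scale gauss_minus_one q)"

definition rat_small :: "nat \<Rightarrow> nat \<Rightarrow> bool" where
  "rat_small r m \<longleftrightarrow> code_pos (pfst r) * 2 ^ Suc m < code_neg (pfst r) * 2 ^ Suc m + Suc (psnd r)"

lemma rat_small_iff: "rat_small r m \<longleftrightarrow> rval r < (1/2) ^ Suc m"
proof -
  have "rval r < (1/2) ^ Suc m \<longleftrightarrow>
      (real (code_pos (pfst r)) - real (code_neg (pfst r))) * 2 ^ Suc m < real (Suc (psnd r))"
    unfolding rval_eq by (simp add: field_simps power_divide)
  also have "\<dots> \<longleftrightarrow> real (code_pos (pfst r) * 2 ^ Suc m) < real (code_neg (pfst r) * 2 ^ Suc m + Suc (psnd r))"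
    unfolding of_nat_add of_nat_mult of_nat_power by (simp add: left_diff_distrib algebra_simps)
  also have "\<dots> \<longleftrightarrow> rat_small r m" unfolding rat_small_def of_nat_less_iff ..
  finally show ?thesis ..
qed

text \<open>The tolerances absorb a factor \<open>2^p\<close> for the number of diagonal blocks and a factor
  \<open>2^((p + 2)\<^sup>2)\<close> for the Lipschitz constant of a polynomial with code at most \<open>p\<close>.\<close>

definition close_exp :: "nat \<Rightarrow> nat" where "close_exp p = (p + 2) ^ 2 + 2 * p + 4"
definition units_exp :: "nat \<Rightarrow> nat" where "units_exp p = close_exp p + 4"
definition defect_exp :: "nat \<Rightarrow> nat" where "defect_exp p = units_exp p + 4 * p + 7"

lemma computable_unit_code [computable_intros]:
  "computable f \<Longrightarrow> computable g \<Longrightarrow> computable h \<Longrightarrow> computable (\<lambda>z. unit_code (f z) (g z) (h z))"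
  unfolding unit_code_def state_vec_def by (intro computable_intros)

lemma computable_state [computable_intros]:
  assumes "computable f"
  shows "computable (\<lambda>z. state_prec (f z))" "computable (\<lambda>z. state_dim (f z))" "computable (\<lambda>z. state_poly (f z))"
  unfolding state_prec_def state_dim_def state_poly_def by (intro computable_intros assms)+

lemma computable_diag_code [computable_intros]:
  assumes "computable x" "computable N" "computable a" "computable b"
  shows "computable (\<lambda>z. diag_code (x z) (N z) (a z) (b z))"
  unfolding diag_code_def
  by (intro computable_rec_nat[where g = "\<lambda>l r z. poly_add r (unit_code (x z) (a z + l * N z) (b z + l * N z))"]
      computable_intros assms computable_compose[OF assms(1)] computable_compose[OF assms(2)]
      computable_compose[OF assms(3)] computable_compose[OF assms(4)])

lemma computable_subst_code [computable_intros]: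
  assumes "computable x" "computable N" "computable q"
  shows "computable (\<lambda>z. subst_code (x z) (N z) (q z))"
  unfolding subst_code_def
  by (rule computable_poly_subst[where D = "\<lambda>i z. poly_scale (pfst i)
        (diag_code (x z) (N z) (pfst (psnd i) mod N z) (psnd (psnd i) mod N z))"])
    (intro computable_intros assms computable_compose[OF assms(1)] computable_compose[OF assms(2)])+

lemma computable_poly_diff [computable_intros]:
  "computable f \<Longrightarrow> computable g \<Longrightarrow> computable (\<lambda>z. poly_diff (f z) (g z))"
  unfolding poly_diff_def by (intro computable_intros)

lemma decidable_rat_small [computable_intros]:
  "computable f \<Longrightarrow> computable g \<Longrightarrow> decidable (\<lambda>z. rat_small (f z) (g z))"
  unfolding rat_small_def by (intro computable_intros)

lemma computable_exps [computable_intros]: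
  assumes "computable f"
  shows "computable (\<lambda>z. close_exp (f z))" "computable (\<lambda>z. units_exp (f z))" "computable (\<lambda>z. defect_exp (f z))"
  unfolding defect_exp_def units_exp_def close_exp_def by (intro computable_intros assms)+

text \<open>The letters of a *-polynomial over the standard special points of the matrix algebra,
  evaluated at a system \<open>e\<close>.\<close>

definition unit_letter :: "nat \<Rightarrow> (nat \<Rightarrow> nat \<Rightarrow> 'a::unital_cstar_algebra) \<Rightarrow> nat \<Rightarrow> 'a" where
  "unit_letter N e l =
     (let i = l div 2; z = scaleC (gval (pfst i)) (e (pfst (psnd i) mod N) (psnd (psnd i) mod N))
      in if l mod 2 = 0 then z else adj z)"

lemma eval_point_unit_code:
  "eval_point s (unit_code x a b) = eval_point s (state_vec x a) * adj (eval_point s (state_vec x b))"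
  by (simp add: unit_code_def)

lemma eval_point_diag_code:
  "eval_point s (diag_code x N a b) = diag_sum (state_dim x div N) N (\<lambda>a b. eval_point s (unit_code x a b)) a b"
proof -
  have "eval_point s (rec_nat 0 (\<lambda>l r. poly_add r (unit_code x (a + l * N) (b + l * N))) d)
     = diag_sum d N (\<lambda>a b. eval_point s (unit_code x a b)) a b" for d
    by (induction d) (simp_all add: diag_sum_def)
  then show ?thesis by (simp add: diag_code_def)
qed

lemma eval_point_subst_code:
  "eval_point s (subst_code x N q) = poly_val (unit_letter N (\<lambda>a b. eval_point s (diag_code x N a b))) q"
proof -
  have "(\<lambda>l. eval_point s (poly_subst_letter (\<lambda>i. poly_scale (pfst i)
       (diag_code x N (pfst (psnd i) mod N) (psnd (psnd i) mod N))) l))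
     = unit_letter N (\<lambda>a b. eval_point s (diag_code x N a b))"
    by (rule ext) (simp add: eval_point_poly_subst_letter unit_letter_def Let_def)
  then show ?thesis by (simp add: subst_code_def eval_point_poly_subst)
qed

lemma eval_point_poly_diff [simp]: "eval_point s (poly_diff p q) = eval_point s p - eval_point s q"
  by (simp add: poly_diff_def scaleC.minus_left)

lemma tendsto_unit_letter:
  assumes "N > 0" "\<And>a b. a < N \<Longrightarrow> b < N \<Longrightarrow> (\<lambda>i. e i a b) \<longlonglongrightarrow> f a b"
  shows "(\<lambda>i. unit_letter N (e i) l) \<longlonglongrightarrow> unit_letter N f l"
  unfolding unit_letter_def Let_def using assms by (auto intro!: tendsto_intros)

lemma tendsto_diag_sum:
  assumes "\<And>a b. a < d * N \<Longrightarrow> b < d * N \<Longrightarrow> (\<lambda>i. e i a b) \<longlonglongrightarrow> (f a b :: 'a::real_normed_vector)" "a < N" "b < N"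
  shows "(\<lambda>i. diag_sum d N (e i) a b) \<longlonglongrightarrow> diag_sum d N f a b"
  unfolding diag_sum_def using assms by (intro tendsto_sum) (auto simp: add_mult_less)

text \<open>A is the algorithm for norms. Polynomials have no constant term, so 1 need not be a
  rational point; u takes its place.\<close>

locale normed_presentation =
  fixes s :: "nat \<Rightarrow> 'a::unital_cstar_algebra" and A :: "nat \<Rightarrow> nat \<Rightarrow> nat" and u :: nat
  assumes pres: "presentation s"
    and computable_A: "computable (\<lambda>z. A (pfst z) (psnd z))"
    and A: "\<bar>norm (eval_point s q) - rval (A q k)\<bar> < (1/2) ^ k"
    and u: "norm (eval_point s u - 1) < (1/2) ^ 4"
begin

abbreviation ev :: "nat \<Rightarrow> 'a" where "ev \<equiv> eval_point s"

text \<open>A decidable test that accepts norms below \<open>(1/2)^(m+2)\<close> and rejects norms of at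
  least \<open>(1/2)^m\<close>.\<close>

definition norm_small :: "nat \<Rightarrow> nat \<Rightarrow> bool" where
  "norm_small q m \<longleftrightarrow> rat_small (A q (m + 2)) m"

lemma norm_smallD: "norm_small q m \<Longrightarrow> norm (ev q) < (1/2) ^ m"
  using A[of q "m + 2"] unfolding norm_small_def rat_small_iff abs_less_iff by (simp add: field_simps)

lemma norm_smallI: "norm (ev q) < (1/2) ^ (m + 2) \<Longrightarrow> norm_small q m"
  using A[of q "m + 2"] unfolding norm_small_def rat_small_iff abs_less_iff by (simp add: field_simps)

lemma decidable_norm_small [computable_intros]:
  "computable f \<Longrightarrow> computable g \<Longrightarrow> decidable (\<lambda>z. norm_small (f z) (g z))"
  unfolding norm_small_def by (intro computable_intros computable_compose2[of A, OF computable_A])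

text \<open>A diagonal sum with blocks of size 1 is the sum of all diagonal units. It is compared
  with u, and 1/4 + 1/16 stays below the 1/2 of \<open>almost_units\<close>.\<close>

definition good :: "nat \<Rightarrow> bool" where
  "good x \<longleftrightarrow> 0 < state_dim x \<and>
     (\<forall>a<state_dim x. \<forall>b<state_dim x. \<forall>c<state_dim x. \<forall>d<state_dim x.
        norm_small (poly_diff (if b = c then unit_code x a d else 0) (poly_mult (unit_code x a b) (unit_code x c d)))
          (defect_exp (state_prec x))) \<and>
     norm_small (poly_diff (diag_code x 1 0 0) u) 2"

text \<open>The \<open>k\<close>-th step captures the rational point with code \<open>pfst k\<close>, hence each rational point
  infinitely often, with errors tending to 0.\<close>

definition step :: "nat \<Rightarrow> nat \<Rightarrow> nat \<Rightarrow> bool" where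
  "step k x y \<longleftrightarrow> state_prec x < state_prec y \<and> state_dim y mod state_dim x = 0 \<and>
     (\<forall>a<state_dim x. \<forall>b<state_dim x.
        norm_small (poly_diff (diag_code y (state_dim x) a b) (unit_code x a b)) (close_exp (state_prec x))) \<and>
     norm_small (poly_diff (pfst k) (subst_code y (state_dim y) (state_poly y))) k"

lemma decidable_good [computable_intros]: "computable f \<Longrightarrow> decidable (\<lambda>z. good (f z))"
proof -
  have "decidable good" unfolding good_def by (intro computable_intros)
  then show "computable f \<Longrightarrow> decidable (\<lambda>z. good (f z))" unfolding decidable_def by (rule computable_compose)
qed

lemma decidable_step: "decidable (\<lambda>z. step (pfst (psnd z)) (psnd (psnd z)) (pfst z))"
  unfolding step_def by (intro computable_intros)

abbreviation unit_val :: "nat \<Rightarrow> nat \<Rightarrow> nat \<Rightarrow> 'a" where "unit_val x a b \<equiv> ev (unit_code x a b)"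

lemma unit_val_adj: "adj (unit_val x a b) = unit_val x b a"
  by (simp add: eval_point_unit_code adj_mult adj_adj)

lemma state_dim_le: "state_dim x \<le> state_prec x"
  by (simp add: state_dim_def state_prec_def pfst_le)

lemma real_le_two_power:
  assumes "n \<le> m" shows "real n \<le> 2 ^ m"
proof -
  have "n \<le> 2 ^ m" using assms less_exp[of m] by linarith
  then have "real n \<le> real (2 ^ m)" by (simp only: of_nat_le_iff)
  then show ?thesis by simp
qed

lemma good_defect:
  assumes "good x" "a < state_dim x" "b < state_dim x" "c < state_dim x" "d < state_dim x"
  shows "norm (unit_defect (unit_val x) a b c d) < (1/2) ^ defect_exp (state_prec x)"
proof -
  have "norm_small (poly_diff (if b = c then unit_code x a d else 0) (poly_mult (unit_code x a b) (unit_code x c d)))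
          (defect_exp (state_prec x))" using assms by (simp add: good_def)
  from norm_smallD[OF this] show ?thesis by (auto simp: unit_defect_def split: if_splits)
qed

lemma good_trace: "good x \<Longrightarrow> norm ((\<Sum>a<state_dim x. unit_val x a a) - 1) < 1/2"
proof -
  assume "good x"
  then have "norm_small (poly_diff (diag_code x 1 0 0) u) 2" by (simp add: good_def)
  from norm_smallD[OF this] have "norm ((\<Sum>a<state_dim x. unit_val x a a) - ev u) < 1/4"
    by (simp add: eval_point_diag_code diag_sum_def power2_eq_square)
  moreover have "norm (ev u - 1) < 1/16" using u by (simp add: power_numeral_reduce)
  ultimately show ?thesis
    using norm_triangle_ineq[of "(\<Sum>a<state_dim x. unit_val x a a) - ev u" "ev u - 1"] by simp
qed

text \<open>The origin of \<open>defect_exp\<close>: N <= p gives 128 N^4 <= 2^(4 p + 7), which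
  covers both the smallness condition of the Newton iteration and the distance 14 N^2
  \<epsilon>.\<close>

lemma almost_units_near:
  assumes N: "0 < N" "N \<le> p" and au: "almost_units N ((1/2) ^ defect_exp p) e"
    and B: "closed B" "\<And>x y. x \<in> B \<Longrightarrow> y \<in> B \<Longrightarrow> x + y \<in> B \<and> x - y \<in> B \<and> x * y \<in> B"
      "\<And>x r. x \<in> B \<Longrightarrow> scaleR r x \<in> B"
    and eB: "\<And>a b. a < N \<Longrightarrow> b < N \<Longrightarrow> e a b \<in> B"
  shows "\<exists>f. matrix_units N f \<and> (\<forall>a<N. \<forall>b<N. f a b \<in> B \<and> norm (f a b - e a b) \<le> (1/2) ^ units_exp p)"
proof -
  have Np: "real N \<le> 2 ^ p" using N(2) by (rule real_le_two_power)
  have "(1/2) ^ defect_exp p * (128 * real N ^ 4) \<le> (1/2) ^ defect_exp p * (2 ^ 7 * (2 ^ p) ^ 4)"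
    using Np by (intro mult_left_mono mult_mono power_mono) auto
  also have "\<dots> = (1/2) ^ units_exp p"
    by (simp add: defect_exp_def power_add power_mult[symmetric] power_divide mult.commute)
  also have "\<dots> \<le> 1" by (simp add: power_le_one)
  finally have 1: "(1/2) ^ defect_exp p * (128 * real N ^ 4) \<le> 1" .
  have "14 * real N ^ 2 * (1/2) ^ defect_exp p \<le> 2 ^ 7 * (2 ^ p) ^ 4 * (1/2) ^ defect_exp p"
  proof (intro mult_right_mono mult_mono)
    have "real N ^ 2 \<le> (2 ^ p) ^ 2" using Np by (intro power_mono) auto
    also have "\<dots> \<le> (2 ^ p) ^ 4" by (intro power_increasing) auto
    finally show "real N ^ 2 \<le> (2 ^ p) ^ 4" .
  qed auto
  also have "\<dots> = (1/2) ^ units_exp p"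
    by (simp add: defect_exp_def power_add power_mult[symmetric] power_divide mult.commute)
  finally have 2: "14 * real N ^ 2 * (1/2) ^ defect_exp p \<le> (1/2) ^ units_exp p" .
  obtain f where f: "matrix_units N f"
    "\<forall>a<N. \<forall>b<N. f a b \<in> B \<and> norm (f a b - e a b) \<le> 14 * real N ^ 2 * (1/2) ^ defect_exp p"
    using almost_units_stable[OF au N(1) 1 _ B eB] by auto
  from f(2) order_trans[OF _ 2] f(1) show ?thesis by blast
qed

lemma good_near_units:
  assumes "good x"
  shows "\<exists>f. matrix_units (state_dim x) f \<and>
    (\<forall>a<state_dim x. \<forall>b<state_dim x. norm (f a b - unit_val x a b) \<le> (1/2) ^ units_exp (state_prec x))"
proof -
  have "almost_units (state_dim x) ((1/2) ^ defect_exp (state_prec x)) (unit_val x)"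
    unfolding almost_units_def
    using good_defect[OF assms] good_trace[OF assms] by (auto simp: unit_val_adj intro: less_imp_le)
  moreover have "0 < state_dim x" using assms by (simp add: good_def)
  ultimately show ?thesis
    using almost_units_near[of "state_dim x" "state_prec x" "unit_val x" UNIV] state_dim_le by simp
qed

lemma ev_LIMSEQ: "\<exists>q. (\<lambda>i. ev (q i)) \<longlonglongrightarrow> x"
proof (rule LIMSEQ_from_dense)
  show "\<exists>q. norm (ev q - x) < \<epsilon>" if "\<epsilon> > 0" for \<epsilon>
    using closure_normI[OF eval_point_dense[OF pres] that, of x] by auto
qed

text \<open>Rational points converge to the first column of e, and products of column entries
  recover all units. Each test in \<open>good\<close> concerns a norm whose limit is strictly below
  the level at which acceptance is guaranteed, so all tests succeed from some i on.\<close>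

lemma states_near_units:
  assumes mu: "matrix_units N e"
  shows "\<exists>y. (\<forall>i. state_dim (y i) = N \<and> state_poly (y i) = C \<and> P < state_prec (y i)) \<and>
    (\<forall>a<N. \<forall>b<N. (\<lambda>i. unit_val (y i) a b) \<longlonglongrightarrow> e a b) \<and> (\<forall>\<^sub>F i in sequentially. good (y i))"
proof -
  have pos: "0 < N" using mu by (rule matrix_units_pos)
  have "\<forall>a. \<exists>q. (\<lambda>i. ev (q i)) \<longlonglongrightarrow> e a 0" using ev_LIMSEQ by blast
  from choice[OF this] obtain q where q: "\<And>a. (\<lambda>i. ev (q a i)) \<longlonglongrightarrow> e a 0" by blast
  \<comment> \<open>A pair is at least as large as its components, so the padding
    \<open>Suc P\<close> lifts the precision above P.\<close>
  define p where "p = pair N (pair C (Suc P))"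
  define y where "y i = pair p (list_encode (map (\<lambda>a. q a i) [0..<N]))" for i
  have p: "P < p" unfolding p_def
    using le_prod_encode_2[of "pair C (Suc P)" N] le_prod_encode_2[of "Suc P" C] by linarith
  have y: "state_dim (y i) = N" "state_poly (y i) = C" "state_prec (y i) = p" for i
    by (simp_all add: y_def p_def state_dim_def state_poly_def state_prec_def)
  have v: "state_vec (y i) a = q a i" if "a < N" for i a
    using that by (simp add: y_def state_vec_def list_code_nth)
  have U: "(\<lambda>i. unit_val (y i) a b) \<longlonglongrightarrow> e a b" if "a < N" "b < N" for a b
  proof -
    have "(\<lambda>i. unit_val (y i) a b) \<longlonglongrightarrow> e a 0 * adj (e b 0)"
      unfolding eval_point_unit_code using that by (simp add: v) (intro tendsto_intros q)
    also have "e a 0 * adj (e b 0) = e a b" using that pos by (simp add: unit_adj[OF mu] unit_mult[OF mu])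
    finally show ?thesis .
  qed
  have "\<forall>\<^sub>F i in sequentially. norm_small (poly_diff (if b = c then unit_code (y i) a d else 0)
      (poly_mult (unit_code (y i) a b) (unit_code (y i) c d))) (defect_exp p)"
    if "a < N" "b < N" "c < N" "d < N" for a b c d
  proof -
    have "(\<lambda>i. norm ((if b = c then unit_val (y i) a d else 0) - unit_val (y i) a b * unit_val (y i) c d))
       \<longlonglongrightarrow> norm ((if b = c then e a d else 0) - e a b * e c d)"
      using that by (cases "b = c") (auto intro!: tendsto_intros U)
    also have "norm ((if b = c then e a d else 0) - e a b * e c d) = 0" using that by (simp add: unit_mult[OF mu])
    finally have "\<forall>\<^sub>F i in sequentially. norm ((if b = c then unit_val (y i) a d else 0) - unit_val (y i) a b * unit_val (y i) c d)
       < (1/2) ^ (defect_exp p + 2)" by (rule order_tendstoD) simp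
    then show ?thesis by eventually_elim (rule norm_smallI, simp split: if_splits)
  qed
  then have 1: "\<forall>\<^sub>F i in sequentially. \<forall>a\<in>{..<N}. \<forall>b\<in>{..<N}. \<forall>c\<in>{..<N}. \<forall>d\<in>{..<N}.
      norm_small (poly_diff (if b = c then unit_code (y i) a d else 0)
      (poly_mult (unit_code (y i) a b) (unit_code (y i) c d))) (defect_exp p)"
    by (intro eventually_ball_finite ballI finite_lessThan) auto
  have 2: "\<forall>\<^sub>F i in sequentially. norm_small (poly_diff (diag_code (y i) 1 0 0) u) 2"
  proof -
    have "(\<lambda>i. norm (ev (diag_code (y i) 1 0 0) - ev u)) \<longlonglongrightarrow> norm (diag_sum N 1 e 0 0 - ev u)"
      unfolding eval_point_diag_code y div_by_1 by (intro tendsto_intros tendsto_diag_sum U) auto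
    also have "diag_sum N 1 e 0 0 = 1" by (simp add: diag_sum_def unit_sum[OF mu])
    finally have l: "(\<lambda>i. norm (ev (diag_code (y i) 1 0 0) - ev u)) \<longlonglongrightarrow> norm (1 - ev u)" .
    \<comment> \<open>The reason for asking u to be within 2^-4 of 1: at exponent 2, acceptance is
      guaranteed only below 2^-(2 + 2).\<close>
    have "norm (1 - ev u) < (1/2) ^ (2 + 2)" using u by (simp add: norm_minus_commute)
    then have "\<forall>\<^sub>F i in sequentially. norm (ev (diag_code (y i) 1 0 0) - ev u) < (1/2) ^ (2 + 2)"
      by (rule order_tendstoD(2)[OF l])
    then show ?thesis by eventually_elim (rule norm_smallI, simp)
  qed
  have "\<forall>\<^sub>F i in sequentially. good (y i)"
    using 1 2 by eventually_elim (simp add: good_def y pos)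
  with y U p show ?thesis by (intro exI[of _ y]) simp
qed

end

section \<open>Existence of a successor state\<close>

definition span_code :: "nat \<Rightarrow> (nat \<Rightarrow> nat \<Rightarrow> nat) \<Rightarrow> nat" where
  "span_code N c = list_encode (concat (map (\<lambda>a. map (\<lambda>b.
     monomial_code gauss_one [2 * pair (c a b) (pair a b)]) [0..<N]) [0..<N]))"

text \<open>The letter \<open>2 * pair (c a b) (pair a b)\<close> is the special point, without
  adjoint, with coefficient code \<open>c a b\<close> and indices a, b. Combinations of units with
  Gaussian rational coefficients are therefore values of polynomials.\<close>

lemma poly_val_span_code:
  "poly_val (unit_letter N E) (span_code N c) = mat_sum N (\<lambda>a b. gval (c a b)) E"
proof -
  have cc: "sum_list (map f (concat (map g xs))) = sum_list (map (\<lambda>a. sum_list (map f (g a))) xs)"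
    for f :: "nat \<Rightarrow> 'a" and g :: "nat \<Rightarrow> nat list" and xs
    by (induction xs) simp_all
  have "mono_val (unit_letter N E) (monomial_code gauss_one [2 * pair (c a b) (pair a b)])
      = scaleC (gval (c a b)) (E (a mod N) (b mod N))" for a b
    by (simp add: mono_val_monomial_code unit_letter_def Let_def)
  then have "poly_val (unit_letter N E) (span_code N c)
     = (\<Sum>a\<in>{0..<N}. \<Sum>b\<in>{0..<N}. scaleC (gval (c a b)) (E (a mod N) (b mod N)))"
    by (simp add: poly_val_def span_code_def cc comp_def interv_sum_list_conv_sum_set_nat)
  also have "\<dots> = mat_sum N (\<lambda>a b. gval (c a b)) E"
    unfolding mat_sum_def lessThan_atLeast0 by (intro sum.cong refl) simp
  finally show ?thesis .
qed

lemma unit_span_rational: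
  assumes "t \<in> unit_span N E" "\<epsilon> > 0"
  shows "\<exists>C. norm (poly_val (unit_letter N E) C - t) < \<epsilon>"
proof -
  obtain c where t: "t = mat_sum N c E" using assms(1) by (auto simp: unit_span_def)
  have "\<forall>a. \<forall>b. \<exists>q. (\<lambda>i. gval (q i)) \<longlonglongrightarrow> c a b" using gval_LIMSEQ by blast
  then have "\<exists>q. \<forall>a b. (\<lambda>i. gval (q a b i)) \<longlonglongrightarrow> c a b" unfolding choice_iff .
  then obtain q where q: "\<And>a b. (\<lambda>i. gval (q a b i)) \<longlonglongrightarrow> c a b" by blast
  have "(\<lambda>i. norm (mat_sum N (\<lambda>a b. gval (q a b i)) E - t)) \<longlonglongrightarrow> norm (t - t)"
    unfolding t unfolding mat_sum_def by (intro tendsto_intros q)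
  then have "\<forall>\<^sub>F i in sequentially. norm (mat_sum N (\<lambda>a b. gval (q a b i)) E - t) < \<epsilon>"
    by (rule order_tendstoD) (use assms(2) in simp)
  then obtain i where "norm (mat_sum N (\<lambda>a b. gval (q a b i)) E - t) < \<epsilon>"
    using eventually_happens' sequentially_bot by blast
  then show ?thesis by (intro exI[of _ "span_code N (\<lambda>a b. q a b i)"]) (simp add: poly_val_span_code)
qed

text \<open>Explains the 4 in \<open>units_exp\<close>: two errors of size 2^-(n + 4) add up to less
  than 2^-(n + 2), below which \<open>norm_small\<close> accepts at exponent n.\<close>

lemma half_power_double: "(1/2::real) ^ (n + 4) + (1/2) ^ (n + 4) \<le> (1/2) ^ (n + 2)"
proof -
  have "(1/2::real) ^ (n + 4) = (1/2) ^ n / 16" "(1/2::real) ^ (n + 2) = (1/2) ^ n / 4"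
    by (simp_all add: power_add power_numeral_reduce)
  moreover have "(0::real) \<le> (1/2) ^ n" by simp
  ultimately show ?thesis by linarith
qed

text \<open>Because the chain increases, one member accommodates approximations of finitely many
  elements.\<close>

lemma directed_union_approx:
  fixes B :: "nat \<Rightarrow> 'a::real_normed_vector set"
  assumes mono: "\<And>j. B j \<subseteq> B (Suc j)" and dense: "closure (\<Union>j. B j) = UNIV"
    and "finite S" "\<epsilon> > 0"
  shows "\<exists>j. \<forall>a\<in>S. \<exists>z\<in>B j. norm (z - v a) < \<epsilon>"
  using \<open>finite S\<close>
proof induction
  case (insert x S)
  then obtain j where j: "\<forall>a\<in>S. \<exists>z\<in>B j. norm (z - v a) < \<epsilon>" by blast
  obtain z i where z: "z \<in> B i" "norm (z - v x) < \<epsilon>"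
    using closure_normI[OF dense \<open>\<epsilon> > 0\<close>, of "v x"] by blast
  have le: "B i \<subseteq> B (max i j)" "B j \<subseteq> B (max i j)" using lift_Suc_mono_le[of B, OF mono] by auto
  have "\<forall>a\<in>insert x S. \<exists>z\<in>B (max i j). norm (z - v a) < \<epsilon>"
  proof
    fix a assume "a \<in> insert x S"
    then show "\<exists>z\<in>B (max i j). norm (z - v a) < \<epsilon>"
    proof
      assume "a = x" then show ?thesis using z le by blast
    next
      assume "a \<in> S" then show ?thesis using j le by blast
    qed
  qed
  then show ?case by blast
qed simp

context normed_presentation
begin

text \<open>The chain only proves existence and need not be computable. One member of it has to
  serve two purposes: to contain an exact system close to x, and an element close to the rational
  point \<open>pfst k\<close>. Any refinement spanning that whole member then captures the rational
  point too.\<close>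

lemma next_state_exists:
  fixes e :: "nat \<Rightarrow> nat \<Rightarrow> nat \<Rightarrow> 'a"
  assumes mu: "\<And>j. matrix_units (n j) (e j)"
    and mono: "\<And>j. unit_span (n j) (e j) \<subseteq> unit_span (n (Suc j)) (e (Suc j))"
    and dense: "closure (\<Union>j. unit_span (n j) (e j)) = UNIV"
    and x: "good x"
  shows "\<exists>y. good y \<and> step k x y"
proof -
  define N where "N = state_dim x"
  define p where "p = state_prec x"
  define B where "B j = unit_span (n j) (e j)" for j
  have N: "0 < N" "N \<le> p" using x state_dim_le by (auto simp: good_def N_def p_def)
  \<comment> \<open>Index N holds the rational point to be captured, so that it is approximated in
    the same algebra as the column of x.\<close>
  define V where "V a = (if a < N then ev (state_vec x a) else ev (pfst k))" for a
  have "\<forall>m. \<exists>j. \<forall>a\<in>{..N}. \<exists>z\<in>B j. norm (z - V a) < (1/2) ^ m"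
    unfolding B_def by (intro allI directed_union_approx mono dense) auto
  from choice[OF this] obtain J where J: "\<And>m a. a \<le> N \<Longrightarrow> \<exists>z\<in>B (J m). norm (z - V a) < (1/2) ^ m" by auto
  define w where "w m a = (SOME z. z \<in> B (J m) \<and> norm (z - V a) < (1/2) ^ m)" for m a
  have w: "w m a \<in> B (J m)" "norm (w m a - V a) < (1/2) ^ m" if "a \<le> N" for m a
  proof -
    have "\<exists>z. z \<in> B (J m) \<and> norm (z - V a) < (1/2) ^ m" using J[OF that] by blast
    from someI_ex[OF this] show "w m a \<in> B (J m)" "norm (w m a - V a) < (1/2) ^ m"
      unfolding w_def by simp_all
  qed
  have lim: "(\<lambda>m. w m a) \<longlonglongrightarrow> V a" if "a \<le> N" for a
    by (rule LIMSEQ_half_power[where C = 1]) (use less_imp_le[OF w(2)[OF that]] in simp)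
  \<comment> \<open>Built from the approximated column, T satisfies the adjoint relations exactly,
    as \<open>almost_units\<close> demands.\<close>
  define T where "T m a b = w m a * adj (w m b)" for m a b
  have T: "(\<lambda>m. T m a b) \<longlonglongrightarrow> unit_val x a b" if "a < N" "b < N" for a b
  proof -
    have "(\<lambda>m. T m a b) \<longlonglongrightarrow> V a * adj (V b)" unfolding T_def using that by (intro tendsto_intros lim) auto
    then show ?thesis using that by (simp add: V_def eval_point_unit_code)
  qed
  \<comment> \<open>The bounds known for x are strict, which leaves room to replace its column by
    nearby elements of the chain.\<close>
  have "\<forall>\<^sub>F m in sequentially. norm (unit_defect (T m) a b c d) < (1/2) ^ defect_exp p"
    if "a < N" "b < N" "c < N" "d < N" for a b c d
  proof (rule order_tendstoD)
    show "(\<lambda>m. norm (unit_defect (T m) a b c d)) \<longlonglongrightarrow> norm (unit_defect (unit_val x) a b c d)"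
      unfolding unit_defect_def using that by (cases "b = c") (auto intro!: tendsto_intros T)
    show "norm (unit_defect (unit_val x) a b c d) < (1/2) ^ defect_exp p"
      using good_defect[OF x] that by (simp add: N_def p_def)
  qed
  then have 1: "\<forall>\<^sub>F m in sequentially. \<forall>a\<in>{..<N}. \<forall>b\<in>{..<N}. \<forall>c\<in>{..<N}. \<forall>d\<in>{..<N}.
      norm (unit_defect (T m) a b c d) < (1/2) ^ defect_exp p"
    by (intro eventually_ball_finite ballI finite_lessThan) auto
  have 2: "\<forall>\<^sub>F m in sequentially. norm ((\<Sum>a<N. T m a a) - 1) < 1/2"
  proof (rule order_tendstoD)
    show "(\<lambda>m. norm ((\<Sum>a<N. T m a a) - 1)) \<longlonglongrightarrow> norm ((\<Sum>a<N. unit_val x a a) - 1)"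
      by (intro tendsto_intros T) auto
  qed (use good_trace[OF x] N_def in simp)
  have "\<forall>\<^sub>F m in sequentially. norm (T m a b - unit_val x a b) < (1/2) ^ units_exp p" if "a < N" "b < N" for a b
  proof (rule order_tendstoD)
    show "(\<lambda>m. norm (T m a b - unit_val x a b)) \<longlonglongrightarrow> norm (unit_val x a b - unit_val x a b)"
      using that by (intro tendsto_intros T)
  qed simp
  then have 3: "\<forall>\<^sub>F m in sequentially. \<forall>a\<in>{..<N}. \<forall>b\<in>{..<N}. norm (T m a b - unit_val x a b) < (1/2) ^ units_exp p"
    by (intro eventually_ball_finite ballI finite_lessThan) auto
  have 4: "\<forall>\<^sub>F m in sequentially. norm (w m N - ev (pfst k)) < (1/2) ^ (k + 4)"
  proof (rule order_tendstoD)
    show "(\<lambda>m. norm (w m N - ev (pfst k))) \<longlonglongrightarrow> norm (V N - ev (pfst k))" by (intro tendsto_intros lim) simp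
  qed (simp add: V_def)
  have "\<exists>m. (\<forall>a\<in>{..<N}. \<forall>b\<in>{..<N}. \<forall>c\<in>{..<N}. \<forall>d\<in>{..<N}. norm (unit_defect (T m) a b c d) < (1/2) ^ defect_exp p) \<and>
     norm ((\<Sum>a<N. T m a a) - 1) < 1/2 \<and>
     (\<forall>a\<in>{..<N}. \<forall>b\<in>{..<N}. norm (T m a b - unit_val x a b) < (1/2) ^ units_exp p) \<and>
     norm (w m N - ev (pfst k)) < (1/2) ^ (k + 4)"
    by (rule eventually_happens'[OF sequentially_bot], intro eventually_conj 1 2 3 4)
  then obtain m where m: "\<forall>a\<in>{..<N}. \<forall>b\<in>{..<N}. \<forall>c\<in>{..<N}. \<forall>d\<in>{..<N}. norm (unit_defect (T m) a b c d) < (1/2) ^ defect_exp p"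
    and m2: "norm ((\<Sum>a<N. T m a a) - 1) < 1/2"
    and m': "\<forall>a\<in>{..<N}. \<forall>b\<in>{..<N}. norm (T m a b - unit_val x a b) < (1/2) ^ units_exp p"
    and m4: "norm (w m N - ev (pfst k)) < (1/2) ^ (k + 4)"
    by (elim exE conjE)
  have m1: "norm (unit_defect (T m) a b c d) < (1/2) ^ defect_exp p" if "a < N" "b < N" "c < N" "d < N" for a b c d
    using m that by simp
  have m3: "norm (T m a b - unit_val x a b) < (1/2) ^ units_exp p" if "a < N" "b < N" for a b
    using m' that by simp
  let ?j = "J m"
  note mj = mu[of ?j]
  have TB: "T m a b \<in> B ?j" if "a < N" "b < N" for a b
    unfolding T_def B_def using that w(1) B_def by (intro unit_span_mult[OF mj] unit_span_adj[OF mj]) auto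
  have au: "almost_units N ((1/2) ^ defect_exp p) (T m)"
    unfolding almost_units_def using m1 m2 by (auto simp: T_def adj_mult adj_adj intro: less_imp_le)
  have "\<exists>f. matrix_units N f \<and> (\<forall>a<N. \<forall>b<N. f a b \<in> B ?j \<and> norm (f a b - T m a b) \<le> (1/2) ^ units_exp p)"
  proof (rule almost_units_near[OF N au _ _ _ TB])
    show "closed (B ?j)" unfolding B_def by (rule closed_unit_span[OF mj])
    show "y + z \<in> B ?j \<and> y - z \<in> B ?j \<and> y * z \<in> B ?j" if "y \<in> B ?j" "z \<in> B ?j" for y z
      using that unfolding B_def
      by (intro conjI unit_span_add[OF mj] unit_span_diff[OF mj] unit_span_mult[OF mj])
    show "scaleR r z \<in> B ?j" if "z \<in> B ?j" for z r
      using that unfolding B_def by (rule unit_span_scaleR[OF mj])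
  qed
  then obtain f where f: "matrix_units N f"
    "\<forall>a<N. \<forall>b<N. f a b \<in> B ?j \<and> norm (f a b - T m a b) \<le> (1/2) ^ units_exp p" by blast
  have fB: "f a b \<in> unit_span (n ?j) (e ?j)" and fT: "norm (f a b - T m a b) \<le> (1/2) ^ units_exp p"
    if "a < N" "b < N" for a b
    using f(2) that by (simp_all add: B_def)
  have fx: "norm (f a b - unit_val x a b) < (1/2) ^ (close_exp p + 2)" if ab: "a < N" "b < N" for a b
  proof -
    have "norm (f a b - unit_val x a b) < (1/2) ^ units_exp p + (1/2) ^ units_exp p"
      using fT[OF ab] m3[OF ab] norm_triangle_ineq[of "f a b - T m a b" "T m a b - unit_val x a b"] by simp
    also have "\<dots> \<le> (1/2) ^ (close_exp p + 2)" unfolding units_exp_def by (rule half_power_double)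
    finally show ?thesis .
  qed
  have "\<exists>d E. matrix_units (d * N) E \<and> (\<forall>a<N. \<forall>b<N. diag_sum d N E a b = f a b) \<and>
      unit_span (n ?j) (e ?j) \<subseteq> unit_span (d * N) E"
    by (rule matrix_units_refine[OF mj f(1)]) (rule fB)
  then obtain d E where E: "matrix_units (d * N) E" "\<forall>a<N. \<forall>b<N. diag_sum d N E a b = f a b"
    "B ?j \<subseteq> unit_span (d * N) E" unfolding B_def by blast
  have "w m N \<in> unit_span (d * N) E" using w(1)[of N m] E(3) by auto
  from unit_span_rational[OF this, of "(1/2) ^ (k + 4)"] obtain C
    where C: "norm (poly_val (unit_letter (d * N) E) C - w m N) < (1/2) ^ (k + 4)" by auto
  have Ct: "norm (ev (pfst k) - poly_val (unit_letter (d * N) E) C) < (1/2) ^ (k + 2)"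
  proof -
    have "norm (ev (pfst k) - poly_val (unit_letter (d * N) E) C) < (1/2) ^ (k + 4) + (1/2) ^ (k + 4)"
      using C m4 norm_triangle_ineq4[of "ev (pfst k) - w m N" "poly_val (unit_letter (d * N) E) C - w m N"]
      by (simp add: norm_minus_commute)
    also have "\<dots> \<le> (1/2) ^ (k + 2)" by (rule half_power_double)
    finally show ?thesis .
  qed
  obtain y where y: "\<And>i. state_dim (y i) = d * N" "\<And>i. state_poly (y i) = C" "\<And>i. p < state_prec (y i)"
    and yE: "\<And>a b. a < d * N \<Longrightarrow> b < d * N \<Longrightarrow> (\<lambda>i. unit_val (y i) a b) \<longlonglongrightarrow> E a b"
    and yg: "\<forall>\<^sub>F i in sequentially. good (y i)"
    using states_near_units[OF E(1), of C p] by blast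
  have dN: "0 < d * N" using E(1) by (rule matrix_units_pos)
  have "\<forall>\<^sub>F i in sequentially. norm_small (poly_diff (diag_code (y i) N a b) (unit_code x a b)) (close_exp p)"
    if ab: "a < N" "b < N" for a b
  proof -
    have "(\<lambda>i. norm (ev (diag_code (y i) N a b) - unit_val x a b)) \<longlonglongrightarrow> norm (diag_sum d N E a b - unit_val x a b)"
      unfolding eval_point_diag_code y using N(1) by (simp, intro tendsto_intros tendsto_diag_sum yE ab)
    then have "\<forall>\<^sub>F i in sequentially. norm (ev (diag_code (y i) N a b) - unit_val x a b) < (1/2) ^ (close_exp p + 2)"
      by (rule order_tendstoD) (use E(2) ab fx[OF ab] in simp)
    then show ?thesis by eventually_elim (rule norm_smallI, simp)
  qed
  then have 5: "\<forall>\<^sub>F i in sequentially. \<forall>a\<in>{..<N}. \<forall>b\<in>{..<N}.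
      norm_small (poly_diff (diag_code (y i) N a b) (unit_code x a b)) (close_exp p)"
    by (intro eventually_ball_finite ballI finite_lessThan) auto
  have 6: "\<forall>\<^sub>F i in sequentially. norm_small (poly_diff (pfst k) (subst_code (y i) (d * N) C)) k"
  proof -
    have "(\<lambda>i. ev (diag_code (y i) (d * N) a b)) \<longlonglongrightarrow> E a b" if "a < d * N" "b < d * N" for a b
      unfolding eval_point_diag_code y using dN yE[OF that] by (simp add: diag_sum_def)
    then have "(\<lambda>i. norm (ev (pfst k) - ev (subst_code (y i) (d * N) C)))
        \<longlonglongrightarrow> norm (ev (pfst k) - poly_val (unit_letter (d * N) E) C)"
      unfolding eval_point_subst_code by (intro tendsto_intros tendsto_poly_val tendsto_unit_letter dN)
    then have "\<forall>\<^sub>F i in sequentially. norm (ev (pfst k) - ev (subst_code (y i) (d * N) C)) < (1/2) ^ (k + 2)"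
      by (rule order_tendstoD) (rule Ct)
    then show ?thesis by eventually_elim (rule norm_smallI, simp)
  qed
  have "\<exists>i. good (y i) \<and> (\<forall>a\<in>{..<N}. \<forall>b\<in>{..<N}.
      norm_small (poly_diff (diag_code (y i) N a b) (unit_code x a b)) (close_exp p)) \<and>
      norm_small (poly_diff (pfst k) (subst_code (y i) (d * N) C)) k"
    by (rule eventually_happens'[OF sequentially_bot], intro eventually_conj yg 5 6)
  then obtain i where "good (y i)" "step k x (y i)"
    unfolding step_def y N_def[symmetric] p_def[symmetric] using y(3) by auto
  then show ?thesis by blast
qed

end

section \<open>The limit of the search\<close>

text \<open>Summing errors over the blocks of the next state may cost a factor 2^q; the gap keeps
  the result below the tolerance of the preceding state.\<close>

lemma close_exp_less: "p < q \<Longrightarrow> close_exp p + q \<le> close_exp q"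
proof -
  assume "p < q"
  then have "(p + 2) ^ 2 + q \<le> (q + 2) ^ 2"
  proof -
    have "p + 3 \<le> q + 2" using \<open>p < q\<close> by simp
    then have "(p + 3) * (q + 2) \<le> (q + 2) * (q + 2)" by (rule mult_le_mono1)
    moreover have "(p + 2) * (p + 2) \<le> (p + 2) * (q + 2)" using \<open>p < q\<close> by (intro mult_le_mono2) simp
    ultimately show ?thesis by (simp add: power2_eq_square algebra_simps)
  qed
  with \<open>p < q\<close> show ?thesis by (simp add: close_exp_def)
qed

text \<open>What \<open>close_exp p\<close> retains after 2^p blocks and a factor 2 are paid for:
  \<open>close_exp p = limit_exp p + (p + 1)\<close>. Here the square is reserved for the Lipschitz
  constant and p + 3 for the final error.\<close>

definition limit_exp :: "nat \<Rightarrow> nat" where "limit_exp p = (p + 2) ^ 2 + p + 3"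

lemma limit_exp_mono: "p + m \<le> q \<Longrightarrow> limit_exp p + m \<le> limit_exp q"
  using power_mono[of "p + 2" "q + 2" 2] unfolding limit_exp_def by linarith

lemma unit_letter_bounds:
  assumes mu: "matrix_units N e" and ef: "\<And>a b. a < N \<Longrightarrow> b < N \<Longrightarrow> norm (e a b - f a b) \<le> \<delta>"
  shows "norm (unit_letter N e l) \<le> real l" "norm (unit_letter N e l - unit_letter N f l) \<le> real l * \<delta>"
proof -
  have N: "0 < N" using mu by (rule matrix_units_pos)
  define i a b where "i = l div 2" and "a = pfst (psnd i) mod N" and "b = psnd (psnd i) mod N"
  have ab: "a < N" "b < N" using N by (simp_all add: a_def b_def)
  have \<delta>: "0 \<le> \<delta>" using order_trans[OF norm_ge_zero ef[OF ab]] .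
  have c: "cmod (gval (pfst i)) \<le> real l"
    using cmod_gval_le[of "pfst i"] pfst_le[of i] unfolding i_def by linarith
  have L: "unit_letter N e l = (if l mod 2 = 0 then scaleC (gval (pfst i)) (e a b) else adj (scaleC (gval (pfst i)) (e a b)))" for e
    by (simp add: unit_letter_def i_def a_def b_def Let_def)
  show "norm (unit_letter N e l) \<le> real l"
    using c norm_unit[OF mu ab] by (simp add: L norm_scaleC)
  have "norm (unit_letter N e l - unit_letter N f l) = norm (scaleC (gval (pfst i)) (e a b - f a b))"
    by (simp add: L scaleC.diff_right flip: adj_diff)
  also have "\<dots> \<le> real l * \<delta>" unfolding norm_scaleC using c ef[OF ab] \<delta> by (intro mult_mono) auto
  finally show "norm (unit_letter N e l - unit_letter N f l) \<le> real l * \<delta>" .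
qed

lemma poly_val_in_unit_span:
  assumes mu: "matrix_units N e"
  shows "poly_val (unit_letter N e) q \<in> unit_span N e"
proof -
  have N: "0 < N" using mu by (rule matrix_units_pos)
  have L: "unit_letter N e l \<in> unit_span N e" for l
    unfolding unit_letter_def Let_def using N
    by (auto intro!: unit_span_scaleC[OF mu] unit_span_adj[OF mu] unit_in_unit_span[OF mu])
  have one: "1 \<in> unit_span N e"
    unfolding unit_sum[OF mu, symmetric] by (intro unit_span_sum[OF mu] unit_in_unit_span[OF mu]) auto
  have w: "prod_list (map (unit_letter N e) ws) \<in> unit_span N e" for ws
    by (induction ws) (auto intro: one unit_span_mult[OF mu] L)
  have "sum_list (map (mono_val (unit_letter N e)) ms) \<in> unit_span N e" for ms
    by (induction ms) (auto simp: mono_val_def intro!: unit_span_zero[OF mu] unit_span_add[OF mu] unit_span_scaleC[OF mu] w)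
  then show ?thesis by (simp add: poly_val_def)
qed

lemma diag_sum_diff_le:
  fixes f g :: "nat \<Rightarrow> nat \<Rightarrow> 'a::unital_cstar_algebra"
  assumes "\<And>a b. a < d * N \<Longrightarrow> b < d * N \<Longrightarrow> norm (f a b - g a b) \<le> \<delta>" "a < N" "b < N"
  shows "norm (diag_sum d N f a b - diag_sum d N g a b) \<le> real d * \<delta>"
  unfolding diag_sum_def sum_subtractf[symmetric]
  by (intro norm_sum_le_const assms(1) add_mult_less assms(2,3))

context normed_presentation
begin

context
  fixes X :: "nat \<Rightarrow> nat"
  assumes X_good: "\<And>k. good (X k)" and X_step: "\<And>k. step k (X k) (X (Suc k))"
begin

lemma X_prec: "state_prec (X k) + m \<le> state_prec (X (k + m))"
proof (induction m)
  case (Suc m)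
  have "state_prec (X (k + m)) < state_prec (X (Suc (k + m)))" using X_step[of "k + m"] by (simp add: step_def)
  with Suc show ?case by simp
qed simp

lemma X_prec_ge: "k \<le> state_prec (X k)"
  using X_prec[of 0 k] by simp

lemma X_dim_pos: "0 < state_dim (X k)"
  using X_good[of k] by (simp add: good_def)

lemma X_dim_dvd: "j \<le> k \<Longrightarrow> state_dim (X j) dvd state_dim (X k)"
proof (induction rule: dec_induct)
  case (step k)
  have "state_dim (X k) dvd state_dim (X (Suc k))" using X_step[of k] by (simp add: step_def mod_eq_0_iff_dvd)
  with step show ?case by (blast intro: dvd_trans)
qed simp

text \<open>D j k is the diagonal sum, at level j, of an exact system f k chosen near state k.
  Exactness makes every D j k a system of matrix units, a property that passes to the limit. The
  choice of f k is not effective, but the last clause compares the limits with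
  \<open>diag_code\<close>, which is computable.\<close>

lemma limit_units_exist:
  "\<exists>e. (\<forall>j. matrix_units (state_dim (X j)) (e j)) \<and>
     (\<forall>j. \<forall>a<state_dim (X j). \<forall>b<state_dim (X j).
        e j a b = diag_sum (state_dim (X (Suc j)) div state_dim (X j)) (state_dim (X j)) (e (Suc j)) a b) \<and>
     (\<forall>j i. j \<le> i \<longrightarrow> (\<forall>a<state_dim (X j). \<forall>b<state_dim (X j).
        norm (e j a b - ev (diag_code (X i) (state_dim (X j)) a b)) \<le> 3 * (1/2) ^ limit_exp (state_prec (X i))))"
proof -
  define N where "N k = state_dim (X k)" for k
  define P where "P k = state_prec (X k)" for k
  have N: "0 < N k" for k using X_dim_pos by (simp add: N_def)
  have NP: "real (N k) \<le> 2 ^ P k" for k unfolding N_def P_def by (intro real_le_two_power state_dim_le)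
  have dv: "j \<le> k \<Longrightarrow> N k = (N k div N j) * N j" for j k using X_dim_dvd[of j k] by (simp add: N_def)
  have "\<forall>k. \<exists>f. matrix_units (N k) f \<and> (\<forall>a<N k. \<forall>b<N k. norm (f a b - unit_val (X k) a b) \<le> (1/2) ^ units_exp (P k))"
    using good_near_units[OF X_good] by (simp add: N_def P_def)
  from choice[OF this] obtain f where f0: "\<forall>k. matrix_units (N k) (f k) \<and>
     (\<forall>a<N k. \<forall>b<N k. norm (f k a b - unit_val (X k) a b) \<le> (1/2) ^ units_exp (P k))" ..
  have mf: "matrix_units (N k) (f k)" for k using f0 by simp
  have f: "norm (f k a b - unit_val (X k) a b) \<le> (1/2) ^ units_exp (P k)" if "a < N k" "b < N k" for k a b
    using f0 that by simp
  define D where "D j k a b = diag_sum (N k div N j) (N j) (f k) a b" for j k a b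
  have dle: "real (N k div N j) \<le> 2 ^ P k" for j k
  proof -
    have "real (N k div N j) \<le> real (N k)" by simp
    also have "\<dots> \<le> 2 ^ P k" by (rule NP)
    finally show ?thesis .
  qed
  have half: "2 ^ p * (1/2::real) ^ (n + p) = (1/2) ^ n" for p n
    by (simp add: power_add power_divide)
  have DU: "norm (D j k a b - ev (diag_code (X k) (N j) a b)) \<le> (1/2) ^ (close_exp (P k) + 4 - P k)"
    if "j \<le> k" "a < N j" "b < N j" for j k a b
  proof -
    have "norm (D j k a b - ev (diag_code (X k) (N j) a b)) \<le> real (N k div N j) * (1/2) ^ units_exp (P k)"
      unfolding D_def eval_point_diag_code N_def[symmetric]
      by (intro diag_sum_diff_le that f) (use dv[OF that(1)] in simp_all)
    also have "\<dots> \<le> 2 ^ P k * (1/2) ^ units_exp (P k)" by (intro mult_right_mono dle) simp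
    also have "units_exp (P k) = (close_exp (P k) + 4 - P k) + P k" by (simp add: units_exp_def close_exp_def)
    finally show ?thesis by (simp only: half)
  qed
  \<comment> \<open>The tolerance of the step test, plus the distances of the two exact systems from
    their states.\<close>
  have one: "norm (D k (Suc k) a b - f k a b) \<le> 2 * (1/2) ^ close_exp (P k)" if ab: "a < N k" "b < N k" for k a b
  proof -
    have st: "P k < P (Suc k)" using X_step[of k] by (simp add: step_def P_def)
    have "norm_small (poly_diff (diag_code (X (Suc k)) (N k) a b) (unit_code (X k) a b)) (close_exp (P k))"
      using X_step[of k] ab by (simp add: step_def N_def P_def)
    from norm_smallD[OF this] have 1: "norm (ev (diag_code (X (Suc k)) (N k) a b) - unit_val (X k) a b) \<le> (1/2) ^ close_exp (P k)" by simp
    have 2: "norm (D k (Suc k) a b - ev (diag_code (X (Suc k)) (N k) a b)) \<le> (1/2) ^ (close_exp (P k) + 4)"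
      by (rule order_trans[OF DU[OF _ ab] power_decreasing]) (use close_exp_less[OF st] in auto)
    have 3: "norm (f k a b - unit_val (X k) a b) \<le> (1/2) ^ (close_exp (P k) + 4)"
      using f[OF ab] by (simp add: units_exp_def)
    have "norm (D k (Suc k) a b - f k a b) \<le> norm (D k (Suc k) a b - ev (diag_code (X (Suc k)) (N k) a b))
        + (norm (ev (diag_code (X (Suc k)) (N k) a b) - unit_val (X k) a b) + norm (f k a b - unit_val (X k) a b))"
      using norm_triangle_ineq[of "D k (Suc k) a b - ev (diag_code (X (Suc k)) (N k) a b)" "ev (diag_code (X (Suc k)) (N k) a b) - f k a b"]
        norm_triangle_ineq4[of "ev (diag_code (X (Suc k)) (N k) a b) - unit_val (X k) a b" "f k a b - unit_val (X k) a b"] by simp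
    also have "\<dots> \<le> (1/2) ^ (close_exp (P k) + 4) + ((1/2) ^ close_exp (P k) + (1/2) ^ (close_exp (P k) + 4))"
      by (intro add_mono 1 2 3)
    also have "\<dots> \<le> 2 * (1/2) ^ close_exp (P k)" 
    proof -
      have "(1/2::real) ^ (close_exp (P k) + 4) \<le> (1/2) ^ (close_exp (P k) + 1)" by (intro power_decreasing) auto
      then show ?thesis by simp
    qed
    finally show ?thesis .
  qed
  have D_comp: "D j k a b = diag_sum (N i div N j) (N j) (D i k) a b" if "j \<le> i" "i \<le> k" for i j k a b
  proof -
    have "N k = (N k div N i) * (N i div N j) * N j"
      using dv[OF that(1)] dv[OF that(2)] by (metis mult.assoc)
    then have "N k div N j = (N k div N i) * (N i div N j)"
      using N[of j] by (metis nonzero_mult_div_cancel_right less_numeral_extra(3))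
    moreover have "D i k = diag_sum (N k div N i) ((N i div N j) * N j) (f k)"
      using dv[OF that(1)] by (auto simp: D_def fun_eq_iff)
    ultimately show ?thesis unfolding D_def[of j] by (simp only: diag_sum_diag_sum[OF N])
  qed
  \<comment> \<open>Seen from level j, the change at level k is summed over at most 2^(P k)
    blocks.\<close>
  have inc: "norm (D j (Suc k) a b - D j k a b) \<le> (1/2) ^ limit_exp (P k)" if "j \<le> k" "a < N j" "b < N j" for j k a b
  proof -
    have "norm (D j (Suc k) a b - D j k a b) \<le> real (N k div N j) * (2 * (1/2) ^ close_exp (P k))"
      unfolding D_comp[OF that(1) le_SucI[OF order_refl]] D_def[of j k]
      by (intro diag_sum_diff_le one that) (use dv[OF that(1)] in simp_all)
    also have "\<dots> \<le> 2 ^ P k * (2 * (1/2) ^ close_exp (P k))" by (intro mult_right_mono dle) simp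
    also have "\<dots> = 2 ^ (P k + 1) * (1/2) ^ close_exp (P k)" by simp
    also have "close_exp (P k) = limit_exp (P k) + (P k + 1)" by (simp add: close_exp_def limit_exp_def)
    finally show ?thesis by (simp only: half)
  qed
  \<comment> \<open>Started at i, so that the precision at i bounds the whole tail; the precision
    grows by at least 1 per stage, which makes the increments geometric.\<close>
  have lim: "\<exists>l. (\<lambda>m. D j (i + m) a b) \<longlonglongrightarrow> l \<and> norm (l - D j i a b) \<le> 2 * (1/2) ^ limit_exp (P i)"
    if "j \<le> i" "a < N j" "b < N j" for i j a b
  proof -
    have "norm (D j (i + Suc m) a b - D j (i + m) a b) \<le> (1/2) ^ limit_exp (P i) * (1/2) ^ m" for m
    proof -
      have "norm (D j (Suc (i + m)) a b - D j (i + m) a b) \<le> (1/2) ^ limit_exp (P (i + m))"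
        using that by (intro inc) auto
      also have "\<dots> \<le> (1/2) ^ (limit_exp (P i) + m)"
        using limit_exp_mono[OF X_prec[of i m]] by (intro power_decreasing) (auto simp: P_def)
      finally show ?thesis by (simp add: power_add)
    qed
    from geometric_limit[of "\<lambda>m. D j (i + m) a b", OF this] obtain l where "(\<lambda>m. D j (i + m) a b) \<longlonglongrightarrow> l"
      "\<forall>m. norm (l - D j (i + m) a b) \<le> 2 * (1/2) ^ limit_exp (P i) * (1/2) ^ m" by blast
    from this(1) this(2)[rule_format, of 0] show ?thesis by auto
  qed
  define e where "e j a b = lim (\<lambda>k. D j k a b)" for j a b
  have e: "(\<lambda>k. D j k a b) \<longlonglongrightarrow> e j a b" "norm (e j a b - D j i a b) \<le> 2 * (1/2) ^ limit_exp (P i)"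
    if ij: "j \<le> i" "a < N j" "b < N j" for i j a b
  proof -
    obtain l where l: "(\<lambda>m. D j (i + m) a b) \<longlonglongrightarrow> l" "norm (l - D j i a b) \<le> 2 * (1/2) ^ limit_exp (P i)"
      using lim[OF ij] by blast
    have l': "(\<lambda>k. D j k a b) \<longlonglongrightarrow> l"
      by (rule LIMSEQ_offset[of _ i]) (use l(1) in \<open>simp add: add.commute\<close>)
    then have "e j a b = l" unfolding e_def by (rule limI)
    with l l' show "(\<lambda>k. D j k a b) \<longlonglongrightarrow> e j a b" "norm (e j a b - D j i a b) \<le> 2 * (1/2) ^ limit_exp (P i)" by auto
  qed
  have mD: "matrix_units (N j) (D j (j + m))" for j m
    using matrix_units_diag_sum[of "N (j + m) div N j" "N j" "f (j + m)"] mf dv[of j "j + m"]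
    unfolding D_def by simp
  have me: "matrix_units (N j) (e j)" for j
  proof (rule matrix_units_limit[OF mD])
    fix a b assume "a < N j" "b < N j"
    from e(1)[OF order_refl this] have "(\<lambda>m. D j (m + j) a b) \<longlonglongrightarrow> e j a b" by (rule LIMSEQ_ignore_initial_segment)
    then show "(\<lambda>m. D j (j + m) a b) \<longlonglongrightarrow> e j a b" by (simp add: add.commute)
  qed
  have compat: "e j a b = diag_sum (N (Suc j) div N j) (N j) (e (Suc j)) a b" if ab: "a < N j" "b < N j" for j a b
  proof (rule LIMSEQ_unique)
    show "(\<lambda>m. D j (m + Suc j) a b) \<longlonglongrightarrow> e j a b"
      by (intro LIMSEQ_ignore_initial_segment e(1)[OF order_refl ab])
    have eq: "D j (m + Suc j) a b = diag_sum (N (Suc j) div N j) (N j) (D (Suc j) (m + Suc j)) a b" for m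
      by (rule D_comp) auto
    show "(\<lambda>m. D j (m + Suc j) a b) \<longlonglongrightarrow> diag_sum (N (Suc j) div N j) (N j) (e (Suc j)) a b"
      unfolding eq
      by (intro tendsto_diag_sum LIMSEQ_ignore_initial_segment e(1)[OF order_refl] ab)
        (use dv[of j "Suc j"] in simp_all)
  qed
  have "norm (e j a b - ev (diag_code (X i) (N j) a b)) \<le> 3 * (1/2) ^ limit_exp (P i)"
    if ij: "j \<le> i" "a < N j" "b < N j" for i j a b
  proof -
    have "norm (e j a b - ev (diag_code (X i) (N j) a b)) \<le> 2 * (1/2) ^ limit_exp (P i) + (1/2) ^ (close_exp (P i) + 4 - P i)"
      using norm_triangle_ineq[of "e j a b - D j i a b" "D j i a b - ev (diag_code (X i) (N j) a b)"]
        e(2)[OF ij] DU[OF ij] by simp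
    also have "(1/2::real) ^ (close_exp (P i) + 4 - P i) \<le> (1/2) ^ limit_exp (P i)"
      by (intro power_decreasing) (auto simp: close_exp_def limit_exp_def)
    finally show ?thesis by simp
  qed
  with me compat show ?thesis unfolding N_def[symmetric] P_def[symmetric] by blast
qed

context
  fixes e :: "nat \<Rightarrow> nat \<Rightarrow> nat \<Rightarrow> 'a"
  assumes me: "\<And>j. matrix_units (state_dim (X j)) (e j)"
    and near: "\<And>i j a b. j \<le> i \<Longrightarrow> a < state_dim (X j) \<Longrightarrow> b < state_dim (X j) \<Longrightarrow>
        norm (e j a b - ev (diag_code (X i) (state_dim (X j)) a b)) \<le> 3 * (1/2) ^ limit_exp (state_prec (X i))"
begin

text \<open>The source of computability of the embeddings: the value of q at the limit system is
  approximated by a code obtained from the state X i. Bounding q by the precision lets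
  \<open>limit_exp\<close> absorb the Lipschitz constant.\<close>

lemma subst_code_near:
  assumes "j \<le> i" "q \<le> state_prec (X i)"
  shows "norm (poly_val (unit_letter (state_dim (X j)) (e j)) q - ev (subst_code (X i) (state_dim (X j)) q))
     < (1/2) ^ state_prec (X i)"
proof -
  define P where "P = state_prec (X i)"
  let ?\<delta> = "3 * (1/2::real) ^ limit_exp P"
  have "norm (poly_val (unit_letter (state_dim (X j)) (e j)) q - ev (subst_code (X i) (state_dim (X j)) q))
      \<le> 2 ^ ((q + 2)\<^sup>2) * ?\<delta>"
    unfolding eval_point_subst_code
  proof (rule poly_val_lipschitz)
    show "norm (unit_letter (state_dim (X j)) (e j) l) \<le> real l"
      "norm (unit_letter (state_dim (X j)) (e j) l
          - unit_letter (state_dim (X j)) (\<lambda>a b. ev (diag_code (X i) (state_dim (X j)) a b)) l) \<le> real l * ?\<delta>" for l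
      using unit_letter_bounds[OF me near[OF assms(1)]] by (simp_all add: P_def)
    have "(1/2::real) ^ limit_exp P \<le> (1/2) ^ 3" by (intro power_decreasing) (auto simp: limit_exp_def)
    then show "?\<delta> \<le> 1" by (simp add: power_numeral_reduce)
  qed simp
  also have "\<dots> \<le> 2 ^ ((P + 2)\<^sup>2) * ?\<delta>"
    using assms(2) by (intro mult_right_mono power_increasing power_mono) (auto simp: P_def)
  also have "\<dots> = 3 * ((1/2) ^ P * (1/2) ^ 3)"
    unfolding limit_exp_def by (simp add: power_add power_divide)
  also have "\<dots> < (1/2) ^ P" by (simp add: power_numeral_reduce)
  finally show ?thesis by (simp add: P_def)
qed

text \<open>The polynomial recorded in state k + 1 has a code bounded by the precision, so its value
  hardly changes when the state is replaced by the limit system and remains close to the rational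
  point \<open>pfst k\<close>.\<close>

lemma limit_units_dense: "closure (\<Union>j. unit_span (state_dim (X j)) (e j)) = UNIV"
proof -
  have near: "\<exists>t\<in>(\<Union>j. unit_span (state_dim (X j)) (e j)). norm (t - ev (pfst k)) < 2 * (1/2) ^ k" for k
  proof -
    let ?N = "state_dim (X (Suc k))" and ?C = "state_poly (X (Suc k))" and ?P = "state_prec (X (Suc k))"
    let ?t = "poly_val (unit_letter ?N (e (Suc k))) ?C"
    have C: "?C \<le> ?P"
      using pfst_le[of "psnd (pfst (X (Suc k)))"] psnd_le[of "pfst (X (Suc k))"]
      unfolding state_poly_def state_prec_def by linarith
    have 1: "norm (?t - ev (subst_code (X (Suc k)) ?N ?C)) < (1/2) ^ ?P" by (rule subst_code_near[OF order_refl C])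
    have 2: "norm (ev (pfst k) - ev (subst_code (X (Suc k)) ?N ?C)) < (1/2) ^ k"
      using X_step[of k] norm_smallD unfolding step_def by fastforce
    have 3: "(1/2::real) ^ ?P \<le> (1/2) ^ k"
      using X_prec_ge[of "Suc k"] by (intro power_decreasing) auto
    have "norm (?t - ev (pfst k)) \<le> norm (?t - ev (subst_code (X (Suc k)) ?N ?C))
        + norm (ev (pfst k) - ev (subst_code (X (Suc k)) ?N ?C))"
      using norm_triangle_ineq4[of "?t - ev (subst_code (X (Suc k)) ?N ?C)" "ev (pfst k) - ev (subst_code (X (Suc k)) ?N ?C)"]
      by simp
    with 1 2 3 have "norm (?t - ev (pfst k)) < 2 * (1/2) ^ k" by linarith
    moreover have "?t \<in> unit_span ?N (e (Suc k))" by (rule poly_val_in_unit_span[OF me])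
    ultimately show ?thesis by blast
  qed
  have "x \<in> closure (\<Union>j. unit_span (state_dim (X j)) (e j))" for x
    unfolding closure_approachable
  proof (intro allI impI)
    fix \<epsilon> :: real assume \<epsilon>: "0 < \<epsilon>"
    obtain q where q: "norm (ev q - x) < \<epsilon> / 2"
      using closure_normI[OF eval_point_dense[OF pres], of "\<epsilon> / 2" x] \<epsilon> by auto
    obtain m where m: "(1/2) ^ m < \<epsilon> / 4" using real_arch_pow_inv[of "\<epsilon> / 4" "1/2"] \<epsilon> by auto
    \<comment> \<open>The step with this number targets q, and k >= m makes its error small
      enough.\<close>
    define k where "k = pair q m"
    obtain t where t: "t \<in> (\<Union>j. unit_span (state_dim (X j)) (e j))" "norm (t - ev q) < 2 * (1/2) ^ k"
      using near[of k] by (auto simp: k_def)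
    have "(1/2::real) ^ k \<le> (1/2) ^ m"
      by (intro power_decreasing) (auto simp: k_def le_prod_encode_2)
    moreover have "dist t x \<le> norm (t - ev q) + norm (ev q - x)"
      using norm_triangle_ineq[of "t - ev q" "ev q - x"] by (simp add: dist_norm)
    ultimately have "dist t x < \<epsilon>" using t(2) q m by linarith
    with t(1) show "\<exists>y\<in>(\<Union>j. unit_span (state_dim (X j)) (e j)). dist y x < \<epsilon>" by blast
  qed
  then show ?thesis by blast
qed

end

end

section \<open>The computable sequence of states\<close>

text \<open>The implication makes the search terminate for every \<open>x\<close>, as regular minimization demands.\<close>

definition next_state :: "nat \<Rightarrow> nat \<Rightarrow> nat" where
  "next_state k x = (LEAST y. (of_bool (\<not> (good x \<longrightarrow> good y \<and> step k x y)) :: nat) = 0)"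

text \<open>The hypothesis \<open>ex\<close> serves to prove that the minimization is regular; the
  function that is minimized consists of decidable tests on codes. The start state is one fixed
  number, so no algorithm has to find it.\<close>

lemma computable_states_exist:
  assumes ex: "\<And>x k. good x \<Longrightarrow> \<exists>y. good y \<and> step k x y" and x0: "good x0"
  shows "\<exists>X. computable X \<and> (\<forall>k. good (X k)) \<and> (\<forall>k. step k (X k) (X (Suc k)))"
proof -
  have "computable (\<lambda>z. LEAST y. (of_bool (\<not> (good (psnd z) \<longrightarrow> good y \<and> step (pfst z) (psnd z) y)) :: nat) = 0)"
  proof (rule computable_Least)
    have "decidable (\<lambda>z. \<not> (good (psnd (psnd z)) \<longrightarrow> good (pfst z) \<and> step (pfst (psnd z)) (psnd (psnd z)) (pfst z)))"
      by (intro decidable_not decidable_imp decidable_conj decidable_good decidable_step computable_intros)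
    then show "computable (\<lambda>z. of_bool (\<not> (good (psnd (psnd z)) \<longrightarrow> good (pfst z) \<and> step (pfst (psnd z)) (psnd (psnd z)) (pfst z))))"
      by (simp add: decidable_def)
    show "\<exists>y. (of_bool (\<not> (good (psnd z) \<longrightarrow> good y \<and> step (pfst z) (psnd z) y)) :: nat) = 0" for z
      using ex[of "psnd z" "pfst z"] by auto
  qed
  then have "computable (\<lambda>z. next_state (pfst z) (psnd z))" by (simp only: next_state_def)
  note cn = computable_compose2[of next_state, OF this]
  define X where "X k = rec_nat x0 (\<lambda>k x. next_state k x) k" for k
  have X: "X 0 = x0" "X (Suc k) = next_state k (X k)" for k by (simp_all add: X_def)
  have "computable X" unfolding X_def
    by (intro computable_rec_nat[where g = "\<lambda>y r x. next_state y r"] cn computable_intros)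
  have nx: "good (next_state k x) \<and> step k x (next_state k x)" if "good x" for k x
  proof -
    have "(of_bool (\<not> (good x \<longrightarrow> good (next_state k x) \<and> step k x (next_state k x))) :: nat) = 0"
      unfolding next_state_def by (rule LeastI_ex) (use ex[OF that] in auto)
    with that show ?thesis by simp
  qed
  have g: "good (X k)" for k by (induction k) (auto simp: X x0 nx)
  have "step k (X k) (X (Suc k))" for k using nx[OF g] by (simp add: X)
  with \<open>computable X\<close> g show ?thesis by blast
qed

end

section \<open>Matrix algebras\<close>

definition mat_val :: "nat \<Rightarrow> (nat \<Rightarrow> nat \<Rightarrow> 'a::unital_cstar_algebra) \<Rightarrow> complex mat \<Rightarrow> 'a" where
  "mat_val n e X = mat_sum n (\<lambda>a b. X $$ (a, b)) e"

lemma mat_adjoint_index: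
  "X \<in> carrier_mat n n \<Longrightarrow> a < n \<Longrightarrow> b < n \<Longrightarrow> mat_adjoint X $$ (a, b) = cnj (X $$ (b, a))"
  unfolding mat_adjoint_def by (auto simp: mat_of_rows_index)

lemma mat_adjoint_square: "X \<in> carrier_mat n n \<Longrightarrow> mat_adjoint X \<in> carrier_mat n n"
  unfolding mat_adjoint_def by auto

lemma mat_val_add:
  "X \<in> carrier_mat n n \<Longrightarrow> Y \<in> carrier_mat n n \<Longrightarrow> mat_val n e (X + Y) = mat_val n e X + mat_val n e Y"
  unfolding mat_val_def mat_sum_add by (rule mat_sum_cong) auto

lemma mat_val_mult:
  assumes "matrix_units n e" "X \<in> carrier_mat n n" "Y \<in> carrier_mat n n"
  shows "mat_val n e (X * Y) = mat_val n e X * mat_val n e Y"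
  unfolding mat_val_def mat_sum_mult[OF assms(1)]
  using assms(2,3) by (intro mat_sum_cong) (auto simp: scalar_prod_def lessThan_atLeast0)

lemma mat_val_smult: "X \<in> carrier_mat n n \<Longrightarrow> mat_val n e (c \<cdot>\<^sub>m X) = scaleC c (mat_val n e X)"
  unfolding mat_val_def mat_sum_scaleC by (rule mat_sum_cong) auto

lemma mat_val_adjoint:
  assumes "matrix_units n e" "X \<in> carrier_mat n n"
  shows "mat_val n e (mat_adjoint X) = adj (mat_val n e X)"
  unfolding mat_val_def mat_sum_adj[OF assms(1)]
  by (rule mat_sum_cong) (simp add: mat_adjoint_index[OF assms(2)])

lemma mat_val_zero: "mat_val n e (0\<^sub>m n n) = 0"
  unfolding mat_val_def mat_sum_def by (simp add: scaleC.zero_left)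

lemma mat_val_embedding:
  assumes mu: "matrix_units n e"
  shows "mat_val n e \<in> unital_embedding (matrix_algebra n) whole_algebra"
proof -
  have one: "mat_val n e (1\<^sub>m n) = 1"
    unfolding mat_val_def mat_sum_identity[OF mu, symmetric] by (rule mat_sum_cong) simp
  have "X = Y" if "X \<in> carrier_mat n n" "Y \<in> carrier_mat n n" "mat_val n e X = mat_val n e Y" for X Y
    using mat_sum_inj[OF mu that(3)[unfolded mat_val_def]] that(1,2) by (intro eq_matI) auto
  then have "inj_on (mat_val n e) (carrier_mat n n)" by (auto intro: inj_onI)
  then show ?thesis
    unfolding unital_embedding_def unital_star_hom_def Ring.ring_hom_def
    by (simp add: matrix_algebra_def whole_algebra_def mat_val_add mat_val_mult[OF mu] mat_val_smult one mat_val_adjoint[OF mu])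
qed

lemma mat_val_image: "mat_val n e ` carrier_mat n n = unit_span n e"
proof
  show "mat_val n e ` carrier_mat n n \<subseteq> unit_span n e" by (auto simp: mat_val_def unit_span_def)
  show "unit_span n e \<subseteq> mat_val n e ` carrier_mat n n"
  proof
    fix x assume "x \<in> unit_span n e"
    then obtain c where "x = mat_sum n c e" by (auto simp: unit_span_def)
    also have "\<dots> = mat_val n e (mat n n (\<lambda>(a, b). c a b))" unfolding mat_val_def by (rule mat_sum_cong) simp
    finally show "x \<in> mat_val n e ` carrier_mat n n" by auto
  qed
qed

lemma standard_special_point_carrier: "standard_special_point n m \<in> carrier_mat n n"
  by (simp add: standard_special_point_def prod_decode_pfst_psnd)

lemma mat_val_special:
  assumes "0 < n"
  shows "mat_val n e (standard_special_point n m) =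
    scaleC (gval (pfst m)) (e (pfst (psnd m) mod n) (psnd (psnd m) mod n))"
proof -
  let ?r = "pfst (psnd m) mod n" and ?t = "psnd (psnd m) mod n"
  have rt: "?r < n" "?t < n" using assms by auto
  have "mat_val n e (standard_special_point n m)
     = (\<Sum>a<n. \<Sum>b<n. if b = ?t then (if a = ?r then scaleC (gval (pfst m)) (e ?r ?t) else 0) else 0)"
    unfolding mat_val_def mat_sum_def
    by (intro sum.cong refl)
      (auto simp: standard_special_point_def prod_decode_pfst_psnd gval_def scaleC.zero_left)
  also have "\<dots> = scaleC (gval (pfst m)) (e ?r ?t)" using rt by simp
  finally show ?thesis .
qed

lemma mat_val_rational_point:
  assumes mu: "matrix_units n e"
  shows "mat_val n e (rational_point (matrix_algebra n) (standard_special_point n) q) = poly_val (unit_letter n e) q"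
proof -
  have n: "0 < n" using mu by (rule matrix_units_pos)
  have "mat_val n e (rational_point (matrix_algebra n) (standard_special_point n) q)
     = poly_val (\<lambda>l. mat_val n e (letter_point (matrix_algebra n) (standard_special_point n) l)) q"
    by (rule hom_rational_point)
      (auto simp: matrix_algebra_def letter_point_eq standard_special_point_carrier mat_adjoint_square
        mat_val_add mat_val_mult[OF mu] mat_val_smult mat_val_zero)
  also have "(\<lambda>l. mat_val n e (letter_point (matrix_algebra n) (standard_special_point n) l)) = unit_letter n e"
    by (rule ext) (simp add: letter_point_eq unit_letter_def Let_def matrix_algebra_def
      mat_val_special[OF n] mat_val_adjoint[OF mu standard_special_point_carrier])
  finally show ?thesis .
qed

lemma diag_block_mat_replicate_carrier:
  assumes "X \<in> carrier_mat n n"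
  shows "diag_block_mat (replicate d X) \<in> carrier_mat (d * n) (d * n)"
  using assms dim_diag_block_mat[of "replicate d X"] by (auto simp: sum_list_replicate)

lemma diag_block_mat_replicate_index:
  assumes X: "X \<in> carrier_mat n n" and "0 < n"
  shows "i < d * n \<Longrightarrow> j < d * n \<Longrightarrow> diag_block_mat (replicate d X) $$ (i, j) =
    (if i div n = j div n then X $$ (i mod n, j mod n) else 0)"
proof (induction d arbitrary: i j)
  case (Suc d)
  have dim: "dim_row (diag_block_mat (replicate d X)) = d * n" "dim_col (diag_block_mat (replicate d X)) = d * n"
    "dim_row X = n" "dim_col X = n"
    using diag_block_mat_replicate_carrier[OF X, of d] X by auto
  have dv: "i div n = Suc ((i - n) div n)" "i mod n = (i - n) mod n" if "\<not> i < n" for i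
    using that \<open>0 < n\<close> by (auto simp: le_div_geq le_mod_geq not_less)
  show ?case
    using Suc.prems Suc.IH[of "i - n" "j - n"]
    by (simp add: Let_def dim) (auto simp: dv[of i] dv[of j])
qed simp

text \<open>In the double sum over blocks only those on the diagonal survive. This turns the
  relation between two systems of units into compatibility of their embeddings with diag(X, ...,
  X).\<close>

lemma mat_val_diag_embedding:
  assumes n: "0 < n" and X: "X \<in> carrier_mat n n"
    and ef: "\<And>a b. a < n \<Longrightarrow> b < n \<Longrightarrow> e a b = diag_sum d n f a b"
  shows "mat_val (d * n) f (diag_block_mat (replicate d X)) = mat_val n e X"
proof -
  have "mat_val (d * n) f (diag_block_mat (replicate d X))
     = (\<Sum>l<d. \<Sum>a<n. \<Sum>k<d. \<Sum>b<n.
         scaleC (diag_block_mat (replicate d X) $$ (a + l * n, b + k * n)) (f (a + l * n) (b + k * n)))"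
    unfolding mat_val_def mat_sum_def sum_lessThan_mult ..
  also have "\<dots> = (\<Sum>l<d. \<Sum>a<n. \<Sum>k<d. if k = l then (\<Sum>b<n. scaleC (X $$ (a, b)) (f (a + l * n) (b + l * n))) else 0)"
    using n by (intro sum.cong refl)
      (auto simp: diag_block_mat_replicate_index[OF X n] add_mult_less scaleC.zero_left intro!: sum.cong sum.neutral)
  also have "\<dots> = (\<Sum>l<d. \<Sum>a<n. \<Sum>b<n. scaleC (X $$ (a, b)) (f (a + l * n) (b + l * n)))" by simp
  also have "\<dots> = (\<Sum>a<n. \<Sum>b<n. \<Sum>l<d. scaleC (X $$ (a, b)) (f (a + l * n) (b + l * n)))"
    by (subst sum.swap, rule sum.cong[OF refl], rule sum.swap)
  also have "\<dots> = mat_val n e X"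
    unfolding mat_val_def mat_sum_def by (intro sum.cong refl) (simp add: ef diag_sum_def scaleC.sum_right)
  finally show ?thesis .
qed

section \<open>Matrix units obtained from unital *-homomorphisms\<close>

definition elementary_mat :: "nat \<Rightarrow> nat \<Rightarrow> nat \<Rightarrow> complex mat" where
  "elementary_mat n a b = mat n n (\<lambda>(i, j). if i = a \<and> j = b then 1 else 0)"

lemma elementary_mat_carrier [simp]: "elementary_mat n a b \<in> carrier_mat n n"
  by (simp add: elementary_mat_def)

lemma elementary_mat_mult:
  assumes "a < n" "b < n" "c < n" "d < n"
  shows "elementary_mat n a b * elementary_mat n c d = (if b = c then elementary_mat n a d else 0\<^sub>m n n)"
proof (rule eq_matI)
  fix i j assume "i < dim_row (if b = c then elementary_mat n a d else 0\<^sub>m n n)"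
    "j < dim_col (if b = c then elementary_mat n a d else 0\<^sub>m n n)"
  then have ij: "i < n" "j < n" by (auto simp: elementary_mat_def split: if_splits)
  then have "(elementary_mat n a b * elementary_mat n c d) $$ (i, j)
     = (\<Sum>k\<in>{0..<n}. (if i = a \<and> k = b then 1 else 0) * (if k = c \<and> j = d then 1 else 0))"
    by (simp add: elementary_mat_def scalar_prod_def)
  also have "\<dots> = (\<Sum>k\<in>{0..<n}. if k = b then (if i = a \<and> b = c \<and> j = d then 1 else 0) else 0)"
    by (intro sum.cong refl) auto
  also have "\<dots> = (if b = c then elementary_mat n a d else 0\<^sub>m n n) $$ (i, j)"
    using ij assms by (simp add: elementary_mat_def)
  finally show "(elementary_mat n a b * elementary_mat n c d) $$ (i, j)
    = (if b = c then elementary_mat n a d else 0\<^sub>m n n) $$ (i, j)" .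
qed (auto simp: elementary_mat_def)

lemma star_hom_matrix_units:
  assumes h: "h \<in> unital_star_hom (matrix_algebra n) (whole_algebra :: 'a::unital_cstar_algebra star_algebra)"
  defines "e \<equiv> \<lambda>a b. h (elementary_mat n a b)"
  shows "matrix_units n e" "h ` carrier_mat n n = unit_span n e"
proof -
  have add: "h (X + Y) = h X + h Y" and mult: "h (X * Y) = h X * h Y"
    if "X \<in> carrier_mat n n" "Y \<in> carrier_mat n n" for X Y
    using h that by (auto simp: unital_star_hom_def Ring.ring_hom_def matrix_algebra_def whole_algebra_def)
  have one: "h (1\<^sub>m n) = 1"
    using h by (auto simp: unital_star_hom_def Ring.ring_hom_def matrix_algebra_def whole_algebra_def)
  have smult: "h (c \<cdot>\<^sub>m X) = scaleC c (h X)" and adj: "h (mat_adjoint X) = adj (h X)"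
    if "X \<in> carrier_mat n n" for X c
    using h that by (auto simp: unital_star_hom_def matrix_algebra_def whole_algebra_def)
  have zero: "h (0\<^sub>m n n) = 0" using add[of "0\<^sub>m n n" "0\<^sub>m n n"] by simp
  \<comment> \<open>Additivity of h is binary, so its expansion in matrix units is proved by adding
    one entry at a time.\<close>
  have part: "h (mat n n (\<lambda>p. if p \<in> S then case p of (a, b) \<Rightarrow> c a b else 0)) = (\<Sum>(a, b)\<in>S. scaleC (c a b) (e a b))"
    if "finite S" "S \<subseteq> {..<n} \<times> {..<n}" for S c
    using that
  proof (induction S rule: finite_induct)
    case empty
    have "mat n n (\<lambda>p. if p \<in> {} then case p of (a, b) \<Rightarrow> c a b else 0) = 0\<^sub>m n n" by (rule eq_matI) auto
    then show ?case by (simp add: zero)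
  next
    case (insert p S)
    obtain a b where p: "p = (a, b)" by (cases p)
    have "mat n n (\<lambda>q. if q \<in> insert p S then case q of (a, b) \<Rightarrow> c a b else 0)
      = c a b \<cdot>\<^sub>m elementary_mat n a b + mat n n (\<lambda>q. if q \<in> S then case q of (a, b) \<Rightarrow> c a b else 0)"
      using insert.hyps by (intro eq_matI) (auto simp: p elementary_mat_def)
    then show ?case using insert by (simp add: add smult p e_def)
  qed
  have full: "h X = mat_sum n (\<lambda>a b. X $$ (a, b)) e" if X: "X \<in> carrier_mat n n" for X
  proof -
    have "X = mat n n (\<lambda>p. if p \<in> {..<n} \<times> {..<n} then case p of (a, b) \<Rightarrow> X $$ (a, b) else 0)"
      using X by (intro eq_matI) auto
    then have "h X = (\<Sum>(a, b)\<in>{..<n} \<times> {..<n}. scaleC (X $$ (a, b)) (e a b))"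
      using part[of "{..<n} \<times> {..<n}" "\<lambda>a b. X $$ (a, b)"] by simp
    then show ?thesis by (simp add: mat_sum_def sum.cartesian_product)
  qed
  show "matrix_units n e"
    unfolding matrix_units_def
  proof (intro conjI allI impI)
    fix a b assume ab: "a < n" "b < n"
    have "mat_adjoint (elementary_mat n a b) = elementary_mat n b a"
    proof (rule eq_matI)
      fix i j assume "i < dim_row (elementary_mat n b a)" "j < dim_col (elementary_mat n b a)"
      then have "i < n" "j < n" by (auto simp: elementary_mat_def)
      then show "mat_adjoint (elementary_mat n a b) $$ (i, j) = elementary_mat n b a $$ (i, j)"
        by (subst mat_adjoint_index[of _ n]) (auto simp: elementary_mat_def)
    qed (use mat_adjoint_square[of "elementary_mat n a b" n] in \<open>auto simp: elementary_mat_def\<close>)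
    then show "adj (e a b) = e b a" using adj[of "elementary_mat n a b"] by (simp add: e_def)
    fix c d assume "c < n" "d < n"
    with ab show "e a b * e c d = (if b = c then e a d else 0)"
      using mult[of "elementary_mat n a b" "elementary_mat n c d"] by (auto simp: e_def elementary_mat_mult zero)
  next
    have "(\<Sum>a<n. e a a) = (\<Sum>a<n. \<Sum>b<n. if b = a then e a b else 0)" by simp
    also have "\<dots> = mat_sum n (\<lambda>a b. 1\<^sub>m n $$ (a, b)) e"
      unfolding mat_sum_def by (intro sum.cong refl) (auto simp: scaleC.zero_left)
    also have "\<dots> = 1" using full[of "1\<^sub>m n"] one by simp
    finally show "(\<Sum>a<n. e a a) = 1" .
  qed
  have "h ` carrier_mat n n = mat_val n e ` carrier_mat n n"
    by (intro image_cong refl) (simp add: full mat_val_def)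
  then show "h ` carrier_mat n n = unit_span n e" by (simp add: mat_val_image)
qed

text \<open>The maps \<mu> j carry the standard matrix units into the algebra, which replaces the
  inductive limit by a nested chain of spans inside it, without reference to the connecting
  maps.\<close>

lemma UHF_matrix_units_chain:
  assumes "UHF_algebra TYPE('a::unital_cstar_algebra)"
  shows "\<exists>n (e :: nat \<Rightarrow> nat \<Rightarrow> nat \<Rightarrow> 'a). (\<forall>j. matrix_units (n j) (e j)) \<and>
    (\<forall>j. unit_span (n j) (e j) \<subseteq> unit_span (n (Suc j)) (e (Suc j))) \<and>
    closure (\<Union>j. unit_span (n j) (e j)) = UNIV"
proof -
  obtain n \<phi> and \<mu> :: "nat \<Rightarrow> complex mat \<Rightarrow> 'a" where
    \<phi>: "\<And>j. \<phi> j \<in> unital_embedding (matrix_algebra (n j)) (matrix_algebra (n (Suc j)))"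
    and lim: "matrix_inductive_limit n \<phi> \<mu>"
    using assms unfolding UHF_algebra_def by blast
  define e where "e j a b = \<mu> j (elementary_mat (n j) a b)" for j a b
  have hom: "\<mu> j \<in> unital_star_hom (matrix_algebra (n j)) whole_algebra" for j
    using lim by (simp add: matrix_inductive_limit_def)
  have mu: "matrix_units (n j) (e j)" and im: "\<mu> j ` carrier_mat (n j) (n j) = unit_span (n j) (e j)" for j
    using star_hom_matrix_units[OF hom[of j]] by (simp_all add: e_def[abs_def])
  have "\<mu> j ` carrier_mat (n j) (n j) \<subseteq> \<mu> (Suc j) ` carrier_mat (n (Suc j)) (n (Suc j))" for j
  proof
    fix x assume "x \<in> \<mu> j ` carrier_mat (n j) (n j)"
    then obtain Y where Y: "Y \<in> carrier_mat (n j) (n j)" "x = \<mu> j Y" by blast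
    have "\<phi> j Y \<in> carrier_mat (n (Suc j)) (n (Suc j))"
      using \<phi>[of j] Y(1) by (auto simp: unital_embedding_def unital_star_hom_def Ring.ring_hom_def matrix_algebra_def)
    moreover have "\<mu> (Suc j) (\<phi> j Y) = x" using lim Y by (simp add: matrix_inductive_limit_def)
    ultimately show "x \<in> \<mu> (Suc j) ` carrier_mat (n (Suc j)) (n (Suc j))" by blast
  qed
  moreover have "closure (\<Union>j. \<mu> j ` carrier_mat (n j) (n j)) = UNIV"
    using lim by (simp add: matrix_inductive_limit_def)
  ultimately show ?thesis using mu unfolding im by blast
qed

section \<open>Assembly of the computable certificate\<close>

lemma matrix_units_one: "matrix_units (Suc 0) (\<lambda>a b. 1)"
  by (simp add: matrix_units_def)

theorem theorem4p9:
  fixes s :: "nat \<Rightarrow> 'a::unital_cstar_algebra"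
  assumes "UHF_algebra TYPE('a)"
    and "computable_presentation s"
  shows "\<exists>n \<psi>. computable_UHF_certificate s n \<psi> \<and>
    (\<forall>j. n j dvd n (Suc j) \<and>
       (\<forall>X\<in>carrier_mat (n j) (n j).
          inv_into (carrier_mat (n (Suc j)) (n (Suc j))) (\<psi> (Suc j)) (\<psi> j X) =
            diag_embedding (n j) (n (Suc j)) X))"
proof -
  have pres: "presentation s" using assms(2) by (simp add: computable_presentation_def)
  obtain F where F: "total_recursive 2 F"
    "\<And>q k. \<bar>norm (rational_point whole_algebra s q) - of_rat (rat_of_code (F [q, k]))\<bar> < (1/2) ^ k"
    using assms(2) unfolding computable_presentation_def by blast
  \<comment> \<open>A single code, which enters the search as a constant; its mere existence is
    enough for computability.\<close>
  obtain u where u: "norm (eval_point s u - 1) < (1/2) ^ 4"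
    using closure_normI[OF eval_point_dense[OF pres], of "(1/2) ^ 4" 1] by auto
  have cF: "computable (\<lambda>z. F [pfst z, psnd z])"
  proof -
    have "total_rec_agree (length [\<lambda>xs. pfst (xs ! 0), \<lambda>xs. psnd (xs ! 0)]) F"
      using F(1) by (auto simp: total_rec_agree_def numeral_2_eq_2)
    then have "total_rec_agree (Suc 0) (\<lambda>xs. F (map (\<lambda>g. g xs) [\<lambda>xs. pfst (xs ! 0), \<lambda>xs. psnd (xs ! 0)]))"
      by (rule total_rec_agree_comp_list) (auto intro!: total_rec_agree_pfst total_rec_agree_psnd total_rec_agree_proj)
    then show ?thesis by (simp add: computable_def)
  qed
  interpret normed_presentation s "\<lambda>q k. F [q, k]" u
    by unfold_locales (use pres cF F(2) u in \<open>simp_all add: eval_point_def rval_def\<close>)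
  obtain m and c :: "nat \<Rightarrow> nat \<Rightarrow> nat \<Rightarrow> 'a" where c: "\<And>j. matrix_units (m j) (c j)"
    "\<And>j. unit_span (m j) (c j) \<subseteq> unit_span (m (Suc j)) (c (Suc j))"
    "closure (\<Union>j. unit_span (m j) (c j)) = UNIV"
    using UHF_matrix_units_chain[OF assms(1)] by blast
  obtain y where "\<forall>\<^sub>F i in sequentially. good (y i)"
    using states_near_units[OF matrix_units_one, of 0 0] by (elim exE conjE)
  from eventually_happens'[OF sequentially_bot this] obtain x0 where x0: "good x0" by blast
  have ex: "\<exists>y. good y \<and> step k x y" if "good x" for x k by (rule next_state_exists[OF c that])
  obtain X where X': "computable X \<and> (\<forall>k. good (X k)) \<and> (\<forall>k. step k (X k) (X (Suc k)))"
    using computable_states_exist[OF ex x0] ..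
  then have cX: "computable X" and X: "\<And>k. good (X k)" "\<And>k. step k (X k) (X (Suc k))"
    by simp_all
  define n where "n j = state_dim (X j)" for j
  obtain e where e': "(\<forall>j. matrix_units (n j) (e j)) \<and>
     (\<forall>j. \<forall>a<n j. \<forall>b<n j. e j a b = diag_sum (n (Suc j) div n j) (n j) (e (Suc j)) a b) \<and>
     (\<forall>j i. j \<le> i \<longrightarrow> (\<forall>a<n j. \<forall>b<n j.
        norm (e j a b - ev (diag_code (X i) (n j) a b)) \<le> 3 * (1/2) ^ limit_exp (state_prec (X i))))"
    using limit_units_exist[OF X] unfolding n_def ..
  note e1 = conjunct1[OF e', rule_format] and e2 = conjunct1[OF conjunct2[OF e'], rule_format]
    and e3 = conjunct2[OF conjunct2[OF e'], rule_format]
  have n: "0 < n j" for j using e1 by (rule matrix_units_pos)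
  have dvd: "n j dvd n (Suc j)" for j using X_dim_dvd[OF X, of j "Suc j"] by (simp add: n_def)
  define \<psi> where "\<psi> j = mat_val (n j) (e j)" for j
  have emb: "\<psi> j \<in> unital_embedding (matrix_algebra (n j)) whole_algebra" for j
    unfolding \<psi>_def by (rule mat_val_embedding[OF e1])
  have step_\<psi>: "diag_embedding (n j) (n (Suc j)) Y \<in> carrier_mat (n (Suc j)) (n (Suc j))"
    "\<psi> (Suc j) (diag_embedding (n j) (n (Suc j)) Y) = \<psi> j Y" if Y: "Y \<in> carrier_mat (n j) (n j)" for j Y
    using diag_block_mat_replicate_carrier[OF Y, of "n (Suc j) div n j"]
      mat_val_diag_embedding[OF n Y e2] dvd[of j]
    by (simp_all add: diag_embedding_def \<psi>_def)
  have im: "\<psi> j ` carrier_mat (n j) (n j) = unit_span (n j) (e j)" for j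
    unfolding \<psi>_def by (rule mat_val_image)
  have "UHF_certificate n \<psi>"
    unfolding UHF_certificate_def
  proof (intro conjI allI)
    show "\<psi> j ` carrier_mat (n j) (n j) \<subseteq> \<psi> (Suc j) ` carrier_mat (n (Suc j)) (n (Suc j))" for j
    proof
      fix x assume "x \<in> \<psi> j ` carrier_mat (n j) (n j)"
      then obtain Y where Y: "Y \<in> carrier_mat (n j) (n j)" "x = \<psi> j Y" by blast
      then have "x = \<psi> (Suc j) (diag_embedding (n j) (n (Suc j)) Y)" by (simp add: step_\<psi>)
      then show "x \<in> \<psi> (Suc j) ` carrier_mat (n (Suc j)) (n (Suc j))" using step_\<psi>(1)[OF Y(1)] by blast
    qed
    show "closure (\<Union>j. \<psi> j ` carrier_mat (n j) (n j)) = UNIV"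
      unfolding im unfolding n_def using e1 e3 by (intro limit_units_dense[OF X]) (simp_all add: n_def)
  qed (use n emb in auto)
  moreover have "\<exists>F. total_recursive 1 F \<and> (\<forall>j. n j = F [j])"
  proof -
    have "computable n" unfolding n_def by (intro computable_intros cX)
    then obtain g where "total_recursive 1 g" "\<forall>xs. length xs = 1 \<longrightarrow> g xs = n (xs ! 0)"
      unfolding computable_def total_rec_agree_def One_nat_def by blast
    then show ?thesis by (intro exI[of _ g]) simp
  qed
  moreover have "uniformly_computable_maps (\<lambda>j. matrix_algebra (n j)) (\<lambda>j. standard_special_point (n j)) s \<psi>"
  proof -
    \<comment> \<open>The stage j + q + k meets three demands at once: it is not before j, its
      precision bounds q, and its error is below 2^-k.\<close>
    define G where "G z = subst_code (X (pfst z + pfst (psnd z) + psnd (psnd z))) (n (pfst z)) (pfst (psnd z))" for z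
    have "computable G" unfolding G_def n_def
      by (intro computable_intros computable_compose[OF cX])
    then have "total_rec_agree 3 (\<lambda>xs. G (pair (xs ! 0) (pair (xs ! 1) (xs ! 2))))"
      by (rule total_rec_agree_computable) (intro total_rec_agree_pair total_rec_agree_proj; simp)
    then obtain H where H: "total_recursive 3 H"
      "\<And>xs. length xs = 3 \<Longrightarrow> H xs = G (pair (xs ! 0) (pair (xs ! 1) (xs ! 2)))"
      unfolding total_rec_agree_def by blast
    have "norm (\<psi> j (rational_point (matrix_algebra (n j)) (standard_special_point (n j)) q)
        - rational_point whole_algebra s (H [j, q, k])) < (1/2) ^ k" for j q k
    proof -
      have i: "j + q + k \<le> state_prec (X (j + q + k))" by (rule X_prec_ge[OF X])
      have "norm (poly_val (unit_letter (n j) (e j)) q - ev (subst_code (X (j + q + k)) (n j) q))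
         < (1/2) ^ state_prec (X (j + q + k))"
        unfolding n_def
        by (rule subst_code_near[OF X]) (use e1 e3 i in \<open>auto simp: n_def\<close>)
      also have "\<dots> \<le> (1/2) ^ k" using i by (intro power_decreasing) auto
      finally show ?thesis
        by (simp add: \<psi>_def mat_val_rational_point[OF e1] H(2) G_def eval_point_def)
    qed
    with H(1) show ?thesis unfolding uniformly_computable_maps_def by blast
  qed
  ultimately have "computable_UHF_certificate s n \<psi>" by (simp add: computable_UHF_certificate_def)
  moreover have "inv_into (carrier_mat (n (Suc j)) (n (Suc j))) (\<psi> (Suc j)) (\<psi> j Y) = diag_embedding (n j) (n (Suc j)) Y"
    if "Y \<in> carrier_mat (n j) (n j)" for j Y
  proof -
    have "inj_on (\<psi> (Suc j)) (carrier_mat (n (Suc j)) (n (Suc j)))"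
      using emb[of "Suc j"] by (simp add: unital_embedding_def matrix_algebra_def)
    from inv_into_f_f[OF this step_\<psi>(1)[OF that]] show ?thesis by (simp add: step_\<psi>(2)[OF that])
  qed
  ultimately show ?thesis using dvd by blast
qed

end
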